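(* Let $L/\mathbb{Q}$ be a finite Galois extension. The $\mathbb{Q}$-span of the matrix entries of $F_{\mathcal{A},L}$ (with respect to any $\mathbb{Q}$-basis of $L$) is equal to the set of elements $(g(\phi_p)\bmod p)_p\in\mathcal{A}$ for $g\in A(L)$.
   Context: $\mathcal{A}=\left(\prod_p\mathbb{F}_p\right)/\left(\bigoplus_p\mathbb{F}_p\right)$ over all rational primes, elements being sequences $(a_p)_p$, $a_p\in\mathbb{F}_p$, equal if they agree for all sufficiently large $p$. With $\mathcal{O}_L$ the ring of integers of $L$, there is an $\mathcal{A}$-algebra isomorphism $L\otimes_{\mathbb{Q}}\mathcal{A}\cong\left(\prod_p\mathcal{O}_L/p\mathcal{O}_L\right)/\left(\bigoplus_p\mathcal{O}_L/p\mathcal{O}_L\right)$; the $\mathcal{A}$-valued Frobenius automorphism $F_{\mathcal{A},L}$ is the $\mathcal{A}$-algebra automorphism of $L\otimes_{\mathbb{Q}}\mathcal{A}$ induced by the $p$-th power map of $\mathcal{O}_L/p\mathcal{O}_L$ in the $p$-th factor. Choosing a $\mathbb{Q}$-basis of $L$ represents it as a square matrix over $\mathcal{A}$; the $\mathbb{Q}$-span of its entries is basis-independent. $A(L)$ is the set of functions $g:\Gamma\to L$, $\Gamma=\mathrm{Gal}(L/\mathbb{Q})$, with $g(\sigma\tau\sigma^{-1})=\sigma(g(\tau))$ for all $\sigma,\tau$. For $p$ unramified in $L$ and coprime to the denominators of the values of $g$, and $\mathfrak{P}$ a prime over $p$ with Frobenius $\phi_{\mathfrak{P}}$, $g(\phi_{\mathfrak{P}})\bmod\mathfrak{P}$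 lies in $\mathbb{F}_p$ and is independent of $\mathfrak{P}$; it is denoted $g(\phi_p)\bmod p$. *)

theory Defs
  imports
    "HOL-Number_Theory.Number_Theory"
    "HOL-Algebra.Algebraic_Closure_Type"
    "HOL-Algebra.Ideal_Product"
    "HOL-Library.Poly_Mapping"
    "Jordan_Normal_Form.Char_Poly"
begin

hide_const (open) Divisibility.prime Coset.order

section \<open>Algebraic integers are closed under the ring operations\<close>

lemma algebraic_int_of_integral_action:
  fixes z :: "'a :: field_char_0" and v :: "'i \<Rightarrow> 'a"
  assumes fin: "finite S" and ne: "i0 \<in> S" "v i0 \<noteq> 0"
    and act: "\<And>i. i \<in> S \<Longrightarrow> \<exists>c::'i \<Rightarrow> int. z * v i = (\<Sum>j\<in>S. of_int (c j) * v j)"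
  shows "algebraic_int z"
proof -
  obtain C :: "'i \<Rightarrow> 'i \<Rightarrow> int" where
    C: "\<And>i. i \<in> S \<Longrightarrow> z * v i = (\<Sum>j\<in>S. of_int (C i j) * v j)"
    using act by metis
  obtain h where h: "bij_betw h {..<card S} S"
    using ex_bij_betw_nat_finite[OF fin] by (auto simp: atLeast0LessThan)
  define n where "n = card S"
  define M :: "int mat" where "M = mat n n (\<lambda>(i,j). C (h i) (h j))"
  define A :: "'a mat" where "A = map_mat of_int M"
  define w :: "'a vec" where "w = vec n (\<lambda>i. v (h i))"
  have M: "M \<in> carrier_mat n n" by (simp add: M_def)
  have A: "A \<in> carrier_mat n n" by (simp add: A_def M_def)
  obtain k0 where k0: "k0 < n" "h k0 = i0"
    using h ne(1) unfolding bij_betw_def n_def by (metis imageE lessThan_iff)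
  have "w \<noteq> 0\<^sub>v n"
  proof
    assume "w = 0\<^sub>v n"
    hence "w $ k0 = 0" using k0 by simp
    thus False using k0 ne(2) by (simp add: w_def)
  qed
  moreover have "A *\<^sub>v w = z \<cdot>\<^sub>v w"
  proof (rule eq_vecI)
    fix i assume "i < dim_vec (z \<cdot>\<^sub>v w)"
    hence i: "i < n" by (simp add: w_def)
    hence hi: "h i \<in> S" using h by (auto simp: bij_betw_def n_def)
    have "(A *\<^sub>v w) $ i = (\<Sum>j<n. of_int (C (h i) (h j)) * v (h j))"
      using i by (simp add: A_def M_def w_def scalar_prod_def atLeast0LessThan)
    also have "\<dots> = (\<Sum>j\<in>S. of_int (C (h i) j) * v j)"
      using h unfolding n_def by (rule sum.reindex_bij_betw)
    also have "\<dots> = z * v (h i)" using C[OF hi] by simp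
    finally show "(A *\<^sub>v w) $ i = (z \<cdot>\<^sub>v w) $ i" using i by (simp add: w_def)
  qed (simp add: A_def M_def w_def)
  ultimately have "eigenvalue A z"
    unfolding eigenvalue_def eigenvector_def using A by (intro exI[of _ w]) (auto simp: w_def)
  hence "poly (char_poly A) z = 0" using eigenvalue_root_char_poly[OF A] by simp
  moreover have "char_poly A = map_poly of_int (char_poly M)"
    unfolding A_def using M by (rule of_int_hom.char_poly_hom)
  moreover have "lead_coeff (char_poly M) = 1"
    using degree_monic_char_poly[OF M] by simp
  ultimately show ?thesis unfolding algebraic_int_altdef_ipoly by metis
qed

lemma algebraic_int_power_relation:
  fixes x :: "'a :: field_char_0"
  assumes "algebraic_int x"
  obtains n :: nat and c :: "nat \<Rightarrow> int" where "n > 0" "x ^ n = (\<Sum>k<n. of_int (c k) * x ^ k)"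
proof -
  obtain p :: "int poly" where p: "poly (map_poly of_int p) x = 0" "lead_coeff p = 1"
    using assms unfolding algebraic_int_altdef_ipoly by blast
  define n where "n = degree p"
  have deg: "degree (map_poly of_int p :: 'a poly) = n" by (simp add: n_def)
  have "0 = (\<Sum>k\<le>n. of_int (coeff p k) * x ^ k)"
    using p(1) unfolding poly_altdef deg by simp
  also have "\<dots> = (\<Sum>k<n. of_int (coeff p k) * x ^ k) + x ^ n"
    using p(2) by (simp add: n_def lessThan_Suc_atMost[symmetric])
  finally have "x ^ n = - (\<Sum>k<n. of_int (coeff p k) * x ^ k)"
    by (simp add: eq_neg_iff_add_eq_0 add.commute)
  hence eq: "x ^ n = (\<Sum>k<n. of_int (- coeff p k) * x ^ k)" by (simp add: sum_negf)
  have "n > 0"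
  proof (rule ccontr)
    assume "\<not> n > 0"
    with eq show False by simp
  qed
  with eq show ?thesis by (intro that)
qed

lemma
  fixes x y :: "'a :: field_char_0"
  assumes x: "algebraic_int x" and y: "algebraic_int y"
  shows algebraic_int_add [intro]: "algebraic_int (x + y)"
    and algebraic_int_mult [intro]: "algebraic_int (x * y)"
proof -
  obtain n c where n: "n > 0" "x ^ n = (\<Sum>k<n. of_int (c k) * x ^ k)"
    using algebraic_int_power_relation[OF x] .
  obtain m d where m: "m > 0" "y ^ m = (\<Sum>k<m. of_int (d k) * y ^ k)"
    using algebraic_int_power_relation[OF y] .
  define S where "S = {..<n} \<times> {..<m}"
  define v where "v = (\<lambda>(i,j). x ^ i * y ^ j)"
  define M where "M = {w. \<exists>c::nat \<times> nat \<Rightarrow> int. w = (\<Sum>j\<in>S. of_int (c j) * v j)}"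
  have fin: "finite S" by (simp add: S_def)
  have M0: "0 \<in> M" unfolding M_def by (auto intro: exI[of _ "\<lambda>_. 0"])
  have Madd: "a + b \<in> M" if ab: "a \<in> M" "b \<in> M" for a b
  proof -
    obtain e f where "a = (\<Sum>j\<in>S. of_int (e j) * v j)" "b = (\<Sum>j\<in>S. of_int (f j) * v j)"
      using ab unfolding M_def by blast
    hence "a + b = (\<Sum>j\<in>S. of_int (e j + f j) * v j)"
      by (simp add: sum.distrib distrib_right)
    thus ?thesis unfolding M_def mem_Collect_eq by (intro exI)
  qed
  have Mscale: "of_int k * a \<in> M" if a: "a \<in> M" for k a
  proof -
    obtain e where "a = (\<Sum>j\<in>S. of_int (e j) * v j)" using a unfolding M_def by blast
    hence "of_int k * a = (\<Sum>j\<in>S. of_int (k * e j) * v j)"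
      by (simp add: sum_distrib_left mult.assoc)
    thus ?thesis unfolding M_def mem_Collect_eq by (intro exI)
  qed
  have Msum: "(\<Sum>i\<in>T. f i) \<in> M" if "\<And>i. i \<in> T \<Longrightarrow> f i \<in> M" for T :: "nat set" and f
    using that by (induction T rule: infinite_finite_induct) (auto simp: M0 intro: Madd)
  have Msum': "(\<Sum>i\<in>T. f i) \<in> M" if "\<And>i. i \<in> T \<Longrightarrow> f i \<in> M" for T :: "(nat \<times> nat) set" and f
    using that by (induction T rule: infinite_finite_induct) (auto simp: M0 intro: Madd)
  have Mv: "x ^ i * y ^ j \<in> M" if "i < n" "j < m" for i j
  proof -
    have "x ^ i * y ^ j = (\<Sum>s\<in>S. of_int (if s = (i,j) then 1 else 0) * v s)"
      using that fin by (simp add: S_def v_def if_distrib[of of_int] if_distribR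
          if_distrib[of "\<lambda>u. u * _"] sum.delta cong: if_cong)
    thus ?thesis unfolding M_def mem_Collect_eq by (intro exI)
  qed
  have xv: "x * (x ^ i * y ^ j) \<in> M" if ij: "i < n" "j < m" for i j
  proof (cases "Suc i < n")
    case True
    thus ?thesis using Mv[of "Suc i" j] ij by (simp add: mult.assoc)
  next
    case False
    hence "Suc i = n" using ij by simp
    hence "x * (x ^ i * y ^ j) = x ^ n * y ^ j" by auto
    also have "\<dots> = (\<Sum>k<n. of_int (c k) * (x ^ k * y ^ j))"
      unfolding n(2) by (simp add: sum_distrib_right mult.assoc)
    also have "\<dots> \<in> M" using ij by (intro Msum Mscale Mv) auto
    finally show ?thesis .
  qed
  have yv: "y * (x ^ i * y ^ j) \<in> M" if ij: "i < n" "j < m" for i j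
  proof (cases "Suc j < m")
    case True
    thus ?thesis using Mv[of i "Suc j"] ij by (simp add: mult_ac)
  next
    case False
    hence "Suc j = m" using ij by simp
    hence "y * (x ^ i * y ^ j) = x ^ i * y ^ m" by (auto simp: mult_ac)
    also have "\<dots> = (\<Sum>k<m. of_int (d k) * (x ^ i * y ^ k))"
      unfolding m(2) by (simp add: sum_distrib_left mult_ac)
    also have "\<dots> \<in> M" using ij by (intro Msum Mscale Mv) auto
    finally show ?thesis .
  qed
  have xM: "x * a \<in> M" if a: "a \<in> M" for a
  proof -
    obtain e where "a = (\<Sum>j\<in>S. of_int (e j) * v j)" using a unfolding M_def by blast
    hence "x * a = (\<Sum>j\<in>S. of_int (e j) * (x * v j))" by (simp add: sum_distrib_left mult_ac)
    also have "\<dots> \<in> M" using xv by (intro Msum' Mscale) (auto simp: S_def v_def)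
    finally show ?thesis .
  qed
  have yM: "y * a \<in> M" if a: "a \<in> M" for a
  proof -
    obtain e where "a = (\<Sum>j\<in>S. of_int (e j) * v j)" using a unfolding M_def by blast
    hence "y * a = (\<Sum>j\<in>S. of_int (e j) * (y * v j))" by (simp add: sum_distrib_left mult_ac)
    also have "\<dots> \<in> M" using yv by (intro Msum' Mscale) (auto simp: S_def v_def)
    finally show ?thesis .
  qed
  have vM: "v s \<in> M" if "s \<in> S" for s using that Mv by (auto simp: S_def v_def)
  have key: "algebraic_int z" if "\<And>a. a \<in> M \<Longrightarrow> z * a \<in> M" for z
  proof (rule algebraic_int_of_integral_action[OF fin])
    show "(0,0) \<in> S" "v (0,0) \<noteq> 0" using n m by (auto simp: S_def v_def)
    show "\<exists>c::nat \<times> nat \<Rightarrow> int. z * v i = (\<Sum>j\<in>S. of_int (c j) * v j)" if "i \<in> S" for i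
      using \<open>\<And>a. a \<in> M \<Longrightarrow> z * a \<in> M\<close>[OF vM[OF that]] unfolding M_def by blast
  qed
  show "algebraic_int (x + y)" by (rule key) (auto simp: distrib_right intro: Madd xM yM)
  show "algebraic_int (x * y)" by (rule key) (auto simp: mult.assoc intro: xM yM)
qed

lemma algebraic_int_diff [intro]:
  "algebraic_int x \<Longrightarrow> algebraic_int y \<Longrightarrow> algebraic_int (x - y)" for x y :: "'a :: field_char_0"
  using algebraic_int_add[of x "- y"] by simp


section \<open>Number fields and their rings of integers\<close>

text \<open>The field \<open>L\<close> is the whole type; \<open>\<rat>\<close> sits in it via \<open>of_rat\<close>.\<close>
class number_field = field_char_0 +
  assumes finite_dimensional:
    "\<exists>B::'a set. finite B \<and> (\<forall>x. \<exists>c::'a \<Rightarrow> rat. x = (\<Sum>b\<in>B. of_rat (c b) * b))"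

instance rat :: number_field
proof
  show "\<exists>B::rat set. finite B \<and> (\<forall>x. \<exists>c::rat \<Rightarrow> rat. x = (\<Sum>b\<in>B. of_rat (c b) * b))"
    by (rule exI[of _ "{1}"]) auto
qed

interpretation L: vector_space "\<lambda>(q::rat) (x::'a::field_char_0). of_rat q * x"
  by unfold_locales (simp_all add: of_rat_add of_rat_mult algebra_simps)

definition gal :: "('a :: field_char_0 \<Rightarrow> 'a) set" where
  "gal = {\<sigma>. bij \<sigma> \<and> (\<forall>x y. \<sigma> (x + y) = \<sigma> x + \<sigma> y) \<and> (\<forall>x y. \<sigma> (x * y) = \<sigma> x * \<sigma> y) \<and>
              (\<forall>q. \<sigma> (of_rat q) = of_rat q)}"

text \<open>In characteristic \<open>0\<close>, with finiteness supplied by the class \<open>number_field\<close>, this is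
  Artin's definition: the fixed field of the automorphism group is \<open>\<rat>\<close>.\<close>
definition galois :: "'a :: field_char_0 itself \<Rightarrow> bool" where
  "galois _ \<longleftrightarrow> {x::'a. \<forall>\<sigma>\<in>gal. \<sigma> x = x} = range of_rat"

typedef (overloaded) 'a algint = "{x :: 'a :: field_char_0. algebraic_int x}"
  morphisms of_algint to_algint
  by auto

setup_lifting type_definition_algint

instantiation algint :: (field_char_0) idom
begin
lift_definition zero_algint :: "'a algint" is 0 by simp
lift_definition one_algint :: "'a algint" is 1 by simp
lift_definition plus_algint :: "'a algint \<Rightarrow> 'a algint \<Rightarrow> 'a algint" is "(+)" by auto
lift_definition minus_algint :: "'a algint \<Rightarrow> 'a algint \<Rightarrow> 'a algint" is "(-)" by auto
lift_definition uminus_algint :: "'a algint \<Rightarrow> 'a algint" is uminus by auto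
lift_definition times_algint :: "'a algint \<Rightarrow> 'a algint \<Rightarrow> 'a algint" is "(*)" by auto
instance by standard (transfer; simp add: algebra_simps)+
end

lemma of_algint_of_nat [simp]: "of_algint (of_nat n) = of_nat n"
  by (induction n) (simp_all add: zero_algint.rep_eq one_algint.rep_eq plus_algint.rep_eq)

lemma of_algint_of_int [simp]: "of_algint (of_int n) = of_int n"
  by (cases n rule: int_diff_cases) (simp add: minus_algint.rep_eq)

text \<open>The least positive integer \<open>m\<close> with \<open>m x \<in> O_L\<close>.\<close>
definition denom :: "'a :: field_char_0 \<Rightarrow> nat" where
  "denom x = (LEAST m. m > 0 \<and> algebraic_int (of_nat m * x))"

lemma common_denominator:
  assumes "finite (T :: rat set)"
  shows "\<exists>D::nat. D > 0 \<and> (\<forall>q\<in>T. of_nat D * q \<in> \<int>)"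
  using assms
proof induction
  case (insert q T)
  then obtain D :: nat where D: "D > 0" "\<forall>q\<in>T. of_nat D * q \<in> \<int>" by auto
  obtain a b where ab: "quotient_of q = (a, b)" by force
  hence b: "b > 0" by (rule quotient_of_denom_pos)
  have q: "q = of_int a / of_int b" using ab by (rule quotient_of_div)
  have "of_nat (D * nat b) * r \<in> \<int>" if "r \<in> Set.insert q T" for r :: rat
  proof (cases "r = q")
    case True
    hence "of_nat (D * nat b) * r = of_int (int D * a)" using b q by (simp add: field_simps)
    thus ?thesis by (metis Ints_of_int)
  next
    case False
    hence "of_nat D * r \<in> \<int>" using that D by auto
    moreover have "of_nat (D * nat b) * r = of_int b * (of_nat D * r)" using b by simp
    ultimately show ?thesis by (metis Ints_mult Ints_of_int)
  qed
  thus ?case using D(1) b by (intro exI[of _ "D * nat b"]) auto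
qed (auto intro: exI[of _ 1])

lemma denom:
  fixes x :: "'a :: number_field"
  shows "denom x > 0" "algebraic_int (of_nat (denom x) * x)"
proof -
  obtain B :: "'a set" where B: "finite B" "\<And>x. \<exists>c::'a \<Rightarrow> rat. x = (\<Sum>b\<in>B. of_rat (c b) * b)"
    using finite_dimensional by blast
  obtain c :: "'a \<Rightarrow> 'a \<Rightarrow> rat" where c: "\<And>y. y = (\<Sum>b\<in>B. of_rat (c y b) * b)"
    using B(2) by metis
  have "\<exists>b0\<in>B. b0 \<noteq> 0"
  proof (rule ccontr)
    assume "\<not> ?thesis"
    hence "(\<Sum>b\<in>B. of_rat (c 1 b) * b) = 0" by (intro sum.neutral) auto
    thus False using c[of 1] by simp
  qed
  then obtain b0 where b0: "b0 \<in> B" "b0 \<noteq> 0" by blast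
  obtain D :: nat where D: "D > 0" "\<forall>q\<in>(\<lambda>(u,b). c (x * u) b) ` (B \<times> B). of_nat D * q \<in> \<int>"
    using common_denominator[of "(\<lambda>(u,b). c (x * u) b) ` (B \<times> B)"] B(1) by auto
  have "algebraic_int (of_nat D * x)"
  proof (rule algebraic_int_of_integral_action[OF B(1) b0(1), where v = "\<lambda>b. b"])
    fix u assume u: "u \<in> B"
    have "\<forall>b\<in>B. \<exists>k::int. of_nat D * c (x * u) b = of_int k"
      using D(2) u by (auto elim!: Ints_cases)
    then obtain k :: "'a \<Rightarrow> int" where k: "\<forall>b\<in>B. of_nat D * c (x * u) b = of_int (k b)"
      by metis
    have "of_nat D * x * u = of_nat D * (\<Sum>b\<in>B. of_rat (c (x * u) b) * b)"
      using c[of "x * u"] by (simp add: mult.assoc)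
    also have "\<dots> = (\<Sum>b\<in>B. of_rat (of_nat D * c (x * u) b) * b)"
      by (simp add: sum_distrib_left of_rat_mult mult.assoc)
    also have "\<dots> = (\<Sum>b\<in>B. of_int (k b) * b)" using k by (intro sum.cong) auto
    finally show "\<exists>k::'a \<Rightarrow> int. of_nat D * x * u = (\<Sum>j\<in>B. of_int (k j) * j)" by blast
  qed (use b0 in auto)
  with D(1) have "\<exists>m. m > 0 \<and> algebraic_int (of_nat m * x)" by blast
  from LeastI_ex[OF this] show "denom x > 0" "algebraic_int (of_nat (denom x) * x)"
    unfolding denom_def by blast+
qed

text \<open>
  For \<open>p\<close> not dividing the denominator of \<open>x\<close>, the element \<open>reduce p x\<close> represents
  \<open>x mod p\<close> in \<open>O_L / p O_L\<close>.
\<close>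
definition reduce :: "nat \<Rightarrow> 'a :: field_char_0 \<Rightarrow> 'a algint" where
  "reduce p x = of_int (modular_inverse (int p) (int (denom x))) * to_algint (of_nat (denom x) * x)"


section \<open>The ring \<open>(\<Prod>\<^sub>p R/pR) / (\<Oplus>\<^sub>p R/pR)\<close>\<close>

text \<open>The quotient below is a nonzero ring as soon as no prime is invertible in \<open>R\<close>.\<close>
class primes_nonunit = comm_ring_1 +
  assumes prime_not_dvd_one: "prime p \<Longrightarrow> \<not> of_nat p dvd 1"

instance int :: primes_nonunit
  by standard (auto simp: prime_nat_iff)

instance algint :: (field_char_0) primes_nonunit
proof
  fix p :: nat assume p: "prime p"
  show "\<not> (of_nat p :: 'a algint) dvd 1"
  proof
    assume "(of_nat p :: 'a algint) dvd 1"
    then obtain y :: "'a algint" where "1 = of_nat p * y" by (rule dvdE)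
    hence "1 = of_nat p * of_algint y"
      by (metis of_algint_of_nat one_algint.rep_eq times_algint.rep_eq)
    hence y: "of_algint y = inverse (of_nat p)" using p by (simp add: field_simps)
    have "algebraic_int (of_algint y)" using of_algint by blast
    moreover have "of_algint y \<in> \<rat>" unfolding y by simp
    ultimately have "of_algint y \<in> \<int>" by (rule rational_algebraic_int_is_int)
    then obtain k :: int where "of_algint y = of_int k" by (rule Ints_cases)
    with \<open>1 = of_nat p * of_algint y\<close> have "of_int 1 = (of_int (int p * k) :: 'a)" by simp
    hence "int p * k = 1" by (metis of_int_eq_iff)
    with p show False by (metis dvd_triv_left int_dvd_int_iff not_prime_unit of_nat_1)
  qed
qed

text \<open>
  An element is represented by a sequence in \<open>R\<close> indexed by \<open>nat\<close>, of which only the values at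
  primes matter: its value at \<open>p\<close> stands for a class modulo \<open>p\<close>, and two sequences are identified
  if these classes agree for all sufficiently large primes.
\<close>
definition eq_mod_primes :: "(nat \<Rightarrow> 'r :: primes_nonunit) \<Rightarrow> (nat \<Rightarrow> 'r) \<Rightarrow> bool" where
  "eq_mod_primes f g \<longleftrightarrow> (\<forall>\<^sub>F p in sequentially. prime p \<longrightarrow> of_nat p dvd f p - g p)"

lemma equivp_eq_mod_primes: "equivp eq_mod_primes"
proof (rule equivpI)
  show "reflp (eq_mod_primes :: (nat \<Rightarrow> 'a) \<Rightarrow> _)" by (auto simp: reflp_def eq_mod_primes_def)
  show "symp (eq_mod_primes :: (nat \<Rightarrow> 'a) \<Rightarrow> _)"
    unfolding symp_def eq_mod_primes_def
  proof (intro allI impI)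
    fix f g :: "nat \<Rightarrow> 'a"
    assume "\<forall>\<^sub>F p in sequentially. prime p \<longrightarrow> of_nat p dvd f p - g p"
    thus "\<forall>\<^sub>F p in sequentially. prime p \<longrightarrow> of_nat p dvd g p - f p"
    proof eventually_elim
      case (elim p)
      thus ?case by (metis dvd_minus_iff minus_diff_eq)
    qed
  qed
  show "transp (eq_mod_primes :: (nat \<Rightarrow> 'a) \<Rightarrow> _)"
  proof (rule transpI)
    fix f g h :: "nat \<Rightarrow> 'a" assume "eq_mod_primes f g" "eq_mod_primes g h"
    thus "eq_mod_primes f h" unfolding eq_mod_primes_def
    proof eventually_elim
      case (elim p)
      thus ?case using dvd_add[of "of_nat p" "f p - g p" "g p - h p"] by auto
    qed
  qed
qed

quotient_type (overloaded) 'r mod_primes = "nat \<Rightarrow> 'r :: primes_nonunit" / eq_mod_primes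
  by (rule equivp_eq_mod_primes)

lift_definition prime_seq :: "(nat \<Rightarrow> 'r :: primes_nonunit) \<Rightarrow> 'r mod_primes" is "\<lambda>f. f" .

instantiation mod_primes :: (primes_nonunit) comm_ring_1
begin
lift_definition zero_mod_primes :: "'a mod_primes" is "\<lambda>_. 0" .
lift_definition one_mod_primes :: "'a mod_primes" is "\<lambda>_. 1" .
lift_definition plus_mod_primes :: "'a mod_primes \<Rightarrow> 'a mod_primes \<Rightarrow> 'a mod_primes"
  is "\<lambda>f g p. f p + g p"
  unfolding eq_mod_primes_def
  subgoal premises prems for f f' g g'
    using prems
proof eventually_elim
  case (elim p)
  thus ?case using dvd_add[of "of_nat p" "f p - f' p" "g p - g' p"] by (auto simp: algebra_simps)
qed
  done
lift_definition minus_mod_primes :: "'a mod_primes \<Rightarrow> 'a mod_primes \<Rightarrow> 'a mod_primes"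
  is "\<lambda>f g p. f p - g p"
  unfolding eq_mod_primes_def
  subgoal premises prems for f f' g g'
    using prems
proof eventually_elim
  case (elim p)
  thus ?case using dvd_diff[of "of_nat p" "f p - f' p" "g p - g' p"] by (auto simp: algebra_simps)
qed
  done
lift_definition uminus_mod_primes :: "'a mod_primes \<Rightarrow> 'a mod_primes"
  is "\<lambda>f p. - f p"
  unfolding eq_mod_primes_def
  subgoal premises prems for f f'
    using prems
proof eventually_elim
  case (elim p)
  thus ?case using dvd_minus_iff[of "of_nat p" "f p - f' p"] by (auto simp: algebra_simps)
qed
  done
lift_definition times_mod_primes :: "'a mod_primes \<Rightarrow> 'a mod_primes \<Rightarrow> 'a mod_primes"
  is "\<lambda>f g p. f p * g p"
  unfolding eq_mod_primes_def
  subgoal premises prems for f f' g g'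
    using prems
proof eventually_elim
  case (elim p)
  show ?case
  proof
    assume "prime p"
    hence "of_nat p dvd (f p - f' p) * g p + f' p * (g p - g' p)"
      using elim by (intro dvd_add dvd_mult dvd_mult2) auto
    thus "of_nat p dvd f p * g p - f' p * g' p" by (simp add: algebra_simps)
  qed
qed
  done
instance
proof
  show "(0 :: 'a mod_primes) \<noteq> 1"
  proof (transfer, rule notI)
    assume "eq_mod_primes (\<lambda>_. 0 :: 'a) (\<lambda>_. 1)"
    then obtain N where "\<And>p. p \<ge> N \<Longrightarrow> prime p \<Longrightarrow> (of_nat p :: 'a) dvd 0 - 1"
      unfolding eq_mod_primes_def eventually_sequentially by blast
    moreover obtain p where "prime p" "p > N" using bigger_prime by blast
    ultimately show False using prime_not_dvd_one[of p, where 'a = 'a] by auto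
  qed
qed (transfer; simp add: algebra_simps eq_mod_primes_def)+
end


lemma eq_mod_primes_refl [simp]: "eq_mod_primes f f"
  by (simp add: eq_mod_primes_def)

lemma prime_seq_eq_iff: "prime_seq f = prime_seq g \<longleftrightarrow> eq_mod_primes f g"
  by (simp add: prime_seq.abs_eq mod_primes.abs_eq_iff)

lemma prime_seq_exhaust: obtains f where "x = prime_seq f"
  using mod_primes.abs_induct[of "\<lambda>x. \<exists>f. x = prime_seq f" x] by (auto simp: prime_seq.abs_eq)

lemma prime_seq_add: "prime_seq f + prime_seq g = prime_seq (\<lambda>p. f p + g p)"
  and prime_seq_diff: "prime_seq f - prime_seq g = prime_seq (\<lambda>p. f p - g p)"
  and prime_seq_mult: "prime_seq f * prime_seq g = prime_seq (\<lambda>p. f p * g p)"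
  by (simp_all add: prime_seq.abs_eq plus_mod_primes.abs_eq minus_mod_primes.abs_eq
      times_mod_primes.abs_eq)

lemma of_nat_mod_primes: "of_nat n = prime_seq (\<lambda>_. of_nat n)"
proof (induction n)
  case 0
  show ?case by (simp add: zero_mod_primes.abs_eq prime_seq.abs_eq)
next
  case (Suc n)
  have one: "1 = prime_seq (\<lambda>_. 1 :: 'a)" by (simp add: one_mod_primes.abs_eq prime_seq.abs_eq)
  show ?case unfolding of_nat_Suc Suc one prime_seq_add ..
qed

lemma of_int_mod_primes: "of_int n = prime_seq (\<lambda>_. of_int n)"
  by (cases n rule: int_diff_cases) (simp add: of_nat_mod_primes prime_seq_diff)

lemma mod_primes_mult_left_cancel:
  fixes x y :: "'r :: primes_nonunit mod_primes"
  assumes "d > 0" "of_nat d * x = of_nat d * y"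
  shows "x = y"
proof -
  obtain f g where fg: "x = prime_seq f" "y = prime_seq g"
    using prime_seq_exhaust[of x] prime_seq_exhaust[of y] by metis
  have "eq_mod_primes (\<lambda>p. of_nat d * f p) (\<lambda>p. of_nat d * g p)"
    using assms(2) by (simp add: fg of_nat_mod_primes prime_seq_mult prime_seq_eq_iff)
  hence "\<forall>\<^sub>F p in sequentially. prime p \<longrightarrow> of_nat p dvd f p - g p"
    unfolding eq_mod_primes_def using eventually_gt_at_top[of d]
  proof eventually_elim
    case (elim p)
    show ?case
    proof
      assume p: "prime p"
      have "\<not> p dvd d" using elim(2) assms(1) by (auto dest: dvd_imp_le)
      hence "coprime (int p) (int d)" using p by (simp add: prime_imp_coprime)
      then obtain u v where uv: "u * int p + v * int d = 1"
        using bezout_int[of "int p" "int d"] by auto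
      have "(1 :: 'r) = of_int (u * int p + v * int d)" unfolding uv by simp
      hence "(f p - g p) * 1 = (f p - g p) * (of_int u * of_nat p + of_int v * of_nat d)" by simp
      hence "f p - g p = of_nat p * (of_int u * (f p - g p)) +
               of_int v * (of_nat d * f p - of_nat d * g p)"
        by (simp add: algebra_simps)
      moreover have "of_nat p dvd of_nat d * f p - of_nat d * g p" using elim p by blast
      ultimately show "of_nat p dvd f p - g p" by (metis dvd_add dvd_mult dvd_triv_left)
    qed
  qed
  thus ?thesis by (simp add: fg prime_seq_eq_iff eq_mod_primes_def)
qed

lift_definition frobenius_mod_primes :: "'r :: primes_nonunit mod_primes \<Rightarrow> 'r mod_primes"
  is "\<lambda>f p. f p ^ p"
  unfolding eq_mod_primes_def
  subgoal premises prems for f g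
    using prems
  proof eventually_elim
    case (elim p)
    have "f p - g p dvd f p ^ p - g p ^ p" by (simp add: power_diff_sumr2)
    thus ?case using elim dvd_trans by blast
  qed
  done

type_synonym ring_A = "int mod_primes"

text \<open>The structure map making \<open>(\<Prod>\<^sub>p R/pR) / (\<Oplus>\<^sub>p R/pR)\<close> an \<open>\<A>\<close>-algebra.\<close>
lift_definition of_A :: "ring_A \<Rightarrow> 'r :: primes_nonunit mod_primes" is "\<lambda>f p. of_int (f p)"
  unfolding eq_mod_primes_def
  subgoal premises prems for f g
    using prems
  proof eventually_elim
    case (elim p)
    show ?case
    proof
      assume "prime p"
      with elim obtain k where "f p - g p = int p * k" by (auto elim!: dvdE)
      hence "of_int (f p) - of_int (g p) = (of_nat p * of_int k :: 'r)"
        by (metis of_int_diff of_int_mult of_int_of_nat_eq)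
      thus "(of_nat p :: 'r) dvd of_int (f p) - of_int (g p)" by simp
    qed
  qed
  done

lemma of_A_add: "of_A (a + b) = of_A a + of_A b"
  and of_A_mult: "of_A (a * b) = of_A a * of_A b"
  by (transfer; simp)+

lemma of_A_of_int: "of_A (of_int k) = of_int k"
  by (simp add: of_int_mod_primes of_A.abs_eq prime_seq.abs_eq)


section \<open>\<open>\<A>\<close> as a \<open>\<rat>\<close>-algebra\<close>

text \<open>For a rational \<open>a/b\<close>, this is \<open>(a b\<^sup>-\<^sup>1 mod p)\<^sub>p\<close>, defined for all \<open>p\<close> not dividing \<open>b\<close>.\<close>
definition rat_A :: "rat \<Rightarrow> ring_A" where
  "rat_A q = prime_seq (\<lambda>p. case quotient_of q of (a, b) \<Rightarrow> a * modular_inverse (int p) b)"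

text \<open>For \<open>x \<in> L\<close> this is the image of \<open>x \<otimes> 1\<close> in \<open>(\<Prod>\<^sub>p O_L/p) / (\<Oplus>\<^sub>p O_L/p)\<close>.\<close>
definition embed_L :: "'a :: field_char_0 \<Rightarrow> 'a algint mod_primes" where
  "embed_L x = prime_seq (\<lambda>p. reduce p x)"

lemma prime_seq_modular_inverse:
  fixes y :: "'r :: primes_nonunit"
  assumes "d > 0"
  shows "of_nat d * prime_seq (\<lambda>p. of_int (modular_inverse (int p) (int d)) * y) = prime_seq (\<lambda>_. y)"
proof -
  have "\<forall>\<^sub>F p in sequentially. prime p \<longrightarrow>
          of_nat p dvd of_nat d * (of_int (modular_inverse (int p) (int d)) * y) - y"
    using eventually_gt_at_top[of d]
  proof eventually_elim
    case (elim p)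
    show ?case
    proof
      assume p: "prime p"
      have "\<not> p dvd d" using elim assms by (auto dest: dvd_imp_le)
      hence "coprime (int p) (int d)" using p by (simp add: prime_imp_coprime)
      hence "coprime (int d) (int p)" by (rule coprime_commute[THEN iffD1])
      hence "[int d * modular_inverse (int p) (int d) = 1] (mod int p)"
        by (rule cong_modular_inverse1)
      hence "int p dvd int d * modular_inverse (int p) (int d) - 1" by (simp add: cong_iff_dvd_diff)
      then obtain k where "int d * modular_inverse (int p) (int d) - 1 = int p * k" by (rule dvdE)
      hence "of_int (int d * modular_inverse (int p) (int d) - 1) = (of_int (int p * k) :: 'r)"
        by simp
      hence "of_nat d * (of_int (modular_inverse (int p) (int d)) * y) - y = of_nat p * (of_int k * y)"
        by (simp add: algebra_simps)
      thus "of_nat p dvd of_nat d * (of_int (modular_inverse (int p) (int d)) * y) - y" by simp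
    qed
  qed
  thus ?thesis by (simp add: of_nat_mod_primes prime_seq_mult prime_seq_eq_iff eq_mod_primes_def)
qed

lemma rat_A_eqI:
  assumes "d > 0" "of_nat d * q = of_int k"
  shows "of_nat d * rat_A q = of_int k"
proof -
  obtain a b where ab: "quotient_of q = (a, b)" by force
  hence b: "b > 0" by (rule quotient_of_denom_pos)
  have q: "q = of_int a / of_int b" using ab by (rule quotient_of_div)
  have "of_nat (nat b) * rat_A q = prime_seq (\<lambda>_. a)"
    using prime_seq_modular_inverse[of "nat b" a] b by (simp add: rat_A_def ab mult.commute)
  hence 1: "of_nat (nat b) * rat_A q = of_int a" by (simp add: of_int_mod_primes)
  have "of_int (int d * a) = (of_int (k * b) :: rat)"
    using assms b q by (simp add: field_simps)
  hence 2: "int d * a = k * b" by (simp only: of_int_eq_iff)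
  have "of_nat (nat b) * (of_nat d * rat_A q) = of_nat d * of_int a"
    using 1 by (metis mult.left_commute)
  also have "\<dots> = of_int (int d * a)" by simp
  also have "\<dots> = of_nat (nat b) * of_int k" unfolding 2 using b by simp
  finally show ?thesis by (rule mod_primes_mult_left_cancel[rotated]) (use b in simp)
qed

lemma rat_common_denom:
  obtains d :: nat and k l :: int
  where "d > 0" "of_nat d * (q :: rat) = of_int k" "of_nat d * (r :: rat) = of_int l"
  using common_denominator[of "{q, r}"] by (auto elim!: Ints_cases)

lemma rat_A_add: "rat_A (q + r) = rat_A q + rat_A r"
proof -
  obtain d k l where d: "d > 0" "of_nat d * q = of_int k" "of_nat d * r = of_int l"
    using rat_common_denom .
  have "of_nat d * rat_A (q + r) = of_int (k + l)"
    by (rule rat_A_eqI) (use d in \<open>auto simp: algebra_simps\<close>)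
  also have "\<dots> = of_nat d * (rat_A q + rat_A r)"
    using rat_A_eqI[OF d(1,2)] rat_A_eqI[OF d(1,3)] by (simp add: algebra_simps)
  finally show ?thesis using d(1) by (rule mod_primes_mult_left_cancel[rotated])
qed

lemma rat_A_mult: "rat_A (q * r) = rat_A q * rat_A r"
proof -
  obtain d k l where d: "d > 0" "of_nat d * q = of_int k" "of_nat d * r = of_int l"
    using rat_common_denom .
  have "of_nat (d * d) * (q * r) = of_int (k * l)"
    using arg_cong2[OF d(2,3), of "(*)"] by (simp add: mult_ac)
  hence "of_nat (d * d) * rat_A (q * r) = of_int (k * l)"
    using d(1) by (intro rat_A_eqI) auto
  also have "\<dots> = (of_nat d * rat_A q) * (of_nat d * rat_A r)"
    using rat_A_eqI[OF d(1,2)] rat_A_eqI[OF d(1,3)] by simp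
  also have "\<dots> = of_nat (d * d) * (rat_A q * rat_A r)" by (simp add: mult_ac)
  finally show ?thesis by (rule mod_primes_mult_left_cancel[rotated]) (use d(1) in simp)
qed

lemma rat_A_1: "rat_A 1 = 1"
  using rat_A_eqI[of 1 1 1] by simp

definition scale_A :: "rat \<Rightarrow> ring_A \<Rightarrow> ring_A" where
  "scale_A q a = rat_A q * a"

interpretation A: vector_space scale_A
  by unfold_locales (simp_all add: scale_A_def rat_A_add rat_A_mult rat_A_1 algebra_simps)

lemma embed_L_eqI:
  fixes x :: "'a :: number_field"
  assumes "d > 0" "of_nat d * x = of_algint y"
  shows "of_nat d * embed_L x = prime_seq (\<lambda>_. y)"
proof -
  define z where "z = to_algint (of_nat (denom x) * x)"
  have z: "of_algint z = of_nat (denom x) * x"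
    unfolding z_def using denom(2) by (intro to_algint_inverse) auto
  have 1: "of_nat (denom x) * embed_L x = prime_seq (\<lambda>_. z)"
    using prime_seq_modular_inverse[of "denom x" z] denom(1)[of x]
    by (simp add: embed_L_def reduce_def z_def)
  have "of_algint (of_nat d * z) = of_algint (of_nat (denom x) * y)"
    using assms(2) by (simp add: times_algint.rep_eq z mult_ac flip: assms(2))
  hence 2: "of_nat d * z = of_nat (denom x) * y" by (simp add: of_algint_inject)
  have "of_nat (denom x) * (of_nat d * embed_L x) = of_nat d * prime_seq (\<lambda>_. z)"
    using 1 by (metis mult.left_commute)
  also have "\<dots> = of_nat (denom x) * prime_seq (\<lambda>_. y)"
    by (simp add: of_nat_mod_primes prime_seq_mult 2)
  finally show ?thesis using denom(1) by (rule mod_primes_mult_left_cancel[rotated])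
qed

lemma algint_common_denom:
  fixes x y :: "'a :: number_field"
  obtains d u v where "d > 0" "of_nat d * x = of_algint u" "of_nat d * y = of_algint v"
proof -
  have "algebraic_int (of_nat (denom x * denom y) * x)"
    using algebraic_int_mult[OF int_imp_algebraic_int[of "of_nat (denom y)"] denom(2)[of x]]
    by (simp add: mult_ac)
  moreover have "algebraic_int (of_nat (denom x * denom y) * y)"
    using algebraic_int_mult[OF int_imp_algebraic_int[of "of_nat (denom x)"] denom(2)[of y]]
    by (simp add: mult_ac)
  ultimately show ?thesis using denom(1)[of x] denom(1)[of y]
    by (intro that[of "denom x * denom y" "to_algint (of_nat (denom x * denom y) * x)"
          "to_algint (of_nat (denom x * denom y) * y)"])
      (auto simp: to_algint_inverse)
qed

lemma embed_L_add: "embed_L (x + y) = embed_L x + embed_L y" for x y :: "'a :: number_field"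
proof -
  obtain d u v where d: "d > 0" "of_nat d * x = of_algint u" "of_nat d * y = of_algint v"
    using algint_common_denom .
  have "of_nat d * embed_L (x + y) = prime_seq (\<lambda>_. u + v)"
    by (rule embed_L_eqI) (use d in \<open>auto simp: algebra_simps plus_algint.rep_eq\<close>)
  also have "\<dots> = of_nat d * (embed_L x + embed_L y)"
    using embed_L_eqI[OF d(1,2)] embed_L_eqI[OF d(1,3)]
    by (simp add: algebra_simps prime_seq_add)
  finally show ?thesis using d(1) by (rule mod_primes_mult_left_cancel[rotated])
qed

lemma embed_L_scale: "embed_L (of_rat q * x) = of_A (rat_A q) * embed_L x"
  for x :: "'a :: number_field"
proof -
  obtain d u where d: "d > 0" "of_nat d * x = of_algint u" using algint_common_denom[of x x] .
  obtain e k where e: "e > 0" "of_nat e * q = of_int k" using rat_common_denom[of q q] .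
  have "of_rat (of_nat e * q) = (of_int k :: 'a)" unfolding e(2) by simp
  hence ek: "of_nat e * of_rat q = (of_int k :: 'a)" by (simp add: of_rat_mult)
  have "of_nat (e * d) * embed_L (of_rat q * x) = prime_seq (\<lambda>_. of_int k * u)"
  proof (rule embed_L_eqI)
    have "of_nat (e * d) * (of_rat q * x) = (of_nat e * of_rat q) * (of_nat d * x)"
      by (simp add: mult_ac)
    thus "of_nat (e * d) * (of_rat q * x) = of_algint (of_int k * u)"
      by (simp add: ek d(2) times_algint.rep_eq)
  qed (use d e in auto)
  also have "\<dots> = of_A (of_int k) * (of_nat d * embed_L x)"
    unfolding embed_L_eqI[OF d] of_A_of_int by (simp add: of_int_mod_primes prime_seq_mult)
  also have "of_int k = of_int (int e) * rat_A q" using rat_A_eqI[OF e] by simp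
  also have "of_A (of_int (int e) * rat_A q) * (of_nat d * embed_L x) =
      of_nat (e * d) * (of_A (rat_A q) * embed_L x)"
    unfolding of_A_mult of_A_of_int by (simp add: mult_ac)
  finally show ?thesis by (rule mod_primes_mult_left_cancel[rotated]) (use d(1) e(1) in simp)
qed


section \<open>The tensor product \<open>L \<otimes>\<^sub>\<rat> \<A>\<close>\<close>

text \<open>
  The usual construction: the free abelian group on \<open>L \<times> \<A>\<close> modulo the subgroup generated by
  the bilinearity relations over \<open>\<rat>\<close>.
\<close>
inductive_set tensor_relations :: "('a :: field_char_0 \<times> ring_A \<Rightarrow>\<^sub>0 int) set" where
  add_left: "frag_of (x + y, a) - frag_of (x, a) - frag_of (y, a) \<in> tensor_relations"
| add_right: "frag_of (x, a + b) - frag_of (x, a) - frag_of (x, b) \<in> tensor_relations"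
| balanced: "frag_of (of_rat q * x, a) - frag_of (x, scale_A q a) \<in> tensor_relations"
| zero: "0 \<in> tensor_relations"
| diff: "u \<in> tensor_relations \<Longrightarrow> v \<in> tensor_relations \<Longrightarrow> u - v \<in> tensor_relations"

lemma tensor_relations_uminus: "u \<in> tensor_relations \<Longrightarrow> - u \<in> tensor_relations"
  using tensor_relations.diff[OF tensor_relations.zero, of u] by simp

lemma tensor_relations_add:
  "u \<in> tensor_relations \<Longrightarrow> v \<in> tensor_relations \<Longrightarrow> u + v \<in> tensor_relations"
  using tensor_relations.diff[OF _ tensor_relations_uminus, of u v] by simp

lifting_forget mod_primes.lifting

quotient_type (overloaded) 'a tensor_A =
  "'a :: field_char_0 \<times> ring_A \<Rightarrow>\<^sub>0 int" / "\<lambda>u v. u - v \<in> tensor_relations"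
proof (rule equivpI)
  show "reflp (\<lambda>u v :: 'a \<times> ring_A \<Rightarrow>\<^sub>0 int. u - v \<in> tensor_relations)"
    by (simp add: reflp_def tensor_relations.zero)
  show "symp (\<lambda>u v :: 'a \<times> ring_A \<Rightarrow>\<^sub>0 int. u - v \<in> tensor_relations)"
    by (rule sympI) (use tensor_relations_uminus in fastforce)
  show "transp (\<lambda>u v :: 'a \<times> ring_A \<Rightarrow>\<^sub>0 int. u - v \<in> tensor_relations)"
    by (rule transpI) (use tensor_relations_add in fastforce)
qed

instantiation tensor_A :: (field_char_0) ab_group_add
begin
lift_definition zero_tensor_A :: "'a tensor_A" is 0 .
lift_definition plus_tensor_A :: "'a tensor_A \<Rightarrow> 'a tensor_A \<Rightarrow> 'a tensor_A" is "(+)"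
  by (drule (1) tensor_relations_add) (simp add: algebra_simps)
lift_definition minus_tensor_A :: "'a tensor_A \<Rightarrow> 'a tensor_A \<Rightarrow> 'a tensor_A" is "(-)"
  by (drule (1) tensor_relations.diff) (simp add: algebra_simps)
lift_definition uminus_tensor_A :: "'a tensor_A \<Rightarrow> 'a tensor_A" is uminus
  by (drule tensor_relations_uminus) simp
instance by standard (transfer; simp add: algebra_simps tensor_relations.zero)+
end

lift_definition tensor :: "'a :: field_char_0 \<Rightarrow> ring_A \<Rightarrow> 'a tensor_A" (infixr \<open>\<otimes>\<^sub>A\<close> 75)
  is "\<lambda>x a. frag_of (x, a)" .

lift_definition scale_tensor :: "ring_A \<Rightarrow> 'a :: field_char_0 tensor_A \<Rightarrow> 'a tensor_A"
  is "\<lambda>c. frag_extend (\<lambda>(x, a). frag_of (x, c * a))"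
  subgoal premises prems for c u v
  proof -
    have "frag_extend (\<lambda>(x, a). frag_of (x, c * a)) w \<in> tensor_relations"
      if "w \<in> tensor_relations" for w :: "'a \<times> ring_A \<Rightarrow>\<^sub>0 int"
      using that
    proof induction
      case (balanced q x a)
      have "scale_A q (c * a) = c * scale_A q a" by (simp add: scale_A_def mult_ac)
      thus ?case using tensor_relations.balanced[of q x "c * a"] by (simp add: frag_extend_diff)
    qed (simp_all add: frag_extend_diff distrib_left tensor_relations.intros)
    from this[OF prems] show ?thesis by (simp add: frag_extend_diff)
  qed
  done

lemma tensor_A_induct [case_names zero tensor diff]:
  assumes "P 0" "\<And>x a. P (x \<otimes>\<^sub>A a)" "\<And>u v. P u \<Longrightarrow> P v \<Longrightarrow> P (u - v)"
  shows "P t"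
proof -
  have "P (abs_tensor_A f)" for f
    by (rule frag_induction[of f UNIV "\<lambda>f. P (abs_tensor_A f)"])
      (use assms in \<open>auto simp flip: zero_tensor_A_def tensor.abs_eq minus_tensor_A.abs_eq\<close>)
  thus ?thesis by (rule tensor_A.abs_induct)
qed

lemma tensor_add_right: "x \<otimes>\<^sub>A (a + b) = x \<otimes>\<^sub>A a + x \<otimes>\<^sub>A b"
  by transfer (use tensor_relations.add_right in \<open>simp add: algebra_simps\<close>)

lemma scale_tensor_tensor: "scale_tensor c (x \<otimes>\<^sub>A a) = x \<otimes>\<^sub>A (c * a)"
  by transfer (simp add: tensor_relations.zero)

lemma scale_tensor_diff: "scale_tensor c (u - v) = scale_tensor c u - scale_tensor c v"
  by transfer (simp add: frag_extend_diff tensor_relations.zero)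

lemma scale_tensor_0: "scale_tensor c 0 = 0"
  by transfer (simp add: tensor_relations.zero)

interpretation tensor_A: Modules.module scale_tensor
proof
  show "scale_tensor c (u + v) = scale_tensor c u + scale_tensor c v" for c and u v :: "'a tensor_A"
    by transfer (simp add: frag_extend_add tensor_relations.zero)
  show "scale_tensor (c + d) t = scale_tensor c t + scale_tensor d t" for c d and t :: "'a tensor_A"
    by (induction t rule: tensor_A_induct)
      (simp_all add: scale_tensor_0 scale_tensor_diff scale_tensor_tensor distrib_right tensor_add_right)
  show "scale_tensor c (scale_tensor d t) = scale_tensor (c * d) t" for c d and t :: "'a tensor_A"
    by (induction t rule: tensor_A_induct)
      (simp_all add: scale_tensor_0 scale_tensor_diff scale_tensor_tensor mult.assoc)
  show "scale_tensor 1 t = t" for t :: "'a tensor_A"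
    by (induction t rule: tensor_A_induct)
      (simp_all add: scale_tensor_0 scale_tensor_diff scale_tensor_tensor)
qed


section \<open>The \<open>\<A>\<close>-valued Frobenius automorphism and its matrix\<close>

definition frag_eval :: "('b \<Rightarrow> 'c :: ring_1) \<Rightarrow> ('b \<Rightarrow>\<^sub>0 int) \<Rightarrow> 'c" where
  "frag_eval h f = (\<Sum>k\<in>Poly_Mapping.keys f. of_int (Poly_Mapping.lookup f k) * h k)"

lemma frag_eval_superset:
  assumes "finite T" "Poly_Mapping.keys f \<subseteq> T"
  shows "frag_eval h f = (\<Sum>k\<in>T. of_int (Poly_Mapping.lookup f k) * h k)"
  unfolding frag_eval_def using assms
  by (intro sum.mono_neutral_left) (auto simp: in_keys_iff)

lemma frag_eval_of [simp]: "frag_eval h (frag_of k) = h k"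
  by (simp add: frag_eval_def)

lemma frag_eval_0 [simp]: "frag_eval h 0 = 0"
  by (simp add: frag_eval_def)

lemma frag_eval_diff: "frag_eval h (f - g) = frag_eval h f - frag_eval h g"
proof -
  let ?T = "Poly_Mapping.keys f \<union> Poly_Mapping.keys g"
  have "frag_eval h (f - g) = (\<Sum>k\<in>?T. of_int (Poly_Mapping.lookup (f - g) k) * h k)"
    using keys_diff[of f g] by (intro frag_eval_superset) auto
  also have "\<dots> = (\<Sum>k\<in>?T. of_int (Poly_Mapping.lookup f k) * h k) -
                  (\<Sum>k\<in>?T. of_int (Poly_Mapping.lookup g k) * h k)"
    by (simp add: lookup_minus left_diff_distrib sum_subtractf)
  finally show ?thesis
    using frag_eval_superset[of ?T f h] frag_eval_superset[of ?T g h] by simp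
qed

text \<open>
  The isomorphism of \<open>L \<otimes>\<^sub>\<rat> \<A>\<close> with \<open>(\<Prod>\<^sub>p O_L/p) / (\<Oplus>\<^sub>p O_L/p)\<close>, sending
  \<open>x \<otimes> (a\<^sub>p)\<^sub>p\<close> to \<open>(x a\<^sub>p mod p)\<^sub>p\<close>.
\<close>
lift_definition tensor_iso :: "'a :: number_field tensor_A \<Rightarrow> 'a algint mod_primes"
  is "frag_eval (\<lambda>(x, a). embed_L x * of_A a)"
  subgoal premises prems for f g
  proof -
    have "frag_eval (\<lambda>(x, a). embed_L x * of_A a :: 'a algint mod_primes) w = 0"
      if "w \<in> tensor_relations" for w :: "'a \<times> ring_A \<Rightarrow>\<^sub>0 int"
      using that
    proof induction
      case (balanced q x a)
      show ?case
        by (simp add: frag_eval_diff embed_L_scale scale_A_def of_A_mult)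
    qed (simp_all add: frag_eval_diff embed_L_add of_A_add distrib_left distrib_right)
    from this[OF prems] show ?thesis by (simp add: frag_eval_diff)
  qed
  done

lemma tensor_iso_tensor: "tensor_iso (x \<otimes>\<^sub>A a) = embed_L x * of_A a"
  by transfer simp

lifting_update mod_primes.lifting

text \<open>
  The \<open>p\<close>-th power map in the \<open>p\<close>-th factor, transported along the bijection \<open>tensor_iso\<close>.
\<close>
definition frobenius_A :: "'a :: number_field tensor_A \<Rightarrow> 'a tensor_A" where
  "frobenius_A = inv_into UNIV tensor_iso \<circ> frobenius_mod_primes \<circ> tensor_iso"

definition Q_basis :: "'a :: field_char_0 set \<Rightarrow> bool" where
  "Q_basis B \<longleftrightarrow> L.independent B \<and> L.span B = UNIV"

text \<open>
  The entry in row \<open>x\<close> and column \<open>y\<close> (for \<open>x, y \<in> B\<close>) of the matrix of an \<open>\<A>\<close>-linear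
  endomorphism with respect to the \<open>\<A>\<close>-basis \<open>{b \<otimes> 1 | b \<in> B}\<close> of \<open>L \<otimes>\<^sub>\<rat> \<A>\<close>.
\<close>
definition matrix_A ::
  "'a :: number_field set \<Rightarrow> ('a tensor_A \<Rightarrow> 'a tensor_A) \<Rightarrow> 'a \<Rightarrow> 'a \<Rightarrow> ring_A" where
  "matrix_A B F x y = tensor_A.representation ((\<lambda>b. b \<otimes>\<^sub>A 1) ` B) (F (y \<otimes>\<^sub>A 1)) (x \<otimes>\<^sub>A 1)"


section \<open>Frobenius elements and the elements \<open>(g(\<phi>\<^sub>p) mod p)\<^sub>p\<close>\<close>

abbreviation OL :: "'a :: field_char_0 algint ring" where
  "OL \<equiv> ring_of_type_algebra"

definition primes_over :: "nat \<Rightarrow> 'a :: field_char_0 algint set set" where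
  "primes_over p = {P. primeideal P OL \<and> of_nat p \<in> P}"

definition ramification_index :: "nat \<Rightarrow> 'a :: field_char_0 algint set \<Rightarrow> nat" where
  "ramification_index p P = (GREATEST e. PIdl\<^bsub>OL\<^esub> (of_nat p) \<subseteq> P [^]\<^bsub>ideals_set OL\<^esub> e)"

definition unramified :: "'a :: field_char_0 itself \<Rightarrow> nat \<Rightarrow> bool" where
  "unramified _ p \<longleftrightarrow> (\<forall>P \<in> primes_over p :: 'a algint set set. ramification_index p P = 1)"

text \<open>For unramified \<open>p\<close> the congruence \<open>\<sigma>(x) \<equiv> x\<^sup>p (mod P)\<close> on \<open>O_L\<close> determines the Frobenius at \<open>P\<close>.\<close>
definition frobenius_element :: "nat \<Rightarrow> 'a :: field_char_0 algint set \<Rightarrow> 'a \<Rightarrow> 'a" where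
  "frobenius_element p P =
     (THE \<sigma>. \<sigma> \<in> gal \<and> (\<forall>x. to_algint (\<sigma> (of_algint x)) - x ^ p \<in> P))"

definition class_functions :: "(('a :: field_char_0 \<Rightarrow> 'a) \<Rightarrow> 'a) set" where
  "class_functions =
     {g \<in> gal \<rightarrow>\<^sub>E UNIV. \<forall>\<sigma>\<in>gal. \<forall>\<tau>\<in>gal. g (\<sigma> \<circ> \<tau> \<circ> inv_into UNIV \<sigma>) = \<sigma> (g \<tau>)}"

text \<open>
  The least nonnegative residue representing \<open>g(\<phi>\<^sub>p) mod p\<close>, which is required to be the same
  for all primes \<open>P\<close> over \<open>p\<close>. The value at the finitely many
  excluded primes is irrelevant in \<open>\<A>\<close> and set to zero.
\<close>
definition eval_frobenius :: "(('a :: field_char_0 \<Rightarrow> 'a) \<Rightarrow> 'a) \<Rightarrow> nat \<Rightarrow> int" where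
  "eval_frobenius g p =
     (if prime p \<and> unramified TYPE('a) p \<and> (\<forall>\<tau>\<in>gal. coprime p (denom (g \<tau>)))
      then THE a. 0 \<le> a \<and> a < int p \<and>
             (\<forall>P\<in>primes_over p. reduce p (g (frobenius_element p P)) - of_int a \<in> P)
      else 0)"

end

theory Submission
  imports Defs
begin

text \<open>
  Let \<open>d\<^sub>b\<close> be the dual of a basis \<open>B\<close> of \<open>L\<close> under the trace form. The matrix entry at \<open>(b, c)\<close> is
  \<open>Tr(d\<^sub>b c\<^sup>p)\<close> modulo \<open>p\<close>. Reducing at a prime \<open>P\<close> over \<open>p\<close> replaces the \<open>p\<close>-th power by the
  Frobenius element \<open>\<phi>\<close>, so this is the value at \<open>\<phi>\<close> of \<open>\<sigma> \<mapsto> \<Sum>\<^sub>\<tau> \<tau>(d\<^sub>b) \<sigma>(\<tau>(c))\<close>, which is a class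
  function. Conversely, every function on the Galois group is of the form \<open>\<sigma> \<mapsto> \<Sum>\<^sub>c w\<^sub>c \<sigma>(c)\<close>, and
  averaging over conjugation shows that these class functions span all of them over \<open>\<rat>\<close>.

  For large \<open>p\<close> the Frobenius element exists because \<open>\<Prod>\<^sub>\<sigma> (x\<^sup>p - \<sigma>(x))\<close> vanishes modulo \<open>p\<close> for
  every integer \<open>x\<close>, so the subspaces \<open>{x | x\<^sup>p = \<sigma>(x) mod P}\<close>
  cover \<open>O\<^sub>L/p\<close>, and fewer than \<open>p + 1\<close> proper subspaces cannot do so. Away from the denominators of \<open>B\<close> and its dual, the trace form shows
  that \<open>O\<^sub>L/p\<close> is reduced, which gives that \<open>p\<close> is unramified.
\<close>

section \<open>The Galois group\<close>

lemma galI: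
  assumes "bij \<sigma>" "\<And>x y. \<sigma> (x + y) = \<sigma> x + \<sigma> y" "\<And>x y. \<sigma> (x * y) = \<sigma> x * \<sigma> y"
    "\<And>q. \<sigma> (of_rat q) = of_rat q"
  shows "\<sigma> \<in> gal"
  using assms by (simp add: gal_def)

context
  fixes \<sigma> :: "'a :: field_char_0 \<Rightarrow> 'a"
  assumes \<sigma>: "\<sigma> \<in> gal"
begin

lemma gal_bij: "bij \<sigma>"
  and gal_add: "\<sigma> (x + y) = \<sigma> x + \<sigma> y"
  and gal_mult: "\<sigma> (x * y) = \<sigma> x * \<sigma> y"
  and gal_of_rat: "\<sigma> (of_rat q) = of_rat q"
  using \<sigma> by (auto simp: gal_def)

lemma gal_of_int: "\<sigma> (of_int k) = of_int k"
  using gal_of_rat[of "of_int k"] by simp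

lemma gal_of_nat: "\<sigma> (of_nat k) = of_nat k"
  using gal_of_rat[of "of_nat k"] by simp

lemma gal_0: "\<sigma> 0 = 0" and gal_1: "\<sigma> 1 = 1"
  using gal_of_rat[of 0] gal_of_rat[of 1] by simp_all

lemma gal_diff: "\<sigma> (x - y) = \<sigma> x - \<sigma> y"
  using gal_add[of "x - y" y] by (simp add: algebra_simps)

lemma gal_sum: "\<sigma> (sum f S) = (\<Sum>i\<in>S. \<sigma> (f i))"
  by (induction S rule: infinite_finite_induct) (simp_all add: gal_0 gal_add)

lemma gal_power: "\<sigma> (x ^ n) = \<sigma> x ^ n"
  by (induction n) (simp_all add: gal_1 gal_mult)

lemma gal_inv_into [simp]: "\<sigma> (inv_into UNIV \<sigma> x) = x" "inv_into UNIV \<sigma> (\<sigma> x) = x"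
  using gal_bij by (simp_all add: bij_def surj_f_inv_f)

lemma gal_inv: "inv_into UNIV \<sigma> \<in> gal"
proof (rule galI)
  let ?i = "inv_into UNIV \<sigma>"
  have inj: "inj \<sigma>" using gal_bij by (rule bij_is_inj)
  show "bij ?i" using gal_bij by (rule bij_imp_bij_inv)
  show "?i (x + y) = ?i x + ?i y" for x y by (rule inv_f_eq[OF inj]) (simp add: gal_add)
  show "?i (x * y) = ?i x * ?i y" for x y by (rule inv_f_eq[OF inj]) (simp add: gal_mult)
  show "?i (of_rat q) = of_rat q" for q by (rule inv_f_eq[OF inj]) (simp add: gal_of_rat)
qed

lemma gal_comp: "\<tau> \<in> gal \<Longrightarrow> \<sigma> \<circ> \<tau> \<in> gal"
  using \<sigma> bij_comp by (auto simp: gal_def)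

lemma algebraic_int_gal:
  assumes "algebraic_int x"
  shows "algebraic_int (\<sigma> x)"
proof -
  obtain p where p: "lead_coeff p = 1" "\<forall>i. coeff p i \<in> \<int>" "poly p x = 0"
    using assms by (auto elim!: algebraic_int.cases)
  have "poly p (\<sigma> x) = \<sigma> (poly p x)"
  proof -
    have "\<sigma> (coeff p i) = coeff p i" for i using p(2)[rule_format, of i] gal_of_int by (auto elim!: Ints_cases)
    thus ?thesis by (simp add: poly_altdef gal_sum gal_mult gal_power)
  qed
  hence "poly p (\<sigma> x) = 0" using p(3) gal_0 by simp
  with p show ?thesis by (auto intro: algebraic_int.intros)
qed

end

lemma gal_id: "id \<in> gal"
  by (rule galI) auto

lemma bij_betw_gal_comp_left: "\<sigma> \<in> gal \<Longrightarrow> bij_betw ((\<circ>) \<sigma>) gal gal"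
  by (rule bij_betw_byWitness[where f' = "(\<circ>) (inv_into UNIV \<sigma>)"])
    (auto simp: fun_eq_iff gal_comp gal_inv)

lemma exists_Q_basis_span:
  obtains B :: "'a :: number_field set" where "finite B" "L.span B = UNIV"
proof -
  obtain B :: "'a set" where B: "finite B" "\<And>x. \<exists>c::'a \<Rightarrow> rat. x = (\<Sum>b\<in>B. of_rat (c b) * b)"
    using finite_dimensional by blast
  have "x \<in> L.span B" for x
  proof -
    obtain c :: "'a \<Rightarrow> rat" where c: "x = (\<Sum>b\<in>B. of_rat (c b) * b)" using B(2) by blast
    show ?thesis unfolding c by (intro L.span_sum L.span_scale L.span_base)
  qed
  with B(1) show ?thesis by (intro that) auto
qed

lemma gal_eq_on_span:
  assumes "\<sigma> \<in> gal" "\<tau> \<in> gal" "\<And>b. b \<in> B \<Longrightarrow> \<sigma> b = \<tau> b" "x \<in> L.span B"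
  shows "\<sigma> x = \<tau> x"
  using assms(4)
proof (induction rule: L.span_induct_alt)
  case base
  show ?case using assms by (simp add: gal_0)
next
  case (step c y z)
  thus ?case using assms by (simp add: gal_add gal_mult gal_of_rat)
qed

text \<open>An automorphism is determined by its values on a finite spanning set, and each value is
  confined to a finite set: a multiple of \<open>x\<close> is a root of a monic polynomial with
  integer coefficients, which automorphisms fix.\<close>

lemma finite_gal: "finite (gal :: ('a :: number_field \<Rightarrow> 'a) set)"
proof -
  obtain B :: "'a set" where B: "finite B" "L.span B = UNIV" by (rule exists_Q_basis_span)
  have "\<exists>R. finite R \<and> (\<forall>\<sigma>\<in>gal. \<sigma> x \<in> R)" for x :: 'a
  proof -
    define y where "y = of_nat (denom x) * x"
    have "algebraic_int y" unfolding y_def by (rule denom)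
    then obtain p :: "'a poly" where p: "lead_coeff p = 1" "\<forall>i. coeff p i \<in> \<int>" "poly p y = 0"
      by (auto elim!: algebraic_int.cases)
    have p0: "p \<noteq> 0" using p(1) by auto
    have "\<sigma> x \<in> (\<lambda>z. z / of_nat (denom x)) ` {z. poly p z = 0}" if \<sigma>: "\<sigma> \<in> gal" for \<sigma>
    proof -
      have "\<sigma> (coeff p i) = coeff p i" for i
        using p(2)[rule_format, of i] gal_of_int[OF \<sigma>] by (auto elim!: Ints_cases)
      hence "poly p (\<sigma> y) = \<sigma> (poly p y)"
        by (simp add: poly_altdef gal_sum[OF \<sigma>] gal_mult[OF \<sigma>] gal_power[OF \<sigma>])
      hence "poly p (\<sigma> y) = 0" using p(3) gal_0[OF \<sigma>] by simp
      moreover have "\<sigma> x = \<sigma> y / of_nat (denom x)"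
        using denom(1)[of x] by (simp add: y_def gal_mult[OF \<sigma>] gal_of_nat[OF \<sigma>])
      ultimately show ?thesis by blast
    qed
    moreover have "finite ((\<lambda>z. z / of_nat (denom x)) ` {z. poly p z = 0})"
      using poly_roots_finite[OF p0] by simp
    ultimately show ?thesis by blast
  qed
  then obtain R where R: "\<And>x::'a. finite (R x)" "\<And>x \<sigma>. \<sigma> \<in> gal \<Longrightarrow> \<sigma> x \<in> R x" by metis
  have "inj_on (\<lambda>\<sigma>. restrict \<sigma> B) gal"
  proof (rule inj_onI)
    fix \<sigma> \<tau> :: "'a \<Rightarrow> 'a" assume st: "\<sigma> \<in> gal" "\<tau> \<in> gal" "restrict \<sigma> B = restrict \<tau> B"
    have "\<sigma> b = \<tau> b" if "b \<in> B" for b using fun_cong[OF st(3), of b] that by simp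
    hence "\<sigma> x = \<tau> x" for x using gal_eq_on_span[OF st(1,2), of B x] B(2) by simp
    thus "\<sigma> = \<tau>" by blast
  qed
  moreover have "(\<lambda>\<sigma>. restrict \<sigma> B) ` gal \<subseteq> PiE B R" using R(2) by auto
  moreover have "finite (PiE B R)" using B(1) R(1) by (intro finite_PiE)
  ultimately show ?thesis using finite_subset inj_on_finite by metis
qed

section \<open>Traces\<close>

definition trace :: "'a :: field_char_0 \<Rightarrow> 'a" where
  "trace x = (\<Sum>\<sigma>\<in>gal. \<sigma> x)"

lemma trace_of_rat_mult: "trace (of_rat q * x) = of_rat q * trace x"
  unfolding trace_def sum_distrib_left
  by (intro sum.cong refl) (metis gal_mult gal_of_rat)

lemma trace_of_int_mult: "trace (of_int q * x) = of_int q * trace x"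
  using trace_of_rat_mult[of "of_int q" x] by simp

lemma trace_of_nat_mult: "trace (of_nat q * x) = of_nat q * trace x"
  using trace_of_rat_mult[of "of_nat q" x] by simp

lemma trace_sum: "trace (sum f S) = (\<Sum>i\<in>S. trace (f i))"
  unfolding trace_def by (subst sum.swap) (intro sum.cong refl gal_sum)

lemma gal_trace:
  assumes "\<sigma> \<in> gal"
  shows "\<sigma> (trace x) = trace x"
  using sum.reindex_bij_betw[OF bij_betw_gal_comp_left[OF assms], of "\<lambda>\<tau>. \<tau> x"]
  by (simp add: trace_def gal_sum[OF assms])

lemma trace_rat:
  assumes "galois TYPE('a :: field_char_0)"
  shows "\<exists>q. trace (x::'a) = of_rat q"
  using assms gal_trace unfolding galois_def by blast

lemma algebraic_int_sum:
  "(\<And>i. i \<in> S \<Longrightarrow> algebraic_int (f i)) \<Longrightarrow> algebraic_int (sum f S :: 'a :: field_char_0)"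
  by (induction S rule: infinite_finite_induct) (simp_all add: algebraic_int_add)

lemma trace_int:
  assumes "galois TYPE('a :: field_char_0)" "algebraic_int (x::'a)"
  obtains k where "trace x = of_int k"
proof -
  have "algebraic_int (trace x)"
    unfolding trace_def by (rule algebraic_int_sum, rule algebraic_int_gal[OF _ assms(2)])
  moreover have "trace x \<in> \<rat>" using trace_rat[OF assms(1)] by (metis Rats_of_rat)
  ultimately have "trace x \<in> \<int>" by (rule rational_algebraic_int_is_int)
  then obtain k where "trace x = of_int k" by (rule Ints_cases)
  thus ?thesis by (rule that)
qed


section \<open>Dual bases\<close>

lemma Q_basis_finite: "Q_basis (B :: 'a :: number_field set) \<Longrightarrow> finite B"
proof -
  assume "Q_basis B"
  moreover obtain C :: "'a set" where "finite C" "L.span C = UNIV" by (rule exists_Q_basis_span)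
  ultimately show ?thesis using L.independent_span_bound[of C B] by (auto simp: Q_basis_def)
qed

lemma Q_basis_expand:
  fixes B :: "'a :: number_field set"
  assumes "Q_basis B"
  shows "(\<Sum>b\<in>B. of_rat (L.representation B x b) * b) = x"
  using assms Q_basis_finite[OF assms] L.sum_representation_eq[of B x B]
  by (auto simp: Q_basis_def)

text \<open>This is duality read on the group side; \<open>dual_basis_gal\<close> extends it to all
  pairs of automorphisms. The pairing of \<open>d c\<close> with \<open>b\<close> under the trace is
  derived from it in \<open>trace_dual\<close>.\<close>

definition dual_basis :: "'a :: field_char_0 set \<Rightarrow> ('a \<Rightarrow> 'a) \<Rightarrow> bool" where
  "dual_basis B d \<longleftrightarrow> (\<forall>\<sigma>\<in>gal. (\<Sum>b\<in>B. d b * \<sigma> b) = (if \<sigma> = id then 1 else 0))"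

text \<open>
  The functions \<open>\<sigma> \<mapsto> \<Sum>\<^sub>b w\<^sub>b \<sigma>(b)\<close> on the Galois group form a ring which separates points and
  contains the constants, hence contains the indicator functions.
\<close>
lemma exists_dual_basis:
  fixes B :: "'a :: number_field set"
  assumes B: "Q_basis B"
  obtains d where "dual_basis B d"
proof -
  define R :: "(('a \<Rightarrow> 'a) \<Rightarrow> 'a) set" where "R = {f. \<exists>w. \<forall>\<sigma>\<in>gal. f \<sigma> = (\<Sum>b\<in>B. w b * \<sigma> b)}"
  have R_add: "(\<lambda>\<sigma>. f \<sigma> + h \<sigma>) \<in> R" if "f \<in> R" "h \<in> R" for f h
  proof -
    obtain v w where "\<forall>\<sigma>\<in>gal. f \<sigma> = (\<Sum>b\<in>B. v b * \<sigma> b)" "\<forall>\<sigma>\<in>gal. h \<sigma> = (\<Sum>b\<in>B. w b * \<sigma> b)"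
      using \<open>f \<in> R\<close> \<open>h \<in> R\<close> unfolding R_def by blast
    hence "\<forall>\<sigma>\<in>gal. f \<sigma> + h \<sigma> = (\<Sum>b\<in>B. (v b + w b) * \<sigma> b)"
      by (simp add: sum.distrib distrib_right)
    thus ?thesis unfolding R_def mem_Collect_eq by (intro exI)
  qed
  have R_eval: "(\<lambda>\<sigma>. u * \<sigma> v) \<in> R" for u v
  proof -
    have \<sigma>v: "\<sigma> v = (\<Sum>b\<in>B. of_rat (L.representation B v b) * \<sigma> b)" if "\<sigma> \<in> gal" for \<sigma>
      using arg_cong[OF Q_basis_expand[OF B, of v], of \<sigma>]
      by (simp add: gal_sum[OF that] gal_mult[OF that] gal_of_rat[OF that])
    hence "u * \<sigma> v = (\<Sum>b\<in>B. (u * of_rat (L.representation B v b)) * \<sigma> b)" if "\<sigma> \<in> gal" for \<sigma>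
      unfolding \<sigma>v[OF that] by (simp only: sum_distrib_left mult.assoc)
    hence "\<forall>\<sigma>\<in>gal. u * \<sigma> v = (\<Sum>b\<in>B. (u * of_rat (L.representation B v b)) * \<sigma> b)" by blast
    thus ?thesis unfolding R_def mem_Collect_eq by (intro exI)
  qed
  have R_const: "(\<lambda>_. u) \<in> R" for u
  proof -
    obtain w where "\<forall>\<sigma>\<in>gal. u * \<sigma> 1 = (\<Sum>b\<in>B. w b * \<sigma> b)" using R_eval[of u 1] unfolding R_def by blast
    hence "\<forall>\<sigma>\<in>gal. u = (\<Sum>b\<in>B. w b * \<sigma> b)" using gal_1 by (metis mult.right_neutral)
    thus ?thesis unfolding R_def mem_Collect_eq by (intro exI)
  qed
  have R_sum: "(\<lambda>\<sigma>. \<Sum>i\<in>S. f i \<sigma>) \<in> R" if "\<And>i. i \<in> S \<Longrightarrow> f i \<in> R" for S :: "'a set" and f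
    using that
  proof (induction S rule: infinite_finite_induct)
    case (insert i S)
    thus ?case using R_add[of "f i" "\<lambda>\<sigma>. \<Sum>i\<in>S. f i \<sigma>"] by simp
  qed (use R_const in simp_all)
  have R_cong: "f \<in> R" if "h \<in> R" "\<And>\<sigma>. \<sigma> \<in> gal \<Longrightarrow> f \<sigma> = h \<sigma>" for f h
    using that unfolding R_def by auto
  have R_mult: "(\<lambda>\<sigma>. f \<sigma> * h \<sigma>) \<in> R" if "f \<in> R" "h \<in> R" for f h
  proof -
    obtain v w where vw: "\<forall>\<sigma>\<in>gal. f \<sigma> = (\<Sum>b\<in>B. v b * \<sigma> b)" "\<forall>\<sigma>\<in>gal. h \<sigma> = (\<Sum>b\<in>B. w b * \<sigma> b)"
      using \<open>f \<in> R\<close> \<open>h \<in> R\<close> unfolding R_def by blast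
    have "(\<lambda>\<sigma>. \<Sum>b\<in>B. \<Sum>c\<in>B. (v b * w c) * \<sigma> (b * c)) \<in> R"
      by (intro R_sum R_eval)
    thus ?thesis
    proof (rule R_cong)
      fix \<sigma> :: "'a \<Rightarrow> 'a" assume \<sigma>: "\<sigma> \<in> gal"
      show "f \<sigma> * h \<sigma> = (\<Sum>b\<in>B. \<Sum>c\<in>B. (v b * w c) * \<sigma> (b * c))"
        unfolding vw(1)[rule_format, OF \<sigma>] vw(2)[rule_format, OF \<sigma>] sum_product gal_mult[OF \<sigma>]
        by (simp only: mult_ac)
    qed
  qed
  have R_prod: "(\<lambda>\<sigma>. \<Prod>i\<in>S. f i \<sigma>) \<in> R" if "\<And>i. i \<in> S \<Longrightarrow> f i \<in> R" for S :: "('a \<Rightarrow> 'a) set" and f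
    using that
  proof (induction S rule: infinite_finite_induct)
    case (insert i S)
    thus ?case using R_mult[of "f i" "\<lambda>\<sigma>. \<Prod>i\<in>S. f i \<sigma>"] by simp
  qed (use R_const in simp_all)
  have "\<exists>x. \<tau> x \<noteq> x" if "\<tau> \<noteq> id" for \<tau> :: "'a \<Rightarrow> 'a" using that by (auto simp: fun_eq_iff)
  then obtain x :: "('a \<Rightarrow> 'a) \<Rightarrow> 'a" where x: "\<And>\<tau>. \<tau> \<noteq> id \<Longrightarrow> \<tau> (x \<tau>) \<noteq> x \<tau>" by metis
  \<comment> \<open>Lagrange interpolation: the factor for \<open>\<tau>\<close> is \<open>(\<sigma>
    (x \<tau>) - \<tau> (x \<tau>)) / (x \<tau> - \<tau> (x \<tau>))\<close>, which is 1 at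
    \<open>id\<close> and 0 at \<open>\<tau>\<close>. It is split into two summands to match
    \<open>R_eval\<close> and \<open>R_const\<close>.\<close>
  define e where "e = (\<lambda>\<sigma>::'a \<Rightarrow> 'a. \<Prod>\<tau>\<in>gal - {id}.
     (inverse (x \<tau> - \<tau> (x \<tau>)) * \<sigma> (x \<tau>)) + inverse (x \<tau> - \<tau> (x \<tau>)) * - \<tau> (x \<tau>))"
  have "e \<in> R" unfolding e_def by (intro R_prod R_add R_eval R_const)
  then obtain d where d: "\<And>\<sigma>. \<sigma> \<in> gal \<Longrightarrow> e \<sigma> = (\<Sum>b\<in>B. d b * \<sigma> b)" unfolding R_def by blast
  have "e \<sigma> = (if \<sigma> = id then 1 else 0)" if "\<sigma> \<in> gal" for \<sigma>
  proof (cases "\<sigma> = id")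
    case True
    have "(inverse (x \<tau> - \<tau> (x \<tau>)) * id (x \<tau>)) + inverse (x \<tau> - \<tau> (x \<tau>)) * - \<tau> (x \<tau>) = 1"
      if "\<tau> \<noteq> id" for \<tau>
      using x[OF that] by (simp flip: right_diff_distrib)
    hence "e id = 1" unfolding e_def by (intro prod.neutral) auto
    thus ?thesis using True by simp
  next
    case False
    have "e \<sigma> = 0" unfolding e_def
    proof (rule prod_zero)
      show "\<exists>\<tau>\<in>gal - {id}. inverse (x \<tau> - \<tau> (x \<tau>)) * \<sigma> (x \<tau>) + inverse (x \<tau> - \<tau> (x \<tau>)) * - \<tau> (x \<tau>) = 0"
        using that False by (intro bexI[of _ \<sigma>]) (simp_all add: algebra_simps)
    qed (use finite_gal in simp)
    thus ?thesis using False by simp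
  qed
  with d have "dual_basis B d" unfolding dual_basis_def by metis
  thus ?thesis by (rule that)
qed


section \<open>Twisted traces and class functions\<close>

lemma sum_gal_comp_left:
  "\<sigma> \<in> gal \<Longrightarrow> (\<Sum>\<tau>\<in>gal. f (\<sigma> \<circ> \<tau>)) = sum f gal"
  using sum.reindex_bij_betw[OF bij_betw_gal_comp_left] .

text \<open>Up to the factor \<open>card gal\<close>, this is the function
  \<open>\<sigma> \<mapsto> u * \<sigma> v\<close> averaged over the group acting by conjugation and
  on values; at \<open>id\<close> it is \<open>trace (u * v)\<close>. It is restricted because
  \<open>class_functions\<close> contains extensional functions only.\<close>

definition twisted_trace :: "'a :: field_char_0 \<Rightarrow> 'a \<Rightarrow> ('a \<Rightarrow> 'a) \<Rightarrow> 'a" where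
  "twisted_trace u v = restrict (\<lambda>\<sigma>. \<Sum>\<tau>\<in>gal. \<tau> u * \<sigma> (\<tau> v)) gal"

lemma twisted_trace_class_function: "twisted_trace u v \<in> class_functions"
proof -
  have "twisted_trace u v (\<sigma> \<circ> \<tau> \<circ> inv_into UNIV \<sigma>) = \<sigma> (twisted_trace u v \<tau>)"
    if \<sigma>: "\<sigma> \<in> gal" and \<tau>: "\<tau> \<in> gal" for \<sigma> \<tau>
  proof -
    have "twisted_trace u v (\<sigma> \<circ> \<tau> \<circ> inv_into UNIV \<sigma>) =
        (\<Sum>\<rho>\<in>gal. \<rho> u * (\<sigma> \<circ> \<tau> \<circ> inv_into UNIV \<sigma>) (\<rho> v))"
      using gal_comp[OF gal_comp[OF \<sigma> \<tau>] gal_inv[OF \<sigma>]] by (simp add: twisted_trace_def)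
    \<comment> \<open>Reindexing by \<open>\<sigma> \<circ> \<rho>\<close> lets the inverse of
      \<open>\<sigma>\<close> cancel, so that \<open>\<sigma>\<close> can be pulled out of every
      term.\<close>
    also have "\<dots> = (\<Sum>\<rho>\<in>gal. (\<sigma> \<circ> \<rho>) u * (\<sigma> \<circ> \<tau> \<circ> inv_into UNIV \<sigma>) ((\<sigma> \<circ> \<rho>) v))"
      using sum_gal_comp_left[OF \<sigma>, of "\<lambda>\<rho>. \<rho> u * (\<sigma> \<circ> \<tau> \<circ> inv_into UNIV \<sigma>) (\<rho> v)"] by simp
    also have "\<dots> = \<sigma> (twisted_trace u v \<tau>)"
      using \<tau> by (simp add: twisted_trace_def gal_sum[OF \<sigma>] gal_mult[OF \<sigma>] gal_inv_into[OF \<sigma>])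
    finally show ?thesis .
  qed
  thus ?thesis by (auto simp: class_functions_def twisted_trace_def)
qed

lemma twisted_trace_sum_left:
  assumes "\<sigma> \<in> gal"
  shows "twisted_trace (\<Sum>b\<in>B. of_rat (q b) * d b) v \<sigma> = (\<Sum>b\<in>B. of_rat (q b) * twisted_trace (d b) v \<sigma>)"
proof -
  have "\<tau> (\<Sum>b\<in>B. of_rat (q b) * d b) * \<sigma> (\<tau> v) = (\<Sum>b\<in>B. of_rat (q b) * (\<tau> (d b) * \<sigma> (\<tau> v)))"
    if "\<tau> \<in> gal" for \<tau>
    unfolding gal_sum[OF that] gal_mult[OF that] gal_of_rat[OF that]
    by (simp add: sum_distrib_right mult.assoc)
  hence "twisted_trace (\<Sum>b\<in>B. of_rat (q b) * d b) v \<sigma> =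
      (\<Sum>\<tau>\<in>gal. \<Sum>b\<in>B. of_rat (q b) * (\<tau> (d b) * \<sigma> (\<tau> v)))"
    unfolding twisted_trace_def restrict_def using assms by (simp cong: sum.cong)
  also have "\<dots> = (\<Sum>b\<in>B. of_rat (q b) * twisted_trace (d b) v \<sigma>)"
    using assms by (subst sum.swap) (simp add: twisted_trace_def sum_distrib_left)
  finally show ?thesis .
qed

context
  fixes B :: "'a :: number_field set" and d :: "'a \<Rightarrow> 'a"
  assumes d: "dual_basis B d"
begin

text \<open>Apply \<open>\<rho>\<close> to the defining relation at
  \<open>inv_into UNIV \<rho> \<circ> \<sigma>\<close>.\<close>

lemma dual_basis_gal:
  assumes \<sigma>: "\<sigma> \<in> gal" and \<rho>: "\<rho> \<in> gal"
  shows "(\<Sum>b\<in>B. \<rho> (d b) * \<sigma> b) = (if \<sigma> = \<rho> then 1 else 0)"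
proof -
  have "(\<Sum>b\<in>B. d b * (inv_into UNIV \<rho> \<circ> \<sigma>) b) = (if inv_into UNIV \<rho> \<circ> \<sigma> = id then 1 else 0)"
    using d gal_comp[OF gal_inv[OF \<rho>] \<sigma>] unfolding dual_basis_def by blast
  hence "\<rho> (\<Sum>b\<in>B. d b * (inv_into UNIV \<rho> \<circ> \<sigma>) b) = (if inv_into UNIV \<rho> \<circ> \<sigma> = id then 1 else 0)"
    by (simp add: gal_0[OF \<rho>] gal_1[OF \<rho>])
  moreover have "inv_into UNIV \<rho> \<circ> \<sigma> = id \<longleftrightarrow> \<sigma> = \<rho>"
    by (auto simp: fun_eq_iff gal_inv_into[OF \<rho>]) (metis gal_inv_into(1)[OF \<rho>])
  ultimately show ?thesis by (simp add: gal_sum[OF \<rho>] gal_mult[OF \<rho>] gal_inv_into[OF \<rho>])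
qed

text \<open>After interchanging the sums, duality leaves only the term of \<open>\<tau> x\<close>
  with \<open>\<tau> = id\<close>.\<close>

lemma trace_dual_basis_expand: "(\<Sum>b\<in>B. trace (d b * x) * b) = x"
proof -
  have "trace (d b * x) * b = (\<Sum>\<tau>\<in>gal. \<tau> x * (\<tau> (d b) * b))" for b
    unfolding trace_def sum_distrib_right by (intro sum.cong refl) (metis gal_mult mult_ac)
  hence "(\<Sum>b\<in>B. trace (d b * x) * b) = (\<Sum>\<tau>\<in>gal. \<tau> x * (\<Sum>b\<in>B. \<tau> (d b) * b))"
    by (simp add: sum_distrib_left) (rule sum.swap)
  also have "\<dots> = (\<Sum>\<tau>\<in>gal. \<tau> x * (if id = \<tau> then 1 else 0))"
    using dual_basis_gal[OF gal_id] by (intro sum.cong refl) simp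
  also have "\<dots> = x" by (simp add: if_distrib finite_gal gal_id cong: if_cong)
  finally show ?thesis .
qed

lemma dual_basis_expand: "(\<Sum>b\<in>B. trace (u * b) * d b) = u"
proof -
  have "trace (u * b) * d b = (\<Sum>\<tau>\<in>gal. \<tau> u * (d b * \<tau> b))" for b
    unfolding trace_def sum_distrib_right by (intro sum.cong refl) (metis gal_mult mult_ac)
  hence "(\<Sum>b\<in>B. trace (u * b) * d b) = (\<Sum>\<tau>\<in>gal. \<tau> u * (\<Sum>b\<in>B. d b * \<tau> b))"
    by (simp add: sum_distrib_left) (rule sum.swap)
  also have "\<dots> = (\<Sum>\<tau>\<in>gal. \<tau> u * (if \<tau> = id then 1 else 0))"
    using d unfolding dual_basis_def by (intro sum.cong refl) simp
  also have "\<dots> = u" by (simp add: if_distrib finite_gal gal_id cong: if_cong)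
  finally show ?thesis .
qed

text \<open>
  Every function on the Galois group has the form \<open>\<sigma> \<mapsto> \<Sum>\<^sub>c w\<^sub>c \<sigma>(c)\<close>; averaging over conjugation
  turns this into a sum of twisted traces.
\<close>
lemma class_function_expand:
  assumes gal: "galois TYPE('a)" and g: "g \<in> class_functions"
  obtains q :: "'a \<Rightarrow> 'a \<Rightarrow> rat" where
    "\<And>\<sigma>. \<sigma> \<in> gal \<Longrightarrow> g \<sigma> = (\<Sum>b\<in>B. \<Sum>c\<in>B. of_rat (q b c) * twisted_trace (d b) c \<sigma>)"
proof -
  define n where "n = card (gal :: ('a \<Rightarrow> 'a) set)"
  have n: "n > 0" unfolding n_def using finite_gal gal_id by (auto simp: card_gt_0_iff)
  \<comment> \<open>Duality inverts the passage from coefficients \<open>w\<close> to the function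
    \<open>\<sigma> \<mapsto> \<Sum>\<^sub>c w\<^sub>c \<sigma>(c)\<close>. The function aimed at is
    \<open>g / n\<close>, since the later sum over the group contributes a factor
    \<open>n\<close>.\<close>
  define w where "w c = (\<Sum>\<rho>\<in>gal. g \<rho> / of_nat n * \<rho> (d c))" for c
  have w: "(\<Sum>c\<in>B. w c * \<sigma> c) = g \<sigma> / of_nat n" if \<sigma>: "\<sigma> \<in> gal" for \<sigma>
  proof -
    have "(\<Sum>c\<in>B. w c * \<sigma> c) = (\<Sum>\<rho>\<in>gal. g \<rho> / of_nat n * (\<Sum>c\<in>B. \<rho> (d c) * \<sigma> c))"
      unfolding w_def sum_distrib_right sum_distrib_left mult.assoc by (rule sum.swap)
    also have "\<dots> = (\<Sum>\<rho>\<in>gal. g \<rho> / of_nat n * (if \<sigma> = \<rho> then 1 else 0))"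
      using dual_basis_gal[OF \<sigma>] by (intro sum.cong refl) simp
    also have "\<dots> = g \<sigma> / of_nat n" using \<sigma> by (simp add: if_distrib finite_gal cong: if_cong)
    finally show ?thesis .
  qed
  \<comment> \<open>The formula for \<open>w\<close> at
    \<open>inv_into UNIV \<tau> \<circ> \<sigma> \<circ> \<tau>\<close>, moved by
    \<open>\<tau>\<close>, gives \<open>g \<sigma> / n\<close> for each \<open>\<tau>\<close>,
    because \<open>g\<close> is a class function.\<close>
  have *: "(\<Sum>c\<in>B. twisted_trace (w c) c \<sigma>) = g \<sigma>" if \<sigma>: "\<sigma> \<in> gal" for \<sigma>
  proof -
    have "(\<Sum>c\<in>B. \<tau> (w c) * \<sigma> (\<tau> c)) = g \<sigma> / of_nat n" if \<tau>: "\<tau> \<in> gal" for \<tau>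
    proof -
      let ?s = "inv_into UNIV \<tau> \<circ> \<sigma> \<circ> \<tau>"
      have s: "?s \<in> gal" by (intro gal_comp gal_inv \<sigma> \<tau>)
      have "g (\<tau> \<circ> ?s \<circ> inv_into UNIV \<tau>) = \<tau> (g ?s)" using g s \<tau> unfolding class_functions_def by blast
      moreover have "\<tau> \<circ> ?s \<circ> inv_into UNIV \<tau> = \<sigma>" by (simp add: fun_eq_iff gal_inv_into[OF \<tau>])
      ultimately have gs: "\<tau> (g ?s) = g \<sigma>" by simp
      have "\<tau> (\<Sum>c\<in>B. w c * ?s c) = \<tau> (inverse (of_nat n) * g ?s)"
        using w[OF s] by (simp add: field_simps)
      also have "inverse (of_nat n) = (of_rat (inverse (of_nat n)) :: 'a)" by (simp add: of_rat_inverse)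
      also have "\<tau> (of_rat (inverse (of_nat n)) * g ?s) = of_rat (inverse (of_nat n)) * g \<sigma>"
        unfolding gal_mult[OF \<tau>] gal_of_rat[OF \<tau>] gs ..
      also have "\<tau> (\<Sum>c\<in>B. w c * ?s c) = (\<Sum>c\<in>B. \<tau> (w c) * \<sigma> (\<tau> c))"
        by (simp add: gal_sum[OF \<tau>] gal_mult[OF \<tau>] gal_inv_into[OF \<tau>])
        finally show ?thesis by (simp add: of_rat_inverse divide_inverse mult.commute)
    qed
    hence "(\<Sum>\<tau>\<in>gal. \<Sum>c\<in>B. \<tau> (w c) * \<sigma> (\<tau> c)) = (\<Sum>\<tau>\<in>(gal::('a\<Rightarrow>'a) set). g \<sigma> / of_nat n)"
      by (intro sum.cong refl)
    also have "\<dots> = g \<sigma>" using n by (simp add: n_def)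
    finally show ?thesis using \<sigma> by (subst (asm) sum.swap) (simp add: twisted_trace_def)
  qed
  \<comment> \<open>Traces are rational, so expanding \<open>w c\<close> in the dual basis makes all
    coefficients rational.\<close>
  define q where "q b c = (SOME r. trace (w c * b) = of_rat r)" for b c
  have q: "trace (w c * b) = of_rat (q b c)" for b c
    unfolding q_def by (rule someI_ex) (rule trace_rat[OF gal])
  have "g \<sigma> = (\<Sum>b\<in>B. \<Sum>c\<in>B. of_rat (q b c) * twisted_trace (d b) c \<sigma>)" if \<sigma>: "\<sigma> \<in> gal" for \<sigma>
  proof -
    have "w c = (\<Sum>b\<in>B. of_rat (q b c) * d b)" for c
      using dual_basis_expand[of "w c"] by (simp add: q)
    hence "g \<sigma> = (\<Sum>c\<in>B. twisted_trace (\<Sum>b\<in>B. of_rat (q b c) * d b) c \<sigma>)"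
      using *[OF \<sigma>] by simp
    thus ?thesis unfolding twisted_trace_sum_left[OF \<sigma>] by (subst sum.swap)
  qed
  thus ?thesis by (rule that)
qed

end


section \<open>Congruences modulo a prime in commutative rings\<close>

context
  fixes p :: nat
  assumes p: "prime p"
begin

text \<open>The inner binomial coefficients are multiples of \<open>p\<close>; modulo
  \<open>p\<close> the power map is thus additive.\<close>

lemma of_nat_dvd_power_add:
  "of_nat p dvd (x + y) ^ p - (x ^ p + y ^ p)" for x y :: "'r :: comm_ring_1"
proof -
  have p0: "p > 0" using p by (rule prime_gt_0_nat)
  have "(x + y) ^ p = (\<Sum>k\<le>p. of_nat (p choose k) * x ^ k * y ^ (p - k))"
    by (rule binomial_ring)
  also have "{..p} = {0, p} \<union> {0<..<p}" using p0 by auto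
  also have "(\<Sum>k\<in>{0, p} \<union> {0<..<p}. of_nat (p choose k) * x ^ k * y ^ (p - k)) =
      (x ^ p + y ^ p) + (\<Sum>k\<in>{0<..<p}. of_nat (p choose k) * x ^ k * y ^ (p - k))"
    using p0 by (subst sum.union_disjoint) auto
  finally have eq: "(x + y) ^ p - (x ^ p + y ^ p) =
      (\<Sum>k\<in>{0<..<p}. of_nat (p choose k) * x ^ k * y ^ (p - k))" by simp
  show ?thesis unfolding eq
  proof (rule dvd_sum)
    fix k assume "k \<in> {0<..<p}"
    hence "p dvd (p choose k)" using p p0 by (intro dvd_choose_prime) auto
    hence "(of_nat p :: 'r) dvd of_nat (p choose k)" by (metis dvd_def of_nat_mult)
    thus "of_nat p dvd of_nat (p choose k) * x ^ k * y ^ (p - k)" by (intro dvd_mult2)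
  qed
qed

text \<open>Writing \<open>x\<close> as \<open>(x - y) + y\<close> avoids the sign of
  \<open>(-1) ^ p\<close>, which would single out \<open>p = 2\<close>.\<close>

lemma of_nat_dvd_power_diff:
  "of_nat p dvd (x - y) ^ p - (x ^ p - y ^ p)" for x y :: "'r :: comm_ring_1"
  using of_nat_dvd_power_add[of "x - y" y] dvd_minus_iff[of "of_nat p" "x ^ p - ((x - y) ^ p + y ^ p)"]
  by (simp add: algebra_simps)

lemma of_nat_dvd_power_sum:
  "of_nat p dvd (\<Sum>i\<in>S. f i) ^ p - (\<Sum>i\<in>S. f i ^ p)" for f :: "'i \<Rightarrow> 'r :: comm_ring_1"
proof (induction S rule: infinite_finite_induct)
  case (insert i S)
  have "of_nat p dvd ((f i + sum f S) ^ p - (f i ^ p + sum f S ^ p)) + (sum f S ^ p - (\<Sum>i\<in>S. f i ^ p))"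
    by (rule dvd_add[OF of_nat_dvd_power_add insert.IH])
  thus ?case using insert by (simp add: algebra_simps)
qed (use prime_gt_0_nat[OF p] in \<open>simp_all add: power_0_left\<close>)

lemma prime_dvd_int_power_diff: "int p dvd k ^ p - k"
proof -
  have nat: "int p dvd int n ^ p - int n" for n :: nat
  proof (cases "p dvd n")
    case True
    hence "int p dvd int n" by simp
    thus ?thesis using prime_gt_0_nat[OF p] by (intro dvd_diff dvd_trans[OF _ dvd_power]) auto
  next
    case False
    have "[n ^ (p - 1) = 1] (mod p)" by (rule fermat_theorem[OF p False])
    hence "[n * n ^ (p - 1) = n * 1] (mod p)" by (rule cong_scalar_left)
    hence "[n ^ p = n] (mod p)" using prime_gt_0_nat[OF p] by (simp flip: power_Suc)
    hence "[int n ^ p = int n] (mod int p)" by (metis cong_int_iff of_nat_power)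
    thus ?thesis by (simp add: cong_iff_dvd_diff)
  qed
  have "int p dvd int (nat (k mod p)) ^ p - int (nat (k mod p))" by (rule nat)
  hence "[int (nat (k mod p)) ^ p = int (nat (k mod p))] (mod int p)" by (simp add: cong_iff_dvd_diff)
  moreover have "int (nat (k mod p)) = k mod p" using prime_gt_0_nat[OF p] by simp
  ultimately have "[k ^ p = k] (mod int p)" by (simp add: cong_def power_mod)
  thus ?thesis by (simp add: cong_iff_dvd_diff)
qed

lemma of_int_dvd_of_int: "int p dvd k \<Longrightarrow> of_nat p dvd (of_int k :: 'r :: comm_ring_1)"
  by (metis dvd_def of_int_mult of_int_of_nat_eq)

lemma of_nat_dvd_int_power_diff: "of_nat p dvd (of_int k ^ p - of_int k :: 'r :: comm_ring_1)"
  using of_int_dvd_of_int[OF prime_dvd_int_power_diff[of k]] by simp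

lemma prime_bezout:
  assumes "\<not> int p dvd k"
  obtains u v where "u * k + v * int p = 1"
proof -
  have "coprime (int p) k" using assms p by (intro prime_imp_coprime) auto
  thus ?thesis using bezout_int[of k "int p"] that by (auto simp: coprime_commute)
qed

lemma of_nat_dvd_cancel_int:
  fixes x :: "'r :: comm_ring_1"
  assumes "\<not> int p dvd k" "of_nat p dvd of_int k * x"
  shows "of_nat p dvd x"
proof -
  obtain u v where uv: "u * k + v * int p = 1" using prime_bezout[OF assms(1)] .
  have "x = of_int (u * k + v * int p) * x" unfolding uv by simp
  also have "\<dots> = of_int u * (of_int k * x) + of_nat p * (of_int v * x)" by (simp add: algebra_simps)
  finally show ?thesis using assms(2) by (metis dvd_add dvd_mult dvd_triv_left)
qed

text \<open>
  If \<open>x\<close> lies in \<open>V\<^sub>i\<close> only and \<open>y\<close> does not lie in \<open>V\<^sub>i\<close>, then two of the \<open>p\<close> points \<open>y + k x\<close> of a line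
  lie in the same \<open>V\<^sub>j\<close> with \<open>j \<noteq> i\<close>, and hence so does \<open>x\<close>.
\<close>
lemma additive_cover:
  fixes V :: "'i \<Rightarrow> 'r :: comm_ring_1 set"
  assumes "finite I" "card I \<le> p"
    and diff: "\<And>i x y. i \<in> I \<Longrightarrow> x \<in> V i \<Longrightarrow> y \<in> V i \<Longrightarrow> x - y \<in> V i"
    and pV: "\<And>i x. i \<in> I \<Longrightarrow> of_nat p * x \<in> V i"
    and cover: "\<And>x. \<exists>i\<in>I. x \<in> V i"
  shows "\<exists>i\<in>I. V i = UNIV"
  using assms
proof (induction I rule: finite_induct)
  case (insert i I)
  note diff = insert.prems(2) and pV = insert.prems(3) and cov = insert.prems(4)
  have zero: "0 \<in> V j" if "j \<in> Set.insert i I" for j using pV[OF that, of 0] by simp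
  have uminus: "- x \<in> V j" if "j \<in> Set.insert i I" "x \<in> V j" for j x
    using diff[OF that(1) zero[OF that(1)] that(2)] by simp
  have add: "x + y \<in> V j" if "j \<in> Set.insert i I" "x \<in> V j" "y \<in> V j" for j x y
    using diff[OF that(1,2) uminus[OF that(1,3)]] by simp
  have nat_mult: "of_nat n * x \<in> V j" if "j \<in> Set.insert i I" "x \<in> V j" for j x n
    by (induction n) (use that zero add in \<open>auto simp: distrib_right\<close>)
  have int_mult: "of_int k * x \<in> V j" if "j \<in> Set.insert i I" "x \<in> V j" for j x k
    using nat_mult[OF that] uminus[OF that(1)] by (cases k) (auto simp flip: of_nat_Suc)
  show ?case
  proof (cases "\<forall>x. \<exists>j\<in>I. x \<in> V j")
    case True
    thus ?thesis using insert.IH insert.prems insert.hyps by auto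
  next
    case False
    then obtain x where x: "\<And>j. j \<in> I \<Longrightarrow> x \<notin> V j" by blast
    have xi: "x \<in> V i" using cov[of x] x by auto
    have "V i = UNIV"
    proof (rule ccontr)
      assume "V i \<noteq> UNIV"
      then obtain y where y: "y \<notin> V i" by blast
      have "y + of_nat k * x \<notin> V i" for k
        using diff[of i "y + of_nat k * x" "of_nat k * x"] nat_mult[OF _ xi, of k] y by auto
      hence "\<exists>j\<in>I. y + of_nat k * x \<in> V j" for k using cov[of "y + of_nat k * x"] by auto
      then obtain J where J: "\<And>k. J k \<in> I" "\<And>k. y + of_nat k * x \<in> V (J k)" by metis
      \<comment> \<open>There are \<open>p\<close> points but at most \<open>p - 1\<close> sets
        left, as \<open>card (insert i I) \<le> p\<close>.\<close>
      have "\<not> inj_on J {..<p}"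
        using card_inj_on_le[of J "{..<p}" I] J(1) insert.hyps insert.prems(1) by auto
      then obtain k l where kl: "k < p" "l < p" "k < l" "J k = J l"
        unfolding inj_on_def by (metis lessThan_iff linorder_neqE_nat)
      have "(y + of_nat l * x) - (y + of_nat k * x) \<in> V (J k)"
        by (rule diff) (use J[of k] J[of l] kl(4) in auto)
      hence *: "of_nat (l - k) * x \<in> V (J k)" using kl(3) by (simp add: of_nat_diff algebra_simps)
      have "\<not> int p dvd int (l - k)" using kl unfolding int_dvd_int_iff by (auto dest!: dvd_imp_le)
      \<comment> \<open>\<open>l - k\<close> is invertible modulo \<open>p\<close> and
        \<open>V (J k)\<close> contains \<open>of_nat p * x\<close>, so \<open>x\<close> itself is
        recovered from its multiple.\<close>
      then obtain u v where uv: "u * int (l - k) + v * int p = 1" by (rule prime_bezout)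
      have Jk: "J k \<in> Set.insert i I" using J(1) by simp
      have "of_int u * (of_nat (l - k) * x) + of_int v * (of_nat p * x) \<in> V (J k)"
        by (intro add[OF Jk] int_mult[OF Jk] * pV[OF Jk])
      also have "of_int u * (of_nat (l - k) * x) + of_int v * (of_nat p * x) =
          of_int (u * int (l - k) + v * int p) * x" by (simp add: algebra_simps)
      finally show False using x[OF J(1)[of k]] unfolding uv by simp
    qed
    thus ?thesis by blast
  qed
qed auto

end


section \<open>Prime ideals\<close>

lemma ring_of_type_algebra_simps:
  "carrier (ring_of_type_algebra :: 'r :: comm_ring_1 ring) = UNIV"
  "x \<otimes>\<^bsub>ring_of_type_algebra :: 'r ring\<^esub> y = x * y"
  "x \<oplus>\<^bsub>ring_of_type_algebra :: 'r ring\<^esub> y = x + y"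
  "\<zero>\<^bsub>ring_of_type_algebra :: 'r ring\<^esub> = 0"
  "\<one>\<^bsub>ring_of_type_algebra :: 'r ring\<^esub> = 1"
  by (simp_all add: ring_of_type_algebra_def)

lemma ideal_ring_of_type_algebra_iff:
  fixes I :: "'r :: comm_ring_1 set"
  shows "ideal I ring_of_type_algebra \<longleftrightarrow> 0 \<in> I \<and> (\<forall>x\<in>I. \<forall>y\<in>I. x + y \<in> I) \<and> (\<forall>r. \<forall>x\<in>I. r * x \<in> I)"
    (is "_ \<longleftrightarrow> ?R")
proof
  assume "ideal I ring_of_type_algebra"
  then interpret ideal I "ring_of_type_algebra :: 'r ring" .
  have "0 \<in> I" using additive_subgroup.zero_closed[OF is_additive_subgroup]
    unfolding ring_of_type_algebra_simps .
  moreover have "x + y \<in> I" if "x \<in> I" "y \<in> I" for x y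
    using additive_subgroup.a_closed[OF is_additive_subgroup that] unfolding ring_of_type_algebra_simps .
  moreover have "r * x \<in> I" if "x \<in> I" for r x
    using I_l_closed[OF that, of r] unfolding ring_of_type_algebra_simps by blast
  ultimately show ?R by blast
next
  assume R: ?R
  interpret ring "ring_of_type_algebra :: 'r ring" by (rule ring_from_type_algebra)
  have inv: "inv\<^bsub>add_monoid (ring_of_type_algebra :: 'r ring)\<^esub> x = - x" for x
  proof -
    have neg: "(- x) \<oplus>\<^bsub>ring_of_type_algebra\<^esub> x = \<zero>\<^bsub>ring_of_type_algebra\<^esub>"
      unfolding ring_of_type_algebra_simps by (rule left_minus)
    have carr: "y \<in> carrier ring_of_type_algebra" for y :: 'r
      unfolding ring_of_type_algebra_simps by (rule UNIV_I)
    have "a_inv ring_of_type_algebra x = - x" by (rule minus_equality[OF neg carr carr])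
    thus ?thesis unfolding a_inv_def .
  qed
  have R0: "0 \<in> I" and R_add: "\<And>x y. x \<in> I \<Longrightarrow> y \<in> I \<Longrightarrow> x + y \<in> I"
    and R_mult: "\<And>r x. x \<in> I \<Longrightarrow> r * x \<in> I"
    using R by blast+
  have R_uminus: "- x \<in> I" if "x \<in> I" for x using R_mult[OF that, of "- 1"] by simp
  show "ideal I ring_of_type_algebra"
  proof (rule idealI)
    show "subgroup I (add_monoid (ring_of_type_algebra :: 'r ring))"
      by (rule subgroup.intro, unfold inv)
        (simp_all only: monoid.simps partial_object.simps ring_of_type_algebra_simps
          subset_UNIV R0 R_add R_uminus)
    show "x \<otimes>\<^bsub>ring_of_type_algebra\<^esub> a \<in> I" "a \<otimes>\<^bsub>ring_of_type_algebra\<^esub> x \<in> I" if "a \<in> I" for a x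
      unfolding ring_of_type_algebra_simps using R_mult[OF that, of x] by (simp_all only: mult.commute)
  qed (rule ring_axioms)
qed

lemma primeideal_ring_of_type_algebra_iff:
  fixes I :: "'r :: comm_ring_1 set"
  shows "primeideal I ring_of_type_algebra \<longleftrightarrow>
    0 \<in> I \<and> (\<forall>x\<in>I. \<forall>y\<in>I. x + y \<in> I) \<and> (\<forall>r. \<forall>x\<in>I. r * x \<in> I) \<and> 1 \<notin> I \<and>
    (\<forall>x y. x * y \<in> I \<longrightarrow> x \<in> I \<or> y \<in> I)" (is "_ \<longleftrightarrow> ?R")
proof
  assume "primeideal I ring_of_type_algebra"
  then interpret primeideal I "ring_of_type_algebra :: 'r ring" .
  show ?R using is_ideal I_prime I_notcarr one_imp_carrier
    by (auto simp: ideal_ring_of_type_algebra_iff ring_of_type_algebra_simps)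
next
  assume R: ?R
  show "primeideal I ring_of_type_algebra"
    by (rule primeidealI)
      (use R in \<open>auto simp: ideal_ring_of_type_algebra_iff ring_of_type_algebra_simps\<close>)
qed

text \<open>Zorn's lemma gives an ideal maximal among those containing \<open>a\<close> and missing
  1, and maximality makes it prime. The family is nonempty because the multiples of the non-unit
  \<open>a\<close> form a member.\<close>

lemma exists_primeideal:
  fixes a :: "'r :: comm_ring_1"
  assumes "\<not> a dvd 1"
  obtains P where "primeideal P ring_of_type_algebra" "a \<in> P"
proof -
  define \<I> where "\<I> = {I. ideal I (ring_of_type_algebra :: 'r ring) \<and> a \<in> I \<and> 1 \<notin> I}"
  have "range ((*) a) \<in> \<I>"
    unfolding \<I>_def mem_Collect_eq ideal_ring_of_type_algebra_iff
  proof (intro conjI ballI allI)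
    show "0 \<in> range ((*) a)" by (rule range_eqI[of _ _ 0]) simp
    show "a \<in> range ((*) a)" by (rule range_eqI[of _ _ 1]) simp
    show "1 \<notin> range ((*) a)" using assms by (auto simp: dvd_def)
    show "x + y \<in> range ((*) a)" if xy: "x \<in> range ((*) a)" "y \<in> range ((*) a)" for x y
    proof -
      obtain u v where "x = a * u" "y = a * v" using xy by blast
      hence "x + y = a * (u + v)" by (simp add: distrib_left)
      thus ?thesis by (rule range_eqI)
    qed
    show "r * x \<in> range ((*) a)" if x: "x \<in> range ((*) a)" for r x
    proof -
      obtain u where "x = a * u" using x by blast
      hence "r * x = a * (r * u)" by (simp add: mult.left_commute)
      thus ?thesis by (rule range_eqI)
    qed
  qed
  hence "\<exists>M\<in>\<I>. \<forall>N\<in>\<I>. M \<subseteq> N \<longrightarrow> N = M"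
  proof (intro subset_Zorn_nonempty)
    fix \<C> assume C: "\<C> \<noteq> {}" "subset.chain \<I> \<C>"
    have sub: "\<C> \<subseteq> \<I>" and ch: "\<And>J K. J \<in> \<C> \<Longrightarrow> K \<in> \<C> \<Longrightarrow> J \<subseteq> K \<or> K \<subseteq> J"
      using C(2) by (auto simp: subset_chain_def)
    have ideal: "0 \<in> J" "a \<in> J" "1 \<notin> J" "\<And>x y. x \<in> J \<Longrightarrow> y \<in> J \<Longrightarrow> x + y \<in> J"
      "\<And>r x. x \<in> J \<Longrightarrow> r * x \<in> J" if "J \<in> \<C>" for J
      using subsetD[OF sub that] unfolding \<I>_def mem_Collect_eq ideal_ring_of_type_algebra_iff by blast+
    show "\<Union> \<C> \<in> \<I>"
      unfolding \<I>_def mem_Collect_eq ideal_ring_of_type_algebra_iff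
    proof (intro conjI ballI allI)
      fix x y assume "x \<in> \<Union> \<C>" "y \<in> \<Union> \<C>"
      then obtain J K where "x \<in> J" "J \<in> \<C>" "y \<in> K" "K \<in> \<C>" by blast
      thus "x + y \<in> \<Union> \<C>" using ch[of J K] ideal(4)[of J] ideal(4)[of K] by blast
    next
      obtain J where "J \<in> \<C>" using C(1) by blast
      thus "0 \<in> \<Union> \<C>" "a \<in> \<Union> \<C>" using ideal(1,2) by auto
    next
      show "1 \<notin> \<Union> \<C>" using ideal(3) by auto
    next
      fix r x assume "x \<in> \<Union> \<C>"
      then obtain J where "x \<in> J" "J \<in> \<C>" by blast
      thus "r * x \<in> \<Union> \<C>" using ideal(5)[of J x r] by auto
    qed
  qed auto
  then obtain M where M: "M \<in> \<I>" and max: "\<And>J. J \<in> \<I> \<Longrightarrow> M \<subseteq> J \<Longrightarrow> J = M" by blast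
  have "ideal M ring_of_type_algebra" and aM: "a \<in> M" and M1: "1 \<notin> M"
    using M unfolding \<I>_def by auto
  hence M0: "0 \<in> M" and M_add: "\<And>x y. x \<in> M \<Longrightarrow> y \<in> M \<Longrightarrow> x + y \<in> M"
    and M_mult: "\<And>r x. x \<in> M \<Longrightarrow> r * x \<in> M"
    unfolding ideal_ring_of_type_algebra_iff by simp_all
  \<comment> \<open>Outside \<open>M\<close> every element is invertible modulo \<open>M\<close>:
    otherwise \<open>M + R x\<close> would be a larger member of the family.\<close>
  have unit: "\<exists>r. 1 - r * x \<in> M" if x: "x \<notin> M" for x
  proof -
    let ?J = "{m + r * x | m r. m \<in> M}"
    have "ideal ?J ring_of_type_algebra" unfolding ideal_ring_of_type_algebra_iff
    proof (intro conjI ballI allI)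
      have "0 = 0 + 0 * x" by simp
      thus "0 \<in> ?J" using M0 by blast
    next
      fix y z assume "y \<in> ?J" "z \<in> ?J"
      then obtain m r n s where "y = m + r * x" "z = n + s * x" "m \<in> M" "n \<in> M" by blast
      hence "y + z = (m + n) + (r + s) * x" "m + n \<in> M" using M_add by (simp_all add: algebra_simps)
      thus "y + z \<in> ?J" by blast
    next
      fix s y assume "y \<in> ?J"
      then obtain m r where "y = m + r * x" "m \<in> M" by blast
      hence "s * y = s * m + (s * r) * x" "s * m \<in> M" using M_mult by (simp_all add: algebra_simps)
      thus "s * y \<in> ?J" by blast
    qed
    moreover have "M \<subseteq> ?J"
    proof
      fix m assume "m \<in> M"
      moreover have "m = m + 0 * x" by simp
      ultimately show "m \<in> ?J" by blast
    qed
    moreover have "x \<in> ?J"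
    proof -
      have "x = 0 + 1 * x" by simp
      thus ?thesis using M0 by blast
    qed
    ultimately have "?J \<notin> \<I>" using max x by blast
    with \<open>ideal ?J _\<close> \<open>M \<subseteq> ?J\<close> aM have "1 \<in> ?J" unfolding \<I>_def by blast
    then obtain m r where "1 = m + r * x" "m \<in> M" by blast
    moreover from this have "1 - r * x = m" by (simp add: diff_eq_eq)
    ultimately show ?thesis by blast
  qed
  have "x \<in> M \<or> y \<in> M" if xy: "x * y \<in> M" for x y
  proof (rule ccontr)
    assume "\<not> (x \<in> M \<or> y \<in> M)"
    then obtain r s where r: "1 - r * x \<in> M" and s: "1 - s * y \<in> M" using unit by blast
    have "(1 - r * x) + ((r * x) * (1 - s * y) + (r * s) * (x * y)) \<in> M"
      by (intro M_add M_mult r s xy)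
    thus False using M1 by (simp add: algebra_simps)
  qed
  hence "primeideal M ring_of_type_algebra"
    unfolding primeideal_ring_of_type_algebra_iff using M0 M_add M_mult M1 by blast
  thus ?thesis using that aM by blast
qed


section \<open>The Galois action on algebraic integers\<close>

lemmas of_algint_simps = zero_algint.rep_eq one_algint.rep_eq plus_algint.rep_eq minus_algint.rep_eq
  uminus_algint.rep_eq times_algint.rep_eq

lemma of_algint_power: "of_algint (x ^ n) = of_algint x ^ n"
  by (induction n) (simp_all add: of_algint_simps)

lemma of_algint_sum: "of_algint (sum f S) = (\<Sum>i\<in>S. of_algint (f i))"
  by (induction S rule: infinite_finite_induct) (simp_all add: of_algint_simps)

lemma of_algint_prod: "of_algint (prod f S) = (\<Prod>i\<in>S. of_algint (f i))"
  by (induction S rule: infinite_finite_induct) (simp_all add: of_algint_simps)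

lemma algebraic_int_of_algint: "algebraic_int (of_algint x)"
  using of_algint[of x] by simp

lemma of_to_algint: "algebraic_int x \<Longrightarrow> of_algint (to_algint x) = x"
  by (rule to_algint_inverse) simp

definition gal_int :: "('a :: field_char_0 \<Rightarrow> 'a) \<Rightarrow> 'a algint \<Rightarrow> 'a algint" where
  "gal_int \<sigma> x = to_algint (\<sigma> (of_algint x))"

context
  fixes \<sigma> :: "'a :: field_char_0 \<Rightarrow> 'a"
  assumes \<sigma>: "\<sigma> \<in> gal"
begin

lemma of_algint_gal_int: "of_algint (gal_int \<sigma> x) = \<sigma> (of_algint x)"
  unfolding gal_int_def by (rule of_to_algint, rule algebraic_int_gal[OF \<sigma> algebraic_int_of_algint])

lemma gal_int_diff: "gal_int \<sigma> (x - y) = gal_int \<sigma> x - gal_int \<sigma> y"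
  and gal_int_mult: "gal_int \<sigma> (x * y) = gal_int \<sigma> x * gal_int \<sigma> y"
  and gal_int_of_nat: "gal_int \<sigma> (of_nat n) = of_nat n"
  and gal_int_power: "gal_int \<sigma> (x ^ n) = gal_int \<sigma> x ^ n"
  by (simp_all add: of_algint_inject[symmetric] of_algint_gal_int of_algint_simps of_algint_power
      gal_diff[OF \<sigma>] gal_mult[OF \<sigma>] gal_of_nat[OF \<sigma>] gal_power[OF \<sigma>])

end

section \<open>Polynomials whose roots are the conjugates of an element\<close>

context
  fixes \<tau> :: "'a :: field_char_0 \<Rightarrow> 'a"
  assumes \<tau>: "\<tau> \<in> gal"
begin

lemma map_poly_gal_mult: "map_poly \<tau> (p * q) = map_poly \<tau> p * map_poly \<tau> q"
  by (rule poly_eqI) (simp add: coeff_map_poly gal_0[OF \<tau>] coeff_mult gal_sum[OF \<tau>] gal_mult[OF \<tau>])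

lemma map_poly_gal_prod: "map_poly \<tau> (prod f S) = (\<Prod>i\<in>S. map_poly \<tau> (f i))"
proof (induction S rule: infinite_finite_induct)
  case (insert i S)
  thus ?case by (simp add: map_poly_gal_mult)
qed (simp_all add: map_poly_1 gal_1[OF \<tau>])

end

text \<open>The coefficients are algebraic integers, being built from conjugates of
  \<open>y\<close>, and they are rational, since an automorphism only permutes the linear factors. A
  rational algebraic integer is an integer.\<close>

lemma norm_poly_integral:
  fixes y :: "'a :: number_field"
  assumes gal: "galois TYPE('a)" and y: "algebraic_int y"
  obtains k where "coeff (\<Prod>\<sigma>\<in>gal. [:- \<sigma> y, 1:]) i = of_int k"
proof -
  define F where "F = (\<Prod>\<sigma>\<in>gal. [:- \<sigma> y, 1:])"
  have "\<forall>i. algebraic_int (coeff (\<Prod>\<sigma>\<in>S. [:- \<sigma> y, 1:]) i)"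
    if "finite S" "S \<subseteq> gal" for S :: "('a \<Rightarrow> 'a) set"
    using that
  proof (induction S rule: finite_induct)
    case (insert \<sigma> S)
    have "algebraic_int (\<sigma> y)" using algebraic_int_gal[OF _ y] insert.prems by simp
    hence lin: "algebraic_int (coeff [:- \<sigma> y, 1:] i)" for i
      by (auto simp: coeff_pCons split: nat.splits)
    have "algebraic_int (\<Sum>j\<le>i. coeff [:- \<sigma> y, 1:] j * coeff (\<Prod>\<sigma>\<in>S. [:- \<sigma> y, 1:]) (i - j))" for i
      using insert by (intro algebraic_int_sum algebraic_int_mult[OF lin]) simp
    thus ?case using insert.hyps by (simp only: prod.insert coeff_mult not_False_eq_True) simp
  qed (auto simp: one_pCons coeff_pCons split: nat.splits)
  hence "algebraic_int (coeff F i)" unfolding F_def using finite_gal by blast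
  moreover have "\<tau> (coeff F i) = coeff F i" if \<tau>: "\<tau> \<in> gal" for \<tau>
  proof -
    have "map_poly \<tau> F = (\<Prod>\<sigma>\<in>gal. map_poly \<tau> [:- \<sigma> y, 1:])"
      unfolding F_def by (rule map_poly_gal_prod[OF \<tau>])
    also have "\<dots> = (\<Prod>\<sigma>\<in>gal. [:- (\<tau> \<circ> \<sigma>) y, 1:])"
      using gal_diff[OF \<tau>, of 0] by (simp add: map_poly_pCons gal_0[OF \<tau>] gal_1[OF \<tau>])
    also have "\<dots> = F"
      unfolding F_def
      using prod.reindex_bij_betw[OF bij_betw_gal_comp_left[OF \<tau>], of "\<lambda>\<sigma>. [:- \<sigma> y, 1:]"] .
    finally show ?thesis using coeff_map_poly[of \<tau> F i] gal_0[OF \<tau>] by simp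
  qed
  hence "coeff F i \<in> \<rat>" using gal unfolding galois_def Rats_def by blast
  ultimately have "coeff F i \<in> \<int>" by (rule rational_algebraic_int_is_int)
  then obtain k where "coeff F i = of_int k" by (rule Ints_cases)
  thus ?thesis unfolding F_def by (rule that)
qed

text \<open>The characteristic polynomial of \<open>x\<close> has integral coefficients, so modulo \<open>p\<close> it vanishes at \<open>x\<^sup>p\<close>.\<close>
lemma dvd_prod_power_minus_gal:
  fixes x :: "'a :: number_field algint"
  assumes gal: "galois TYPE('a)" and p: "prime p"
  shows "of_nat p dvd (\<Prod>\<sigma>\<in>gal. x ^ p - gal_int \<sigma> x)"
proof -
  define y where "y = of_algint x"
  define F where "F = (\<Prod>\<sigma>\<in>gal. [:- \<sigma> y, 1:])"
  define n where "n = degree F"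
  have y: "algebraic_int y" unfolding y_def by (rule algebraic_int_of_algint)
  define c where "c i = (SOME k. coeff F i = of_int k)" for i
  have c: "coeff F i = of_int (c i)" for i
    unfolding c_def F_def by (rule someI_ex) (rule norm_poly_integral[OF gal y], blast)
  have eval: "(\<Sum>i\<le>n. of_int (c i) * z ^ i) = (\<Prod>\<sigma>\<in>gal. z - \<sigma> y)" for z
  proof -
    have "(\<Sum>i\<le>n. of_int (c i) * z ^ i) = poly F z" unfolding poly_altdef n_def c ..
    also have "\<dots> = (\<Prod>\<sigma>\<in>gal. z - \<sigma> y)" unfolding F_def poly_prod by (intro prod.cong) auto
    finally show ?thesis .
  qed
  have eq0: "(\<Sum>i\<le>n. of_int (c i) * x ^ i) = 0"
  proof -
    have "of_algint (\<Sum>i\<le>n. of_int (c i) * x ^ i) = (\<Sum>i\<le>n. of_int (c i) * y ^ i)"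
      by (simp add: of_algint_sum of_algint_simps of_algint_power y_def)
    also have "\<dots> = 0" unfolding eval using finite_gal gal_id by (intro prod_zero bexI[of _ id]) auto
    finally show ?thesis by (simp add: of_algint_inject[symmetric] of_algint_simps)
  qed
  have eqp: "(\<Prod>\<sigma>\<in>gal. x ^ p - gal_int \<sigma> x) = (\<Sum>i\<le>n. of_int (c i) * (x ^ p) ^ i)"
  proof -
    have "of_algint (\<Sum>i\<le>n. of_int (c i) * (x ^ p) ^ i) = (\<Prod>\<sigma>\<in>gal. y ^ p - \<sigma> y)"
      unfolding eval[symmetric] by (simp add: of_algint_sum of_algint_simps of_algint_power y_def)
    also have "\<dots> = of_algint (\<Prod>\<sigma>\<in>gal. x ^ p - gal_int \<sigma> x)"
      by (simp add: of_algint_prod of_algint_simps of_algint_power of_algint_gal_int y_def)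
    finally show ?thesis by (simp add: of_algint_inject)
  qed
  \<comment> \<open>Modulo \<open>p\<close>, raising the relation at \<open>x\<close> to the
    \<open>p\<close>-th power termwise and then using Fermat on the coefficients yields the value at
    \<open>x ^ p\<close>.\<close>
  have "of_nat p dvd (\<Sum>i\<le>n. of_int (c i) * x ^ i) ^ p - (\<Sum>i\<le>n. (of_int (c i) * x ^ i) ^ p)"
    by (rule of_nat_dvd_power_sum[OF p])
  hence 1: "of_nat p dvd (\<Sum>i\<le>n. (of_int (c i) * x ^ i) ^ p)"
    unfolding eq0 using prime_gt_0_nat[OF p] by (simp add: power_0_left)
  have "of_nat p dvd (\<Sum>i\<le>n. (of_int (c i) ^ p - of_int (c i)) * (x ^ p) ^ i)"
    by (intro dvd_sum dvd_mult2 of_nat_dvd_int_power_diff[OF p])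
  also have "(\<Sum>i\<le>n. (of_int (c i) ^ p - of_int (c i)) * (x ^ p) ^ i) =
      (\<Sum>i\<le>n. (of_int (c i) * x ^ i) ^ p) - (\<Sum>i\<le>n. of_int (c i) * (x ^ p) ^ i)"
    by (simp add: sum_subtractf algebra_simps power_mult_distrib flip: power_mult)
  finally have "of_nat p dvd (\<Sum>i\<le>n. (of_int (c i) * x ^ i) ^ p) - (\<Sum>i\<le>n. of_int (c i) * (x ^ p) ^ i)" .
  from dvd_diff[OF 1 this] show ?thesis unfolding eqp by simp
qed


section \<open>Primes of the ring of integers\<close>

context
  fixes P :: "'a :: number_field algint set" and p :: nat
  assumes P: "P \<in> primes_over p"
begin

lemma
  shows primes_over_0: "0 \<in> P"
    and primes_over_add: "\<And>x y. x \<in> P \<Longrightarrow> y \<in> P \<Longrightarrow> x + y \<in> P"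
    and primes_over_mult: "\<And>x r. x \<in> P \<Longrightarrow> r * x \<in> P"
    and primes_over_1: "1 \<notin> P"
    and primes_over_prime: "\<And>x y. x * y \<in> P \<Longrightarrow> x \<in> P \<or> y \<in> P"
    and primes_over_of_nat: "of_nat p \<in> P"
  using P unfolding primes_over_def mem_Collect_eq primeideal_ring_of_type_algebra_iff by simp_all

lemma primes_over_mult_right: "x \<in> P \<Longrightarrow> x * r \<in> P"
  using primes_over_mult[of x r] by (simp add: mult.commute)

lemma primes_over_uminus: "x \<in> P \<Longrightarrow> - x \<in> P"
  using primes_over_mult[of x "-1"] by simp

lemma primes_over_diff: "x \<in> P \<Longrightarrow> y \<in> P \<Longrightarrow> x - y \<in> P"
  using primes_over_add[of x "- y"] primes_over_uminus[of y] by simp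

lemma primes_over_dvd: "of_nat p dvd x \<Longrightarrow> x \<in> P"
  using primes_over_mult_right[OF primes_over_of_nat] by (auto elim!: dvdE)

lemma primes_over_sum: "(\<And>i. i \<in> S \<Longrightarrow> f i \<in> P) \<Longrightarrow> sum f S \<in> P"
  by (induction S rule: infinite_finite_induct) (simp_all add: primes_over_0 primes_over_add)

lemma primes_over_prod: "finite S \<Longrightarrow> prod f S \<in> P \<Longrightarrow> \<exists>i\<in>S. f i \<in> P"
  by (induction S rule: finite_induct) (use primes_over_1 primes_over_prime in auto)

lemma primes_over_power: "x ^ n \<in> P \<Longrightarrow> x \<in> P"
  by (induction n) (use primes_over_1 primes_over_prime in auto)

text \<open>An integer prime to \<open>p\<close> inside \<open>P\<close> would put 1 into
  \<open>P\<close> by Bezout. This turns congruences modulo \<open>P\<close> between integers into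
  congruences modulo \<open>p\<close>.\<close>

lemma primes_over_of_int_iff:
  assumes p: "prime p"
  shows "of_int k \<in> P \<longleftrightarrow> int p dvd k"
proof
  assume k: "of_int k \<in> P"
  show "int p dvd k"
  proof (rule ccontr)
    assume "\<not> int p dvd k"
    then obtain u v where "u * k + v * int p = 1" by (rule prime_bezout[OF p])
    hence "of_int u * of_int k + of_int v * of_nat p = (1 :: 'a algint)"
      by (metis of_int_1 of_int_add of_int_mult of_int_of_nat_eq)
    moreover have "of_int u * of_int k + of_int v * of_nat p \<in> P"
      by (rule primes_over_add[OF primes_over_mult[OF k] primes_over_mult[OF primes_over_of_nat]])
    ultimately show False using primes_over_1 by simp
  qed
next
  assume "int p dvd k"
  thus "of_int k \<in> P" by (rule primes_over_dvd[OF of_int_dvd_of_int[OF p]])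
qed

text \<open>Since \<open>P\<close> is prime, each \<open>x\<close> makes some factor of
  \<open>\<Prod>\<^sub>\<sigma> (x\<^sup>p - \<sigma>(x))\<close> vanish modulo \<open>P\<close>;
  \<open>additive_cover\<close> turns this \<open>\<sigma>\<close> depending on \<open>x\<close>
  into a single one.\<close>

lemma exists_frobenius:
  assumes gal: "galois TYPE('a)" and p: "prime p" and card: "card (gal :: ('a \<Rightarrow> 'a) set) \<le> p"
  shows "\<exists>\<sigma>\<in>gal. \<forall>x. gal_int \<sigma> x - x ^ p \<in> P"
proof -
  define V where "V \<sigma> = {x :: 'a algint. gal_int \<sigma> x - x ^ p \<in> P}" for \<sigma>
  have "\<exists>\<sigma>\<in>gal. V \<sigma> = UNIV"
  proof (rule additive_cover[OF p finite_gal card])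
    fix \<sigma> :: "'a \<Rightarrow> 'a" and x y :: "'a algint"
    assume \<sigma>: "\<sigma> \<in> gal" and xy: "x \<in> V \<sigma>" "y \<in> V \<sigma>"
    have "(gal_int \<sigma> x - x ^ p) - (gal_int \<sigma> y - y ^ p) - ((x - y) ^ p - (x ^ p - y ^ p)) \<in> P"
      using xy unfolding V_def mem_Collect_eq
      by (rule primes_over_diff[OF primes_over_diff primes_over_dvd[OF of_nat_dvd_power_diff[OF p]]])
    thus "x - y \<in> V \<sigma>" by (simp add: V_def gal_int_diff[OF \<sigma>] algebra_simps)
  next
    fix \<sigma> :: "'a \<Rightarrow> 'a" and x :: "'a algint"
    assume \<sigma>: "\<sigma> \<in> gal"
    have "gal_int \<sigma> (of_nat p * x) - (of_nat p * x) ^ p =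
        of_nat p * gal_int \<sigma> x - of_nat p * (x * (of_nat p * x) ^ (p - 1))"
      using prime_gt_0_nat[OF p]
      by (simp add: gal_int_mult[OF \<sigma>] gal_int_of_nat[OF \<sigma>] power_eq_if[of _ p] mult.assoc)
    also have "\<dots> \<in> P" by (rule primes_over_dvd) (intro dvd_diff dvd_triv_left)
    finally show "of_nat p * x \<in> V \<sigma>" by (simp add: V_def)
  next
    fix x :: "'a algint"
    have "(\<Prod>\<sigma>\<in>gal. x ^ p - gal_int \<sigma> x) \<in> P"
      by (rule primes_over_dvd[OF dvd_prod_power_minus_gal[OF gal p]])
    then obtain \<sigma> where \<sigma>: "\<sigma> \<in> gal" "x ^ p - gal_int \<sigma> x \<in> P"
      using primes_over_prod[OF finite_gal] by blast
    thus "\<exists>\<sigma>\<in>gal. x \<in> V \<sigma>" using primes_over_uminus[OF \<sigma>(2)] by (auto simp: V_def)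
  qed
  thus ?thesis unfolding V_def by blast
qed

end

lemma primes_over_nonempty:
  assumes "prime p"
  shows "primes_over p \<noteq> ({} :: 'a :: field_char_0 algint set set)"
  using exists_primeideal[OF prime_not_dvd_one[OF assms, where 'a = "'a algint"]]
  unfolding primes_over_def by blast


section \<open>Frobenius elements at primes not dividing a discriminant\<close>

lemma common_denom:
  assumes "finite (T :: 'a :: number_field set)"
  obtains D :: nat where "D > 0" "\<And>x. x \<in> T \<Longrightarrow> algebraic_int (of_nat D * x)"
proof -
  define D where "D = (\<Prod>x\<in>T. denom x)"
  have "algebraic_int (of_nat D * x)" if "x \<in> T" for x
  proof -
    have "D = denom x * (\<Prod>y\<in>T - {x}. denom y)"
      unfolding D_def using assms that by (rule prod.remove)
    hence "of_nat D * x = of_int (int (\<Prod>y\<in>T - {x}. denom y)) * (of_nat (denom x) * x)"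
      by (simp add: mult_ac)
    thus ?thesis using denom(2)[of x] by (simp only: algebraic_int_mult[OF int_imp_algebraic_int[OF Ints_of_int]])
  qed
  moreover have "D > 0" unfolding D_def by (intro prod_pos denom(1))
  ultimately show ?thesis by (intro that)
qed

text \<open>\<open>D\<close> stands in for a discriminant: \<open>\<beta>\<close> and
  \<open>\<delta>\<close> clear the denominators of the basis and its dual, and \<open>D * D\<close>
  is invertible modulo every prime not dividing \<open>D\<close>.\<close>

locale integral_dual_basis =
  fixes B :: "'a :: number_field set" and d :: "'a \<Rightarrow> 'a" and D :: nat
    and \<beta> \<delta> :: "'a \<Rightarrow> 'a algint"
  assumes gal: "galois TYPE('a)"
    and dual: "dual_basis B d"
    and D: "D > 0"
    and \<beta>: "\<And>b. b \<in> B \<Longrightarrow> of_nat D * b = of_algint (\<beta> b)"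
    and \<delta>: "\<And>b. b \<in> B \<Longrightarrow> of_nat D * d b = of_algint (\<delta> b)"
begin

text \<open>The expansion \<open>x = \<Sum>\<^sub>b Tr(d\<^sub>b x) b\<close> is cleared by one
  \<open>D\<close> for \<open>d b\<close> and one for \<open>b\<close>. Its coefficients become
  integers that are sums of conjugates, so they can be tested modulo a prime ideal.\<close>

lemma int_trace_expand:
  "\<exists>t :: 'a \<Rightarrow> int. (\<forall>b\<in>B. of_int (t b) = (\<Sum>\<sigma>\<in>gal. gal_int \<sigma> (\<delta> b * x))) \<and>
     of_nat (D * D) * x = (\<Sum>b\<in>B. of_int (t b) * \<beta> b)"
proof -
  define t where "t b = (SOME k. trace (of_algint (\<delta> b * x)) = of_int k)" for b
  have t: "trace (of_algint (\<delta> b * x)) = of_int (t b)" for b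
    unfolding t_def
    by (rule someI_ex) (rule trace_int[OF gal algebraic_int_of_algint[of "\<delta> b * x"]], blast)
  have "of_int (t b) = (\<Sum>\<sigma>\<in>gal. gal_int \<sigma> (\<delta> b * x))" for b
  proof -
    have "of_algint (\<Sum>\<sigma>\<in>gal. gal_int \<sigma> (\<delta> b * x)) = of_algint (of_int (t b))"
      by (simp add: of_algint_sum of_algint_gal_int t[symmetric] trace_def)
    thus ?thesis by (simp only: of_algint_inject)
  qed
  moreover have "of_nat (D * D) * x = (\<Sum>b\<in>B. of_int (t b) * \<beta> b)"
  proof -
    have tr: "of_nat (D * D) * (trace (d b * of_algint x) * b) = of_int (t b) * of_algint (\<beta> b)"
      if "b \<in> B" for b
    proof -
      have "of_int (t b) = trace (of_nat D * (d b * of_algint x))"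
        using \<delta>[OF that] by (simp add: t[symmetric] of_algint_simps mult.assoc flip: \<delta>[OF that])
      also have "\<dots> = of_nat D * trace (d b * of_algint x)" by (rule trace_of_nat_mult)
      finally show ?thesis by (simp add: \<beta>[OF that, symmetric] mult_ac)
    qed
    have "of_algint (of_nat (D * D) * x) = of_nat (D * D) * (\<Sum>b\<in>B. trace (d b * of_algint x) * b)"
      unfolding trace_dual_basis_expand[OF dual] times_algint.rep_eq of_algint_of_nat ..
    also have "\<dots> = (\<Sum>b\<in>B. of_int (t b) * of_algint (\<beta> b))"
      unfolding sum_distrib_left by (intro sum.cong refl tr)
    also have "\<dots> = of_algint (\<Sum>b\<in>B. of_int (t b) * \<beta> b)"
      by (simp add: of_algint_sum of_algint_simps)
    finally show ?thesis by (simp only: of_algint_inject)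
  qed
  ultimately show ?thesis by blast
qed

section \<open>Reducedness, unramifiedness and the Frobenius at a prime not dividing
  \<open>D\<close>\<close>

context
  fixes p :: nat
  assumes p: "prime p" and pD: "\<not> p dvd D"
begin

lemma not_dvd_DD: "\<not> int p dvd int (D * D)"
  using p pD by (metis int_dvd_int_iff prime_dvd_mult_nat)

text \<open>Inertia is trivial: for distinct automorphisms, the duality relations with values 1 and
  0, scaled by \<open>D * D\<close>, differ by a sum of terms in \<open>P\<close>. That puts
  \<open>D * D\<close> into \<open>P\<close>, although \<open>p\<close> does not divide
  \<open>D\<close>.\<close>

lemma gal_cong_imp_eq:
  fixes P :: "'a algint set"
  assumes P: "P \<in> primes_over p" and \<sigma>: "\<sigma> \<in> gal" and \<tau>: "\<tau> \<in> gal"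
    and cong: "\<And>x. gal_int \<sigma> x - gal_int \<tau> x \<in> P"
  shows "\<sigma> = \<tau>"
proof (rule ccontr)
  assume neq: "\<sigma> \<noteq> \<tau>"
  have eq: "of_nat (D * D) = (\<Sum>b\<in>B. gal_int \<sigma> (\<delta> b) * (gal_int \<sigma> (\<beta> b) - gal_int \<tau> (\<beta> b)))"
  proof -
    have "of_algint (gal_int \<sigma> (\<delta> b) * (gal_int \<sigma> (\<beta> b) - gal_int \<tau> (\<beta> b))) =
        of_nat (D * D) * (\<sigma> (d b) * \<sigma> b - \<sigma> (d b) * \<tau> b)" if "b \<in> B" for b
      using \<beta>[OF that] \<delta>[OF that]
      by (simp add: of_algint_simps of_algint_gal_int \<sigma> \<tau> gal_mult[OF \<sigma>] gal_mult[OF \<tau>]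
          gal_of_nat[OF \<sigma>] gal_of_nat[OF \<tau>] algebra_simps flip: \<beta>[OF that] \<delta>[OF that])
    hence "of_algint (\<Sum>b\<in>B. gal_int \<sigma> (\<delta> b) * (gal_int \<sigma> (\<beta> b) - gal_int \<tau> (\<beta> b))) =
        of_nat (D * D) * ((\<Sum>b\<in>B. \<sigma> (d b) * \<sigma> b) - (\<Sum>b\<in>B. \<sigma> (d b) * \<tau> b))"
      unfolding of_algint_sum sum_subtractf[symmetric] sum_distrib_left by (intro sum.cong refl)
    also have "\<dots> = of_algint (of_nat (D * D))"
      using neq by (simp add: dual_basis_gal[OF dual \<sigma> \<sigma>] dual_basis_gal[OF dual \<tau> \<sigma>] of_algint_simps)
    finally show ?thesis by (simp only: of_algint_inject)
  qed
  have "of_nat (D * D) \<in> P"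
    unfolding eq by (intro primes_over_sum[OF P] primes_over_mult[OF P] cong)
  hence "of_int (int (D * D)) \<in> P" by simp
  thus False using primes_over_of_int_iff[OF P p] not_dvd_DD by blast
qed

text \<open>All conjugates of \<open>\<delta> b * x\<close> have a power in \<open>P\<close>, so
  they lie in \<open>P\<close>, and so do the integral coefficients of \<open>D * D * x\<close>.
  Being integers, these are multiples of \<open>p\<close>, which is why one prime over
  \<open>p\<close> suffices.\<close>

lemma dvd_power_imp_dvd:
  assumes x: "of_nat p dvd (x :: 'a algint) ^ k"
  shows "of_nat p dvd x"
proof -
  obtain P :: "'a algint set" where P: "P \<in> primes_over p" using primes_over_nonempty[OF p] by blast
  obtain t where t: "\<And>b. b \<in> B \<Longrightarrow> of_int (t b) = (\<Sum>\<sigma>\<in>gal. gal_int \<sigma> (\<delta> b * x))"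
    and exp: "of_nat (D * D) * x = (\<Sum>b\<in>B. of_int (t b) * \<beta> b)"
    using int_trace_expand by blast
  have "of_nat p dvd (of_int (t b) * \<beta> b)" if b: "b \<in> B" for b
  proof -
    have "gal_int \<sigma> (\<delta> b * x) \<in> P" if \<sigma>: "\<sigma> \<in> gal" for \<sigma>
    proof (rule primes_over_power[OF P])
      obtain y where y: "x ^ k = of_nat p * y" using x by (rule dvdE)
      have "gal_int \<sigma> (\<delta> b * x) ^ k = gal_int \<sigma> (\<delta> b) ^ k * gal_int \<sigma> (x ^ k)"
        by (simp add: gal_int_mult[OF \<sigma>] gal_int_power[OF \<sigma>] power_mult_distrib)
      also have "\<dots> = of_nat p * (gal_int \<sigma> (\<delta> b) ^ k * gal_int \<sigma> y)"
        unfolding y gal_int_mult[OF \<sigma>] gal_int_of_nat[OF \<sigma>] by (simp add: mult_ac)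
      also have "\<dots> \<in> P" by (rule primes_over_dvd[OF P dvd_triv_left])
      finally show "gal_int \<sigma> (\<delta> b * x) ^ k \<in> P" .
    qed
    hence "of_int (t b) \<in> P" unfolding t[OF b] by (intro primes_over_sum[OF P])
    hence "int p dvd t b" using primes_over_of_int_iff[OF P p] by blast
    thus ?thesis by (intro dvd_mult2 of_int_dvd_of_int[OF p])
  qed
  hence "of_nat p dvd (of_nat (D * D) * x)" unfolding exp by (intro dvd_sum)
  hence "of_nat p dvd (of_int (int (D * D)) * x)" by simp
  thus ?thesis by (rule of_nat_dvd_cancel_int[OF p not_dvd_DD])
qed

text \<open>Since \<open>O\<^sub>L/p\<close> is reduced, its localization at \<open>P\<close> is a field.\<close>
lemma exists_annihilator:
  fixes P :: "'a algint set"
  assumes P: "P \<in> primes_over p" and x: "x \<in> P"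
  obtains w where "w \<notin> P" "of_nat p dvd (w * x)"
proof -
  obtain n c where n: "n > 0" "of_algint x ^ n = (\<Sum>k<n. of_int (c k) * of_algint x ^ k)"
    using algebraic_int_power_relation[OF algebraic_int_of_algint[of x]] .
  define a where "a k = (if k = n then 1 else - c k)" for k
  have "of_algint (x ^ n) = of_algint (\<Sum>k<n. of_int (c k) * x ^ k)"
    using n(2) by (simp add: of_algint_power of_algint_sum of_algint_simps)
  hence xn: "x ^ n = (\<Sum>k<n. of_int (c k) * x ^ k)" by (simp only: of_algint_inject)
  have "(\<Sum>k\<le>n. of_int (a k) * x ^ k) = x ^ n + (\<Sum>k<n. - (of_int (c k) * x ^ k))"
    by (simp add: a_def flip: lessThan_Suc_atMost)
  hence a0: "(\<Sum>k\<le>n. of_int (a k) * x ^ k) = 0" by (simp add: xn sum_negf)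
  \<comment> \<open>The lowest coefficient not divisible by \<open>p\<close>; it exists because the
    leading one is 1. Modulo \<open>p\<close> the equation reads \<open>x ^ i * w = 0\<close>, where
    \<open>w\<close> is congruent to \<open>a i\<close> modulo \<open>P\<close>.\<close>
  define i where "i = (LEAST k. \<not> int p dvd a k)"
  have "\<not> int p dvd a n" using p by (auto simp: a_def dest: not_prime_unit)
  hence ai: "\<not> int p dvd a i" and in_: "i \<le> n" and below: "\<And>k. k < i \<Longrightarrow> int p dvd a k"
    unfolding i_def
    using LeastI[of "\<lambda>k. \<not> int p dvd a k"] Least_le[of "\<lambda>k. \<not> int p dvd a k"] not_less_Least
    by blast+
  define w where "w = (\<Sum>k\<in>{i..n}. of_int (a k) * x ^ (k - i))"
  have "w \<notin> P"
  proof
    assume w: "w \<in> P"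
    have "w = of_int (a i) + (\<Sum>k\<in>{Suc i..n}. of_int (a k) * x ^ (k - i))"
      unfolding w_def by (subst sum.atLeast_Suc_atMost[OF in_]) simp
    moreover have "(\<Sum>k\<in>{Suc i..n}. of_int (a k) * x ^ (k - i)) \<in> P"
    proof (rule primes_over_sum[OF P])
      fix k assume "k \<in> {Suc i..n}"
      hence "x ^ (k - i) = x * x ^ (k - i - 1)" by (simp add: power_eq_if[of _ "k - i"])
      thus "of_int (a k) * x ^ (k - i) \<in> P"
        using primes_over_mult[OF P primes_over_mult_right[OF P x]] by simp
    qed
    ultimately have "of_int (a i) \<in> P" using primes_over_diff[OF P w] by fastforce
    thus False using ai primes_over_of_int_iff[OF P p] by blast
  qed
  moreover have "of_nat p dvd (w * x)"
  proof (rule dvd_power_imp_dvd)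
    have "0 = (\<Sum>k<i. of_int (a k) * x ^ k) + (\<Sum>k\<in>{i..n}. of_int (a k) * x ^ k)"
      unfolding a0[symmetric] using in_
      by (subst sum.union_disjoint[symmetric]) (auto intro: sum.cong)
    also have "(\<Sum>k\<in>{i..n}. of_int (a k) * x ^ k) = x ^ i * w"
      unfolding w_def sum_distrib_left by (intro sum.cong refl) (simp add: mult_ac flip: power_add)
    finally have "x ^ i * w = - (\<Sum>k<i. of_int (a k) * x ^ k)"
      by (simp add: eq_neg_iff_add_eq_0 add.commute)
    moreover have "of_nat p dvd (\<Sum>k<i. of_int (a k) * x ^ k)"
      by (intro dvd_sum dvd_mult2 of_int_dvd_of_int[OF p] below) simp
    ultimately have "of_nat p dvd (x ^ i * w)" by simp
    \<comment> \<open>The extra factor completes a power of \<open>w * x\<close>, from which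
      reducedness removes the exponent.\<close>
    hence "of_nat p dvd (x ^ i * w) * (x * w ^ i)" by (rule dvd_mult2)
    thus "of_nat p dvd (w * x) ^ Suc i" by (simp add: power_mult_distrib mult_ac)
  qed
  ultimately show ?thesis by (rule that)
qed

text \<open>Annihilators multiply: each element of the square of \<open>P\<close> is sent into the
  multiples of \<open>p * p\<close> by some \<open>w\<close> outside \<open>P\<close>. For the
  element \<open>p\<close> itself this forces \<open>p\<close> to divide \<open>w\<close>, hence
  \<open>w\<close> to lie in \<open>P\<close>.\<close>

lemma not_in_square:
  fixes P :: "'a algint set"
  assumes P: "P \<in> primes_over p"
  shows "of_nat p \<notin> P \<cdot>\<^bsub>OL\<^esub> P"
proof
  have "\<exists>w. w \<notin> P \<and> of_nat (p * p) dvd (w * t)" if "t \<in> P \<cdot>\<^bsub>OL\<^esub> P" for t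
    using that
  proof induction
    case (prod x y)
    obtain v w where v: "v \<notin> P" "of_nat p dvd (v * x)" and w: "w \<notin> P" "of_nat p dvd (w * y)"
      using exists_annihilator[OF P prod(1)] exists_annihilator[OF P prod(2)] by metis
    have "of_nat p * of_nat p dvd (v * x) * (w * y)" by (rule mult_dvd_mono[OF v(2) w(2)])
    moreover have "v * w \<notin> P" using primes_over_prime[OF P] v w by blast
    ultimately show ?case
      by (intro exI[of _ "v * w"]) (simp add: ring_of_type_algebra_simps mult_ac)
  next
    case (sum s t)
    then obtain v w where v: "v \<notin> P" "of_nat (p * p) dvd (v * s)" and w: "w \<notin> P" "of_nat (p * p) dvd (w * t)"
      by blast
    have "of_nat (p * p) dvd w * (v * s) + v * (w * t)" by (intro dvd_add dvd_mult v w)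
    moreover have "v * w \<notin> P" using primes_over_prime[OF P] v w by blast
    ultimately show ?case
      by (intro exI[of _ "v * w"]) (simp add: ring_of_type_algebra_simps algebra_simps)
  qed
  moreover assume "of_nat p \<in> P \<cdot>\<^bsub>OL\<^esub> P"
  ultimately obtain w where w: "w \<notin> P" "of_nat (p * p) dvd (w * of_nat p)" by blast
  have "(of_nat p :: 'a algint) \<noteq> 0"
    using prime_gt_0_nat[OF p] by (simp add: of_algint_inject[symmetric] of_algint_simps)
  hence "of_nat p dvd w" using w(2) by (simp add: mult.commute)
  thus False using primes_over_dvd[OF P] w(1) by blast
qed

text \<open>\<open>p\<close> lies in \<open>P\<close> but not in its square, and all higher powers
  are contained in the square.\<close>

lemma unramified_not_dvd: "unramified TYPE('a) p"
  unfolding unramified_def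
proof
  fix P :: "'a algint set" assume P: "P \<in> primes_over p"
  let ?Q = "\<lambda>e. PIdl\<^bsub>OL\<^esub> (of_nat p) \<subseteq> P [^]\<^bsub>ideals_set OL\<^esub> (e :: nat)"
  have Suc: "P [^]\<^bsub>ideals_set OL\<^esub> Suc e = (P [^]\<^bsub>ideals_set OL\<^esub> e) \<cdot>\<^bsub>OL\<^esub> P" for e :: nat
    by (simp add: nat_pow_def ideals_set_def)
  \<comment> \<open>Powers start from the unit ideal, so the first power is the product of
    \<open>UNIV\<close> and \<open>P\<close> rather than literally \<open>P\<close>.\<close>
  have Zero: "P [^]\<^bsub>ideals_set OL\<^esub> (0::nat) = UNIV"
    by (simp add: nat_pow_def ideals_set_def ring_of_type_algebra_simps)
  have "?Q 1"
  proof
    fix x :: "'a algint" assume "x \<in> PIdl\<^bsub>OL\<^esub> (of_nat p)"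
    hence "x \<in> P" using primes_over_mult[OF P primes_over_of_nat[OF P]]
      by (auto simp: cgenideal_def ring_of_type_algebra_simps)
    hence "1 \<otimes>\<^bsub>OL\<^esub> x \<in> UNIV \<cdot>\<^bsub>OL\<^esub> P" by (intro ideal_prod.prod) auto
    thus "x \<in> P [^]\<^bsub>ideals_set OL\<^esub> (1::nat)"
      by (simp only: One_nat_def Suc Zero ring_of_type_algebra_simps mult_1)
  qed
  moreover have "e \<le> 1" if e: "?Q e" for e
  proof (rule ccontr)
    assume "\<not> e \<le> 1"
    \<comment> \<open>With \<open>e = m + 2\<close> the power is \<open>(I P) P\<close> for
      \<open>I\<close> the \<open>m\<close>-th power, and \<open>I P\<close> is contained in
      \<open>P\<close>.\<close>
    then obtain m where m: "e = Suc (Suc m)" by (metis One_nat_def nat_le_linear not_less_eq_eq old.nat.exhaust le0)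
    have sub: "x \<in> P" if "x \<in> I \<cdot>\<^bsub>OL\<^esub> P" for I and x :: "'a algint"
      using that by induction (simp_all add: ring_of_type_algebra_simps primes_over_add[OF P] primes_over_mult[OF P])
    have sub2: "x \<in> P \<cdot>\<^bsub>OL\<^esub> P" if "x \<in> (I \<cdot>\<^bsub>OL\<^esub> P) \<cdot>\<^bsub>OL\<^esub> P" for I and x :: "'a algint"
      using that by induction (use sub in \<open>auto intro: ideal_prod.intros\<close>)
    have "1 * of_nat p \<in> PIdl\<^bsub>OL\<^esub> (of_nat p)"
      unfolding cgenideal_def ring_of_type_algebra_simps by blast
    hence "of_nat p \<in> P [^]\<^bsub>ideals_set OL\<^esub> e" using e by auto
    hence "of_nat p \<in> P \<cdot>\<^bsub>OL\<^esub> P" unfolding m Suc by (rule sub2)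
    thus False using not_in_square[OF P] by blast
  qed
  ultimately show "ramification_index p P = 1"
    unfolding ramification_index_def by (intro Greatest_equality)
qed

text \<open>Two candidates are congruent modulo \<open>P\<close> everywhere, hence equal by
  \<open>gal_cong_imp_eq\<close>; so the description in \<open>frobenius_element\<close> is
  definite.\<close>

lemma frobenius_element:
  fixes P :: "'a algint set"
  assumes P: "P \<in> primes_over p" and card: "card (gal :: ('a \<Rightarrow> 'a) set) \<le> p"
  shows "frobenius_element p P \<in> gal" "gal_int (frobenius_element p P) x - x ^ p \<in> P"
proof -
  obtain \<phi> where \<phi>: "\<phi> \<in> gal" "\<And>x. gal_int \<phi> x - x ^ p \<in> P"
    using exists_frobenius[OF P gal p card] by blast
  have "frobenius_element p P = \<phi>"
    unfolding frobenius_element_def gal_int_def[symmetric]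
  proof (rule the_equality)
    show "\<phi> \<in> gal \<and> (\<forall>x. gal_int \<phi> x - x ^ p \<in> P)" using \<phi> by blast
    fix \<tau> assume \<tau>: "\<tau> \<in> gal \<and> (\<forall>x. gal_int \<tau> x - x ^ p \<in> P)"
    show "\<tau> = \<phi>"
    proof (rule gal_cong_imp_eq[OF P])
      fix x
      have "(gal_int \<tau> x - x ^ p) - (gal_int \<phi> x - x ^ p) \<in> P"
        by (rule primes_over_diff[OF P _ \<phi>(2)]) (use \<tau> in blast)
      thus "gal_int \<tau> x - gal_int \<phi> x \<in> P" by simp
    qed (use \<tau> \<phi> in blast)+
  qed
  thus "frobenius_element p P \<in> gal" "gal_int (frobenius_element p P) x - x ^ p \<in> P" using \<phi> by simp_all
qed

end

end


section \<open>The elements \<open>(g(\<phi>\<^sub>p) mod p)\<^sub>p\<close>\<close>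

text \<open>With \<open>z = denom x * x\<close> one has \<open>n * z = denom x * y\<close>, and the
  modular inverse in \<open>reduce\<close> cancels \<open>denom x\<close>. So a common denominator
  \<open>n\<close> may replace the individual ones.\<close>

lemma reduce_cong:
  fixes x :: "'a :: number_field"
  assumes p: "prime p" "coprime p (denom x)" and y: "of_nat n * x = of_algint y"
  shows "of_nat p dvd of_nat n * reduce p x - y"
proof -
  define z where "z = to_algint (of_nat (denom x) * x)"
  have z: "of_algint z = of_nat (denom x) * x" unfolding z_def by (rule of_to_algint[OF denom(2)])
  define m where "m = modular_inverse (int p) (int (denom x))"
  have "coprime (int (denom x)) (int p)" using p(2) by (simp add: coprime_commute)
  hence "[int (denom x) * m = 1] (mod int p)" unfolding m_def by (rule cong_modular_inverse1)
  hence dvd: "int p dvd int (denom x) * m - 1" by (simp add: cong_iff_dvd_diff)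
  have "of_algint (of_nat n * z) = of_algint (of_nat (denom x) * y)"
    using y by (simp add: of_algint_simps z mult_ac flip: y)
  hence nz: "of_nat n * z = of_nat (denom x) * y" by (simp only: of_algint_inject)
  have "of_nat n * reduce p x = of_int m * (of_nat n * z)"
    unfolding reduce_def m_def[symmetric] z_def[symmetric] by (simp add: mult_ac)
  hence "of_nat n * reduce p x - y = of_int (int (denom x) * m - 1) * y"
    unfolding nz by (simp add: algebra_simps)
  thus ?thesis using of_int_dvd_of_int[OF p(1) dvd] by (metis dvd_mult2)
qed

lemma prime_seq_eqI:
  assumes "\<forall>\<^sub>F p in sequentially. prime p \<longrightarrow> of_nat p dvd f p - g p"
  shows "prime_seq f = prime_seq g"
  using assms by (simp add: prime_seq_eq_iff eq_mod_primes_def)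

text \<open>
  The element \<open>s\<close> of \<open>\<A>\<close> is \<open>(g(\<phi>\<^sub>P) mod P)\<^sub>p\<close> for almost all \<open>p\<close> and all \<open>P\<close> over \<open>p\<close>, expressed after
  multiplication by a common denominator \<open>n\<close> of the values of \<open>g\<close>.
\<close>
definition frobenius_value :: "(('a :: number_field \<Rightarrow> 'a) \<Rightarrow> 'a) \<Rightarrow> ring_A \<Rightarrow> bool" where
  "frobenius_value g s \<longleftrightarrow> (\<exists>n h a. n > 0 \<and> (\<forall>\<tau>\<in>gal. of_nat n * g \<tau> = of_algint (h \<tau>)) \<and>
     (\<forall>\<^sub>F p in sequentially. prime p \<longrightarrow>
        (\<forall>P\<in>primes_over p. h (frobenius_element p P) - of_int (a p) \<in> P)) \<and>
     of_nat n * s = prime_seq a)"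

lemma frobenius_valueI:
  assumes "n > 0" "\<And>\<tau>. \<tau> \<in> gal \<Longrightarrow> of_nat n * g \<tau> = of_algint (h \<tau>)"
    "\<forall>\<^sub>F p in sequentially. prime p \<longrightarrow>
        (\<forall>P\<in>primes_over p. h (frobenius_element p P) - of_int (a p) \<in> P)"
    "of_nat n * s = prime_seq a"
  shows "frobenius_value g s"
  unfolding frobenius_value_def using assms by blast

lemma frobenius_value_cong:
  assumes "frobenius_value g s" "\<And>\<tau>. \<tau> \<in> gal \<Longrightarrow> g' \<tau> = g \<tau>"
  shows "frobenius_value g' s"
  using assms unfolding frobenius_value_def by simp

lemma frobenius_value_0: "frobenius_value (\<lambda>_. 0) 0"
proof (rule frobenius_valueI[where n = 1 and h = "\<lambda>_. 0" and a = "\<lambda>_. 0"])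
  show "of_nat 1 * 0 = prime_seq (\<lambda>_. 0 :: int)" using of_nat_mod_primes[of 0, where 'a = int] by simp
qed (simp_all add: of_algint_simps primes_over_0)

lemma frobenius_value_add:
  fixes g g' :: "('a :: number_field \<Rightarrow> 'a) \<Rightarrow> 'a"
  assumes "frobenius_value g s" "frobenius_value g' s'"
  shows "frobenius_value (\<lambda>\<tau>. g \<tau> + g' \<tau>) (s + s')"
proof -
  obtain n h a where 1: "n > 0" "\<And>\<tau>. \<tau> \<in> gal \<Longrightarrow> of_nat n * g \<tau> = of_algint (h \<tau>)"
    "\<forall>\<^sub>F p in sequentially. prime p \<longrightarrow> (\<forall>P\<in>primes_over p. h (frobenius_element p P) - of_int (a p) \<in> P)"
    "of_nat n * s = prime_seq a"
    using assms(1) unfolding frobenius_value_def by blast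
  obtain n' h' a' where 2: "n' > 0" "\<And>\<tau>. \<tau> \<in> gal \<Longrightarrow> of_nat n' * g' \<tau> = of_algint (h' \<tau>)"
    "\<forall>\<^sub>F p in sequentially. prime p \<longrightarrow> (\<forall>P\<in>primes_over p. h' (frobenius_element p P) - of_int (a' p) \<in> P)"
    "of_nat n' * s' = prime_seq a'"
    using assms(2) unfolding frobenius_value_def by blast
  define k where "k \<tau> = of_nat n' * h \<tau> + of_nat n * h' \<tau>" for \<tau>
  define c where "c p = int n' * a p + int n * a' p" for p
  show ?thesis
  proof (rule frobenius_valueI)
    show "n * n' > 0" using 1(1) 2(1) by simp
    show "of_nat (n * n') * (g \<tau> + g' \<tau>) = of_algint (k \<tau>)" if "\<tau> \<in> gal" for \<tau>
      unfolding k_def of_algint_simps of_algint_of_nat 1(2)[OF that, symmetric] 2(2)[OF that, symmetric]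
      by (simp add: algebra_simps)
    show "\<forall>\<^sub>F p in sequentially. prime p \<longrightarrow>
        (\<forall>P\<in>primes_over p. k (frobenius_element p P) - of_int (c p) \<in> P)"
      using 1(3) 2(3)
    proof eventually_elim
      case (elim p)
      show ?case
      proof (intro impI ballI)
        fix P :: "'a algint set" assume p: "prime p" and P: "P \<in> primes_over p"
        let ?\<phi> = "frobenius_element p P"
        have "of_nat n' * (h ?\<phi> - of_int (a p)) + of_nat n * (h' ?\<phi> - of_int (a' p)) \<in> P"
          using elim p P by (intro primes_over_add[OF P] primes_over_mult[OF P]) auto
        thus "k ?\<phi> - of_int (c p) \<in> P" by (simp add: k_def c_def algebra_simps)
      qed
    qed
    have "of_nat (n * n') * (s + s') = of_nat n' * (of_nat n * s) + of_nat n * (of_nat n' * s')"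
      by (simp add: algebra_simps)
    also have "\<dots> = prime_seq c"
      unfolding 1(4) 2(4) by (simp add: of_nat_mod_primes prime_seq_mult prime_seq_add c_def[abs_def])
    finally show "of_nat (n * n') * (s + s') = prime_seq c" .
  qed
qed

lemma frobenius_value_scale:
  fixes g :: "('a :: number_field \<Rightarrow> 'a) \<Rightarrow> 'a"
  assumes "frobenius_value g s"
  shows "frobenius_value (\<lambda>\<tau>. of_rat q * g \<tau>) (scale_A q s)"
proof -
  obtain n h a where 1: "n > 0" "\<And>\<tau>. \<tau> \<in> gal \<Longrightarrow> of_nat n * g \<tau> = of_algint (h \<tau>)"
    "\<forall>\<^sub>F p in sequentially. prime p \<longrightarrow> (\<forall>P\<in>primes_over p. h (frobenius_element p P) - of_int (a p) \<in> P)"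
    "of_nat n * s = prime_seq a"
    using assms unfolding frobenius_value_def by blast
  obtain e k where e: "e > 0" "of_nat e * q = of_int k" using rat_common_denom[of q q] .
  have "of_rat (of_nat e * q) = (of_int k :: 'a)" unfolding e(2) by simp
  hence ek: "of_nat e * of_rat q = (of_int k :: 'a)" by (simp add: of_rat_mult)
  show ?thesis
  proof (rule frobenius_valueI)
    show "e * n > 0" using 1(1) e(1) by simp
    show "of_nat (e * n) * (of_rat q * g \<tau>) = of_algint (of_int k * h \<tau>)" if "\<tau> \<in> gal" for \<tau>
    proof -
      have "of_nat (e * n) * (of_rat q * g \<tau>) = (of_nat e * of_rat q) * (of_nat n * g \<tau>)"
        by (simp add: mult_ac)
      thus ?thesis unfolding ek 1(2)[OF that] by (simp add: of_algint_simps)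
    qed
    show "\<forall>\<^sub>F p in sequentially. prime p \<longrightarrow>
        (\<forall>P\<in>primes_over p. of_int k * h (frobenius_element p P) - of_int (k * a p) \<in> P)"
      using 1(3)
    proof eventually_elim
      case (elim p)
      show ?case
      proof (intro impI ballI)
        fix P :: "'a algint set" assume p: "prime p" and P: "P \<in> primes_over p"
        let ?\<phi> = "frobenius_element p P"
        have "of_int k * (h ?\<phi> - of_int (a p)) \<in> P" using elim p P by (intro primes_over_mult[OF P]) auto
        thus "of_int k * h ?\<phi> - of_int (k * a p) \<in> P" by (simp add: algebra_simps)
      qed
    qed
    have "of_nat (e * n) * scale_A q s = (of_nat e * rat_A q) * (of_nat n * s)"
      by (simp add: scale_A_def mult_ac)
    also have "\<dots> = prime_seq (\<lambda>p. k * a p)"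
      unfolding rat_A_eqI[OF e] 1(4) by (simp add: of_int_mod_primes prime_seq_mult)
    finally show "of_nat (e * n) * scale_A q s = prime_seq (\<lambda>p. k * a p)" .
  qed
qed

lemma frobenius_value_sum:
  assumes "\<And>i. i \<in> S \<Longrightarrow> frobenius_value (g i) (s i)"
  shows "frobenius_value (\<lambda>\<tau>. \<Sum>i\<in>S. g i \<tau>) (\<Sum>i\<in>S. s i)"
  using assms
proof (induction S rule: infinite_finite_induct)
  case (insert i S)
  thus ?case using frobenius_value_add[of "g i" "s i" "\<lambda>\<tau>. \<Sum>i\<in>S. g i \<tau>" "\<Sum>i\<in>S. s i"] by simp
qed (use frobenius_value_0 in simp_all)

section \<open>Values of class functions and of twisted traces at Frobenius elements\<close>

context integral_dual_basis
begin

lemma eventually_good_prime: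
  "\<forall>\<^sub>F p in sequentially. card (gal :: ('a \<Rightarrow> 'a) set) \<le> p \<and> \<not> p dvd D"
  using eventually_gt_at_top[of D] eventually_ge_at_top[of "card (gal :: ('a \<Rightarrow> 'a) set)"]
proof eventually_elim
  case (elim p)
  thus ?case using D by (auto dest: dvd_imp_le)
qed

text \<open>For large \<open>p\<close> the residue is \<open>a p\<close> divided by
  \<open>n\<close>. Independence of the prime over \<open>p\<close> comes from
  \<open>frobenius_value\<close>, whose \<open>a p\<close> serves all of them.\<close>

lemma eval_frobenius_eqI:
  fixes g :: "('a \<Rightarrow> 'a) \<Rightarrow> 'a"
  assumes val: "frobenius_value g s"
  shows "prime_seq (eval_frobenius g) = (s :: ring_A)"
proof -
  obtain n h a where n: "n > 0" and h: "\<And>\<tau>. \<tau> \<in> gal \<Longrightarrow> of_nat n * g \<tau> = of_algint (h \<tau>)"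
    and ev: "\<forall>\<^sub>F p in sequentially. prime p \<longrightarrow>
      (\<forall>P\<in>primes_over p. h (frobenius_element p P) - of_int (a p) \<in> P)"
    and s: "of_nat n * s = prime_seq a"
    using val unfolding frobenius_value_def by blast
  have "\<forall>\<^sub>F p in sequentially. \<forall>\<tau>\<in>gal. denom (g \<tau>) < p"
    using finite_gal eventually_gt_at_top by (intro eventually_ball_finite) auto
  hence "\<forall>\<^sub>F p in sequentially. prime p \<longrightarrow> of_nat p dvd int n * eval_frobenius g p - a p"
    using ev eventually_good_prime eventually_gt_at_top[of n]
  proof eventually_elim
    case (elim p)
    show ?case
    proof
      assume p: "prime p"
      have card: "card (gal :: ('a \<Rightarrow> 'a) set) \<le> p" and pD: "\<not> p dvd D" using elim by auto
      have pn: "\<not> int p dvd int n" using elim n by (auto dest: dvd_imp_le)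
      then obtain u v where uv: "u * int n + v * int p = 1" by (rule prime_bezout[OF p])
      have cop: "coprime p (denom (g \<tau>))" if "\<tau> \<in> gal" for \<tau>
      proof (rule prime_imp_coprime[OF p])
        show "\<not> p dvd denom (g \<tau>)" using elim(1) that denom(1)[of "g \<tau>"] dvd_imp_le[of p "denom (g \<tau>)"] by fastforce
      qed
      define Q where "Q c \<longleftrightarrow> 0 \<le> c \<and> c < int p \<and>
        (\<forall>P\<in>primes_over p. reduce p (g (frobenius_element p P)) - of_int c \<in> P)" for c
      \<comment> \<open>\<open>u\<close> inverts \<open>n\<close> modulo \<open>p\<close>, and the
        reduction brings the residue into the range required by
        \<open>eval_frobenius\<close>.\<close>
      define c where "c = (u * a p) mod int p"
      have "int n * c - a p = int n * (c - u * a p) - int p * (v * a p)"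
        using arg_cong[OF uv, of "\<lambda>x. x * a p"] by (simp add: algebra_simps)
      moreover have "int p dvd c - u * a p" unfolding c_def by (simp add: mod_eq_dvd_iff[symmetric])
      ultimately have nc: "int p dvd int n * c - a p" by (metis dvd_diff dvd_mult dvd_triv_left)
      have "reduce p (g (frobenius_element p P)) - of_int c \<in> P" if P: "P \<in> primes_over p" for P :: "'a algint set"
      proof -
        let ?\<phi> = "frobenius_element p P"
        let ?r = "reduce p (g ?\<phi>)"
        have \<phi>: "?\<phi> \<in> gal" by (rule frobenius_element(1)[OF p pD P card])
        have "(of_nat n * ?r - h ?\<phi>) + (h ?\<phi> - of_int (a p)) - of_int (int n * c - a p) \<in> P"
        proof (rule primes_over_diff[OF P primes_over_add[OF P]])
          show "of_nat n * ?r - h ?\<phi> \<in> P"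
            by (rule primes_over_dvd[OF P reduce_cong[OF p cop[OF \<phi>] h[OF \<phi>]]])
          show "h ?\<phi> - of_int (a p) \<in> P" using elim p P by blast
          show "of_int (int n * c - a p) \<in> P" using nc primes_over_of_int_iff[OF P p] by blast
        qed
        hence "of_int (int n) * (?r - of_int c) \<in> P" by (simp add: algebra_simps)
        thus ?thesis using primes_over_prime[OF P] primes_over_of_int_iff[OF P p] pn by blast
      qed
      moreover have "0 \<le> c" "c < int p" unfolding c_def using prime_gt_0_nat[OF p] by simp_all
      ultimately have Qc: "Q c" unfolding Q_def by blast
      have "c' = c" if Q: "Q c'" for c'
      proof -
        obtain P :: "'a algint set" where P: "P \<in> primes_over p" using primes_over_nonempty[OF p] by blast
        let ?r = "reduce p (g (frobenius_element p P))"
        have "(?r - of_int c) - (?r - of_int c') \<in> P"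
          using Q Qc P unfolding Q_def by (intro primes_over_diff[OF P, of "?r - of_int c"]) blast+
        hence "of_int (c' - c) \<in> P" by simp
        hence "int p dvd c' - c" using primes_over_of_int_iff[OF P p] by blast
        hence "c' mod int p = c mod int p" by (simp add: mod_eq_dvd_iff)
        thus ?thesis using Q Qc unfolding Q_def by simp
      qed
      hence "(THE c. Q c) = c" using Qc by (intro the_equality)
      moreover have "eval_frobenius g p = (THE c. Q c)"
        unfolding eval_frobenius_def Q_def using p unramified_not_dvd[OF p pD] cop by simp
      ultimately show "of_nat p dvd int n * eval_frobenius g p - a p" using nc by simp
    qed
  qed
  hence "prime_seq (\<lambda>p. int n * eval_frobenius g p) = prime_seq a" by (rule prime_seq_eqI)
  hence "of_nat n * prime_seq (eval_frobenius g) = of_nat n * s"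
    unfolding s by (simp add: of_nat_mod_primes prime_seq_mult)
  thus ?thesis by (rule mod_primes_mult_left_cancel[OF n])
qed

text \<open>\<open>a p\<close> is the trace of \<open>u' * v' ^ p\<close>. Modulo a fixed
  \<open>P\<close>, the Frobenius \<open>\<phi>\<close> replaces \<open>\<sigma>(v')\<^sup>p\<close>
  by \<open>\<phi>(\<sigma>(v'))\<close> for every \<open>\<sigma>\<close>; that gives the twisted
  trace at \<open>\<phi>\<close>, scaled by \<open>n * n\<close>.\<close>

lemma frobenius_value_twisted_trace:
  fixes u v :: 'a
  assumes n: "n > 0" and u: "of_nat n * u = of_algint u'" and v: "of_nat n * v = of_algint v'"
    and a: "\<And>p. of_int (a p) = (\<Sum>\<sigma>\<in>gal. gal_int \<sigma> (u' * v' ^ p))"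
    and s: "of_nat (n * n) * s = prime_seq a"
  shows "frobenius_value (twisted_trace u v) s"
proof (rule frobenius_valueI[OF _ _ _ s])
  define h where "h \<tau> = (\<Sum>\<sigma>\<in>gal. gal_int \<sigma> u' * gal_int \<tau> (gal_int \<sigma> v'))" for \<tau>
  show "n * n > 0" using n by simp
  show "of_nat (n * n) * twisted_trace u v \<tau> = of_algint (h \<tau>)" if \<tau>: "\<tau> \<in> gal" for \<tau>
  proof -
    have "of_nat (n * n) * (\<sigma> u * \<tau> (\<sigma> v)) = of_algint (gal_int \<sigma> u' * gal_int \<tau> (gal_int \<sigma> v'))"
      if \<sigma>: "\<sigma> \<in> gal" for \<sigma>
      by (simp add: times_algint.rep_eq of_algint_gal_int \<sigma> \<tau> gal_mult[OF \<sigma>] gal_mult[OF \<tau>]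
          gal_of_nat[OF \<sigma>] gal_of_nat[OF \<tau>] mult_ac flip: u v)
    thus ?thesis using \<tau> by (simp add: twisted_trace_def h_def sum_distrib_left of_algint_sum)
  qed
  show "\<forall>\<^sub>F p in sequentially. prime p \<longrightarrow>
      (\<forall>P\<in>primes_over p. h (frobenius_element p P) - of_int (a p) \<in> P)"
    using eventually_good_prime
  proof eventually_elim
    case (elim p)
    show ?case
    proof (intro impI ballI)
      fix P :: "'a algint set" assume p: "prime p" and P: "P \<in> primes_over p"
      let ?\<phi> = "frobenius_element p P"
      have "h ?\<phi> - of_int (a p) =
          (\<Sum>\<sigma>\<in>gal. gal_int \<sigma> u' * (gal_int ?\<phi> (gal_int \<sigma> v') - gal_int \<sigma> v' ^ p))"
      proof -
        have "gal_int \<sigma> (u' * v' ^ p) = gal_int \<sigma> u' * gal_int \<sigma> v' ^ p" if "\<sigma> \<in> gal" for \<sigma>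
          by (simp add: gal_int_mult[OF that] gal_int_power[OF that])
        thus ?thesis by (simp add: h_def a right_diff_distrib sum_subtractf)
      qed
      also have "\<dots> \<in> P"
        using elim frobenius_element(2)[OF p _ P]
        by (intro primes_over_sum[OF P] primes_over_mult[OF P]) blast
      finally show "h ?\<phi> - of_int (a p) \<in> P" .
    qed
  qed
qed

end


section \<open>The matrix of the Frobenius\<close>

lemma class_functionD:
  "g \<in> class_functions \<Longrightarrow> \<sigma> \<in> gal \<Longrightarrow> \<tau> \<in> gal \<Longrightarrow> g (\<sigma> \<circ> \<tau> \<circ> inv_into UNIV \<sigma>) = \<sigma> (g \<tau>)"
  unfolding class_functions_def by blast

lemma restrict_class_function:
  assumes "\<And>\<sigma> \<tau>. \<sigma> \<in> gal \<Longrightarrow> \<tau> \<in> gal \<Longrightarrow> f (\<sigma> \<circ> \<tau> \<circ> inv_into UNIV \<sigma>) = \<sigma> (f \<tau>)"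
  shows "restrict f gal \<in> class_functions"
proof -
  have "restrict f gal (\<sigma> \<circ> \<tau> \<circ> inv_into UNIV \<sigma>) = \<sigma> (restrict f gal \<tau>)"
    if "\<sigma> \<in> gal" "\<tau> \<in> gal" for \<sigma> \<tau>
    using assms[OF that] gal_comp[OF gal_comp[OF that] gal_inv[OF that(1)]] that(2) by simp
  thus ?thesis unfolding class_functions_def by simp
qed

lemma prime_seq_0: "prime_seq (\<lambda>_. 0) = 0"
  using of_nat_mod_primes[of 0] by simp

lemma prime_seq_sum: "prime_seq (\<lambda>p. \<Sum>i\<in>S. f i p) = (\<Sum>i\<in>S. prime_seq (f i))"
  by (induction S rule: infinite_finite_induct) (simp_all add: prime_seq_0 prime_seq_add[symmetric])

lemma of_A_prime_seq: "of_A (prime_seq f) = prime_seq (\<lambda>p. of_int (f p))"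
  by (simp add: prime_seq.abs_eq of_A.abs_eq)

lemma of_A_of_nat_mult: "of_A (of_nat n * a) = of_nat n * of_A a"
  by (metis of_A_mult of_A_of_int of_int_of_nat_eq)

lemma of_A_0: "of_A 0 = 0" and of_A_1: "of_A 1 = 1"
  by (metis of_A_of_int of_int_0, metis of_A_of_int of_int_1)

lemma of_A_diff: "of_A (a - b) = of_A a - of_A b"
  by (metis of_A_add diff_add_cancel add_diff_cancel_right')

lemma frobenius_mod_primes_prime_seq: "frobenius_mod_primes (prime_seq f) = prime_seq (\<lambda>p. f p ^ p)"
  by (simp add: prime_seq.abs_eq frobenius_mod_primes.abs_eq)

lemma frobenius_mod_primes_of_nat_mult:
  "frobenius_mod_primes (of_nat n * x) = of_nat n * frobenius_mod_primes x"
proof -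
  obtain f where f: "x = prime_seq f" by (rule prime_seq_exhaust)
  have "prime_seq (\<lambda>p. (of_nat n * f p) ^ p) = prime_seq (\<lambda>p. of_nat n * f p ^ p)"
  proof (rule prime_seq_eqI, intro always_eventually allI impI)
    fix p :: nat assume "prime p"
    hence "of_nat p dvd (of_int (int n) ^ p - of_int (int n)) * f p ^ p"
      by (intro dvd_mult2 of_nat_dvd_int_power_diff)
    thus "of_nat p dvd (of_nat n * f p) ^ p - of_nat n * f p ^ p"
      by (simp add: power_mult_distrib left_diff_distrib)
  qed
  thus ?thesis by (simp add: f of_nat_mod_primes prime_seq_mult frobenius_mod_primes_prime_seq)
qed

section \<open>The map \<open>tensor_iso\<close> in coordinates\<close>

lemma tensor_iso_diff: "tensor_iso (u - v) = tensor_iso u - tensor_iso v"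
proof -
  obtain f g where "u = abs_tensor_A f" "v = abs_tensor_A g"
    using tensor_A.abs_induct[of "\<lambda>u. \<exists>f. u = abs_tensor_A f"] by metis
  thus ?thesis by (simp add: minus_tensor_A.abs_eq tensor_iso.abs_eq frag_eval_diff)
qed

lemma tensor_iso_0: "tensor_iso 0 = 0"
  using tensor_iso_diff[of 0 0] by simp

lemma tensor_iso_add: "tensor_iso (u + v) = tensor_iso u + tensor_iso v"
  using tensor_iso_diff[of "u + v" v] by (simp add: eq_diff_eq)

lemma tensor_iso_sum: "tensor_iso (sum f S) = (\<Sum>i\<in>S. tensor_iso (f i))"
  by (induction S rule: infinite_finite_induct) (simp_all add: tensor_iso_0 tensor_iso_add)

lemma tensor_add_left: "(x + y) \<otimes>\<^sub>A a = x \<otimes>\<^sub>A a + y \<otimes>\<^sub>A a"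
  by transfer (use tensor_relations.add_left in \<open>simp add: algebra_simps\<close>)

lemma tensor_balanced: "(of_rat q * x) \<otimes>\<^sub>A a = x \<otimes>\<^sub>A scale_A q a"
  by transfer (rule tensor_relations.balanced)

lemma tensor_zero_left: "0 \<otimes>\<^sub>A a = 0"
  using tensor_add_left[of 0 0 a] by simp

lemma tensor_zero_right: "x \<otimes>\<^sub>A 0 = 0"
  using tensor_add_right[of x 0 0] by simp

lemma tensor_diff_right: "x \<otimes>\<^sub>A (a - b) = x \<otimes>\<^sub>A a - x \<otimes>\<^sub>A b"
  using tensor_add_right[of x "a - b" b] by (simp add: eq_diff_eq)

lemma tensor_sum_left: "sum f S \<otimes>\<^sub>A a = (\<Sum>i\<in>S. f i \<otimes>\<^sub>A a)"
  by (induction S rule: infinite_finite_induct) (simp_all add: tensor_zero_left tensor_add_left)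

lemma tensor_basis_expand:
  fixes B :: "'a :: number_field set" and t :: "'a tensor_A"
  assumes B: "Q_basis B"
  shows "\<exists>a. t = (\<Sum>b\<in>B. b \<otimes>\<^sub>A a b)"
proof (induction t rule: tensor_A_induct)
  case zero
  show ?case by (intro exI[of _ "\<lambda>_. 0"]) (simp add: tensor_zero_right)
next
  case (tensor x a)
  have "x \<otimes>\<^sub>A a = (\<Sum>b\<in>B. of_rat (L.representation B x b) * b) \<otimes>\<^sub>A a"
    unfolding Q_basis_expand[OF B] ..
  thus ?case unfolding tensor_sum_left tensor_balanced by (intro exI)
next
  case (diff u v)
  then obtain a a' where "u = (\<Sum>b\<in>B. b \<otimes>\<^sub>A a b)" "v = (\<Sum>b\<in>B. b \<otimes>\<^sub>A a' b)" by blast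
  hence "u - v = (\<Sum>b\<in>B. b \<otimes>\<^sub>A (a b - a' b))" by (simp add: tensor_diff_right sum_subtractf)
  thus ?case by (intro exI)
qed

lemma tensor_iso_basis: "tensor_iso (\<Sum>b\<in>B. b \<otimes>\<^sub>A a b) = (\<Sum>b\<in>B. embed_L b * of_A (a b))"
  by (simp add: tensor_iso_sum tensor_iso_tensor)

section \<open>The basis of the tensor product and the matrix entries\<close>

context integral_dual_basis
begin

context
  assumes B: "Q_basis B"
begin

text \<open>Compare the trivial expansion of \<open>b\<close> with the one by traces. The
  coefficients are rational, so linear independence of \<open>B\<close> over the rationals
  applies.\<close>

lemma trace_dual:
  assumes "b \<in> B" "c \<in> B"
  shows "trace (d c * b) = (if c = b then 1 else 0)"
proof -
  define q where "q c = (SOME r. trace (d c * b) = of_rat r)" for c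
  have q: "trace (d c * b) = of_rat (q c)" for c
    unfolding q_def by (rule someI_ex) (rule trace_rat[OF gal])
  have "(\<Sum>c\<in>B. of_rat (q c - (if c = b then 1 else 0)) * c) =
      (\<Sum>c\<in>B. trace (d c * b) * c) - (\<Sum>c\<in>B. if c = b then c else 0)"
    unfolding sum_subtractf[symmetric] by (intro sum.cong) (auto simp: q of_rat_diff left_diff_distrib)
  also have "\<dots> = 0"
    using assms(1) Q_basis_finite[OF B] by (simp add: trace_dual_basis_expand[OF dual])
  finally have "q c - (if c = b then 1 else 0) = 0"
    using B Q_basis_finite[OF B] assms(2) unfolding Q_basis_def
    by (intro L.independentD[of B B "\<lambda>c. q c - (if c = b then 1 else 0)"]) auto
  thus ?thesis unfolding q by (cases "c = b") simp_all
qed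

text \<open>Multiplying by \<open>D\<close> represents the relation by combinations
  \<open>z p\<close> of the \<open>\<beta> b\<close>, which are divisible by \<open>p\<close> for
  large \<open>p\<close>. The trace of \<open>\<delta> c * z p\<close> isolates
  \<open>D * D * f c p\<close>, and it is a multiple of \<open>p\<close>.\<close>

lemma embed_L_basis_independent:
  assumes zero: "(\<Sum>b\<in>B. embed_L b * of_A (a b)) = 0" and c: "c \<in> B"
  shows "a c = 0"
proof -
  define f where "f b = (SOME f. a b = prime_seq f)" for b
  have "\<exists>f. a b = prime_seq f" for b by (rule prime_seq_exhaust[of "a b"]) blast
  hence f: "a b = prime_seq (f b)" for b unfolding f_def by (rule someI_ex)
  define z where "z p = (\<Sum>b\<in>B. \<beta> b * of_int (f b p))" for p
  have "prime_seq z = (\<Sum>b\<in>B. prime_seq (\<lambda>_. \<beta> b) * of_A (a b))"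
    by (simp add: z_def[abs_def] prime_seq_sum f of_A_prime_seq prime_seq_mult)
  also have "\<dots> = (\<Sum>b\<in>B. of_nat D * (embed_L b * of_A (a b)))"
    by (intro sum.cong refl) (simp add: embed_L_eqI[OF D \<beta>, symmetric] mult.assoc)
  also have "\<dots> = prime_seq (\<lambda>_. 0)" by (simp add: sum_distrib_left[symmetric] zero prime_seq_0)
  finally have "\<forall>\<^sub>F p in sequentially. prime p \<longrightarrow> of_nat p dvd z p"
    by (simp add: prime_seq_eq_iff eq_mod_primes_def)
  hence "\<forall>\<^sub>F p in sequentially. prime p \<longrightarrow> of_nat p dvd f c p - 0"
    using eventually_good_prime
  proof eventually_elim
    case (elim p)
    show ?case
    proof
      assume p: "prime p"
      obtain y where y: "z p = of_nat p * y" using elim p by (auto elim: dvdE)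
      obtain k where k: "trace (of_algint (\<delta> c * y)) = of_int k"
        using trace_int[OF gal algebraic_int_of_algint[of "\<delta> c * y"]] .
      have "of_algint (\<delta> c * z p) = (\<Sum>b\<in>B. of_int (int (D * D) * f b p) * (d c * b))"
        unfolding z_def sum_distrib_left of_algint_sum
        by (intro sum.cong refl) (simp add: of_algint_simps mult_ac flip: \<beta> \<delta>[OF c])
      hence "trace (of_algint (\<delta> c * z p)) = (\<Sum>b\<in>B. of_int (int (D * D) * f b p) * trace (d c * b))"
        by (simp only: trace_sum trace_of_int_mult)
      also have "\<dots> = (\<Sum>b\<in>B. if c = b then of_int (int (D * D) * f b p) else 0)"
        using c by (intro sum.cong refl) (simp add: trace_dual)
      also have "\<dots> = of_int (int (D * D) * f c p)" using c Q_basis_finite[OF B] by simp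
      finally have "of_int (int (D * D) * f c p) = trace (of_nat p * of_algint (\<delta> c * y))"
        by (simp add: y of_algint_simps mult_ac)
      also have "\<dots> = of_int (int p * k)" unfolding trace_of_nat_mult k by simp
      finally have "int p dvd int (D * D) * f c p" by (metis dvd_triv_left of_int_eq_iff)
      thus "of_nat p dvd f c p - 0"
        using elim not_dvd_DD[OF p] p prime_dvd_mult_iff[of "int p" "int (D * D)" "f c p"] by simp
    qed
  qed
  thus "a c = 0" unfolding f prime_seq_0[symmetric] by (rule prime_seq_eqI)
qed

lemma tensor_basis_inject:
  assumes "(\<Sum>b\<in>B. embed_L b * of_A (a b)) = (\<Sum>b\<in>B. embed_L b * of_A (a' b))" "c \<in> B"
  shows "a c = a' c"
  using embed_L_basis_independent[of "\<lambda>b. a b - a' b", OF _ assms(2)] assms(1)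
  by (simp add: of_A_diff right_diff_distrib sum_subtractf)

text \<open>Makes the inverse in \<open>frobenius_A\<close> undo \<open>tensor_iso\<close>; that the
  relevant powers lie in the image is seen in \<open>frobenius_A_basis\<close>, where a preimage is
  exhibited.\<close>

lemma inj_tensor_iso: "inj (tensor_iso :: 'a tensor_A \<Rightarrow> _)"
proof (rule injI)
  fix t t' :: "'a tensor_A" assume eq: "tensor_iso t = tensor_iso t'"
  obtain a a' where a: "t = (\<Sum>b\<in>B. b \<otimes>\<^sub>A a b)" "t' = (\<Sum>b\<in>B. b \<otimes>\<^sub>A a' b)"
    using tensor_basis_expand[OF B] by metis
  have "a c = a' c" if "c \<in> B" for c
    using eq that unfolding a tensor_iso_basis by (rule tensor_basis_inject)
  thus "t = t'" unfolding a by simp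
qed

lemma inj_on_tensor_1: "inj_on (\<lambda>b. b \<otimes>\<^sub>A 1) B"
proof (rule inj_onI)
  fix b c assume bc: "b \<in> B" "c \<in> B" "b \<otimes>\<^sub>A 1 = c \<otimes>\<^sub>A 1"
  have sum: "(\<Sum>b'\<in>B. embed_L b' * of_A (if b' = x then 1 else 0)) = tensor_iso (x \<otimes>\<^sub>A 1)" if "x \<in> B" for x
    using that Q_basis_finite[OF B]
    by (simp add: tensor_iso_tensor if_distrib of_A_0 of_A_1 cong: if_cong)
  have "(if b = b then 1 else 0) = (if b = c then 1 else 0 :: ring_A)"
    by (rule tensor_basis_inject[OF _ bc(1)]) (simp add: sum bc)
  thus "b = c" by (simp split: if_splits)
qed

lemma independent_tensor_basis: "tensor_A.independent ((\<lambda>b. b \<otimes>\<^sub>A 1) ` B)"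
  unfolding tensor_A.dependent_finite[OF finite_imageI[OF Q_basis_finite[OF B]]]
proof
  assume "\<exists>u. (\<exists>v\<in>(\<lambda>b. b \<otimes>\<^sub>A 1) ` B. u v \<noteq> 0) \<and> (\<Sum>v\<in>(\<lambda>b. b \<otimes>\<^sub>A 1) ` B. scale_tensor (u v) v) = 0"
  then obtain u c where u: "(\<Sum>v\<in>(\<lambda>b. b \<otimes>\<^sub>A 1) ` B. scale_tensor (u v) v) = 0"
    and c: "c \<in> B" "u (c \<otimes>\<^sub>A 1) \<noteq> 0" by blast
  have "(\<Sum>b\<in>B. b \<otimes>\<^sub>A u (b \<otimes>\<^sub>A 1)) = 0"
    using u by (simp add: sum.reindex[OF inj_on_tensor_1] scale_tensor_tensor)
  hence "(\<Sum>b\<in>B. embed_L b * of_A (u (b \<otimes>\<^sub>A 1))) = 0"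
    unfolding tensor_iso_basis[symmetric] by (simp add: tensor_iso_0)
  hence "u (c \<otimes>\<^sub>A 1) = 0" by (rule embed_L_basis_independent[OF _ c(1)])
  thus False using c(2) by simp
qed

lemma representation_tensor_basis:
  assumes x: "x \<in> B"
  shows "tensor_A.representation ((\<lambda>b. b \<otimes>\<^sub>A 1) ` B) (\<Sum>b\<in>B. b \<otimes>\<^sub>A a b) (x \<otimes>\<^sub>A 1) = a x"
proof -
  let ?I = "(\<lambda>b::'a. b \<otimes>\<^sub>A 1) ` B" and ?t = "\<Sum>b\<in>B. b \<otimes>\<^sub>A a b"
  let ?r = "tensor_A.representation ?I ?t"
  have "b \<otimes>\<^sub>A a b \<in> tensor_A.span ?I" if "b \<in> B" for b
    using tensor_A.span_scale[OF tensor_A.span_base[of "b \<otimes>\<^sub>A 1" ?I], of "a b"] that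
    by (simp add: scale_tensor_tensor)
  hence "?t \<in> tensor_A.span ?I" by (intro tensor_A.span_sum)
  hence "(\<Sum>v\<in>?I. scale_tensor (?r v) v) = ?t"
    using Q_basis_finite[OF B] by (intro tensor_A.sum_representation_eq independent_tensor_basis) auto
  hence "(\<Sum>b\<in>B. b \<otimes>\<^sub>A ?r (b \<otimes>\<^sub>A 1)) = ?t"
    by (simp add: sum.reindex[OF inj_on_tensor_1] scale_tensor_tensor)
  from arg_cong[OF this, of tensor_iso] show ?thesis
    unfolding tensor_iso_basis using x by (rule tensor_basis_inject)
qed

text \<open>Expanding \<open>\<beta> c ^ p\<close> for every \<open>p\<close> gives integers
  \<open>t p b = Tr(\<delta>\<^sub>b \<beta>\<^sub>c\<^sup>p)\<close>; divided by
  \<open>D * D\<close> modulo \<open>p\<close>, they form column \<open>c\<close> of the matrix.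
  They are also the integers required by \<open>frobenius_value_twisted_trace\<close>.\<close>

lemma frobenius_A_basis:
  assumes c: "c \<in> B"
  obtains s where "\<And>b. b \<in> B \<Longrightarrow> frobenius_value (twisted_trace (d b) c) (s b)"
    "frobenius_A (c \<otimes>\<^sub>A 1) = (\<Sum>b\<in>B. b \<otimes>\<^sub>A s b)"
proof -
  have "\<exists>t. \<forall>p. (\<forall>b\<in>B. of_int (t p b) = (\<Sum>\<sigma>\<in>gal. gal_int \<sigma> (\<delta> b * \<beta> c ^ p))) \<and>
     of_nat (D * D) * \<beta> c ^ p = (\<Sum>b\<in>B. of_int (t p b) * \<beta> b)"
    by (rule choice) (intro allI int_trace_expand)
  then obtain t where t: "\<And>p b. b \<in> B \<Longrightarrow> of_int (t p b) = (\<Sum>\<sigma>\<in>gal. gal_int \<sigma> (\<delta> b * \<beta> c ^ p))"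
    and exp: "\<And>p. of_nat (D * D) * \<beta> c ^ p = (\<Sum>b\<in>B. of_int (t p b) * \<beta> b)"
    by blast
  \<comment> \<open>Division by \<open>D * D\<close>; at the finitely many primes dividing
    \<open>D\<close> the value is immaterial.\<close>
  define s where "s b = prime_seq (\<lambda>p. t p b * modular_inverse (int p) (int (D * D)))" for b
  have s: "of_nat (D * D) * s b = prime_seq (\<lambda>p. t p b)" for b
  proof -
    have "prime_seq (\<lambda>p. modular_inverse (int p) (int (D * D)) * 1) * of_nat (D * D) = prime_seq (\<lambda>_. 1)"
      using prime_seq_modular_inverse[of "D * D" "1::int"] D by (simp add: mult.commute)
    hence "prime_seq (\<lambda>p. t p b) * (prime_seq (\<lambda>p. modular_inverse (int p) (int (D * D)) * 1) * of_nat (D * D))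
        = prime_seq (\<lambda>p. t p b)"
      by (simp add: prime_seq_mult)
    thus ?thesis by (simp add: s_def prime_seq_mult[symmetric] mult_ac)
  qed
  show ?thesis
  proof (rule that)
    show "frobenius_value (twisted_trace (d b) c) (s b)" if "b \<in> B" for b
      by (rule frobenius_value_twisted_trace[OF D \<delta>[OF that] \<beta>[OF c] t[OF that] s])
    \<comment> \<open>One factor \<open>D\<close> clears \<open>embed_L b\<close> and two clear
      \<open>s b\<close>. On the Frobenius side one factor passes through the \<open>p\<close>-th
      power by Fermat.\<close>
    have "of_nat (D * D * D) * (\<Sum>b\<in>B. embed_L b * of_A (s b)) =
        (\<Sum>b\<in>B. (of_nat D * embed_L b) * of_A (of_nat (D * D) * s b))"
      unfolding of_A_of_nat_mult by (simp add: sum_distrib_left mult_ac)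
    also have "\<dots> = (\<Sum>b\<in>B. prime_seq (\<lambda>p. \<beta> b * of_int (t p b)))"
      by (intro sum.cong refl) (simp only: embed_L_eqI[OF D \<beta>] s of_A_prime_seq prime_seq_mult)
    also have "\<dots> = prime_seq (\<lambda>p. of_nat (D * D) * \<beta> c ^ p)"
      unfolding prime_seq_sum[symmetric] exp by (simp only: mult.commute)
    also have "\<dots> = of_nat (D * D) * frobenius_mod_primes (of_nat D * embed_L c)"
      unfolding embed_L_eqI[OF D \<beta>[OF c]] frobenius_mod_primes_prime_seq
      by (simp only: of_nat_mod_primes prime_seq_mult)
    also have "\<dots> = of_nat (D * D * D) * frobenius_mod_primes (embed_L c)"
      by (simp add: frobenius_mod_primes_of_nat_mult mult.assoc)
    finally have "(\<Sum>b\<in>B. embed_L b * of_A (s b)) = frobenius_mod_primes (embed_L c)"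
      by (rule mod_primes_mult_left_cancel[rotated]) (use D in simp)
    hence "frobenius_mod_primes (tensor_iso (c \<otimes>\<^sub>A 1)) = tensor_iso (\<Sum>b\<in>B. b \<otimes>\<^sub>A s b)"
      by (simp add: tensor_iso_basis tensor_iso_tensor of_A_1)
    thus "frobenius_A (c \<otimes>\<^sub>A 1) = (\<Sum>b\<in>B. b \<otimes>\<^sub>A s b)"
      by (simp add: frobenius_A_def inv_f_f[OF inj_tensor_iso])
  qed
qed

lemma frobenius_value_matrix_A:
  assumes "b \<in> B" "c \<in> B"
  shows "frobenius_value (twisted_trace (d b) c) (matrix_A B frobenius_A b c)"
proof -
  obtain s where "\<And>b. b \<in> B \<Longrightarrow> frobenius_value (twisted_trace (d b) c) (s b)"
    "frobenius_A (c \<otimes>\<^sub>A 1) = (\<Sum>b\<in>B. b \<otimes>\<^sub>A s b)"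
    using frobenius_A_basis[OF assms(2)] by blast
  thus ?thesis using assms(1) by (simp add: matrix_A_def representation_tensor_basis)
qed

text \<open>The rational coefficients that expand \<open>g\<close> in twisted traces also combine
  the matrix entries, because \<open>frobenius_value\<close> is linear.\<close>

lemma class_function_frobenius_value:
  fixes g :: "('a \<Rightarrow> 'a) \<Rightarrow> 'a"
  assumes "g \<in> class_functions"
  obtains q where "frobenius_value g (\<Sum>b\<in>B. \<Sum>c\<in>B. scale_A (q b c) (matrix_A B frobenius_A b c))"
proof -
  obtain q where q: "\<And>\<sigma>. \<sigma> \<in> gal \<Longrightarrow> g \<sigma> = (\<Sum>b\<in>B. \<Sum>c\<in>B. of_rat (q b c) * twisted_trace (d b) c \<sigma>)"
    using class_function_expand[OF dual gal assms] by blast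
  have "frobenius_value (\<lambda>\<sigma>. \<Sum>b\<in>B. \<Sum>c\<in>B. of_rat (q b c) * twisted_trace (d b) c \<sigma>)
      (\<Sum>b\<in>B. \<Sum>c\<in>B. scale_A (q b c) (matrix_A B frobenius_A b c))"
    by (intro frobenius_value_sum frobenius_value_scale frobenius_value_matrix_A)
  hence "frobenius_value g (\<Sum>b\<in>B. \<Sum>c\<in>B. scale_A (q b c) (matrix_A B frobenius_A b c))"
    by (rule frobenius_value_cong) (rule q)
  thus ?thesis by (rule that)
qed

lemma span_matrix_A:
  "A.span {matrix_A B frobenius_A x y | x y. x \<in> B \<and> y \<in> B} =
   {prime_seq (eval_frobenius g) | g :: ('a \<Rightarrow> 'a) \<Rightarrow> 'a. g \<in> class_functions}" (is "A.span ?M = ?R")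
proof
  have R: "s \<in> ?R" if "frobenius_value g s" "g \<in> class_functions" for s and g :: "('a \<Rightarrow> 'a) \<Rightarrow> 'a"
    using eval_frobenius_eqI[OF that(1)] that(2) by blast
  \<comment> \<open>\<open>eval_frobenius\<close> is defined by a description of residues and is not
    visibly linear in \<open>g\<close>. Linearity is taken from \<open>frobenius_value\<close>,
    which holds for some element by the expansion of \<open>g\<close>, and that element is this one
    by \<open>eval_frobenius_eqI\<close>.\<close>
  have val: "frobenius_value g (prime_seq (eval_frobenius g))" if g: "g \<in> class_functions" for g :: "('a \<Rightarrow> 'a) \<Rightarrow> 'a"
  proof -
    obtain q where q: "frobenius_value g (\<Sum>b\<in>B. \<Sum>c\<in>B. scale_A (q b c) (matrix_A B frobenius_A b c))"
      using class_function_frobenius_value[OF g] .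
    show ?thesis using eval_frobenius_eqI[OF q] q by simp
  qed
  show "A.span ?M \<subseteq> ?R"
  proof (rule A.span_minimal)
    show "?M \<subseteq> ?R"
    proof
      fix s assume "s \<in> ?M"
      then obtain b c where bc: "b \<in> B" "c \<in> B" and s: "s = matrix_A B frobenius_A b c" by blast
      show "s \<in> ?R" unfolding s
        by (rule R[OF frobenius_value_matrix_A[OF bc] twisted_trace_class_function])
    qed
    show "A.subspace ?R"
    proof (rule A.subspaceI)
      show "0 \<in> ?R"
      proof (rule R)
        \<comment> \<open>Restriction keeps the function extensional, as
          \<open>class_functions\<close> demands.\<close>
        show "frobenius_value (restrict (\<lambda>_. 0) gal) 0"
          by (rule frobenius_value_cong[OF frobenius_value_0]) simp
        show "restrict (\<lambda>_. 0) gal \<in> class_functions"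
          by (rule restrict_class_function) (simp only: gal_0)
      qed
    next
      fix s s' assume "s \<in> ?R" "s' \<in> ?R"
      then obtain g g' :: "('a \<Rightarrow> 'a) \<Rightarrow> 'a" where g: "g \<in> class_functions" "s = prime_seq (eval_frobenius g)"
        and g': "g' \<in> class_functions" "s' = prime_seq (eval_frobenius g')" by blast
      show "s + s' \<in> ?R"
      proof (rule R)
        show "frobenius_value (restrict (\<lambda>\<tau>. g \<tau> + g' \<tau>) gal) (s + s')"
          unfolding g(2) g'(2)
          by (rule frobenius_value_cong[OF frobenius_value_add[OF val[OF g(1)] val[OF g'(1)]]]) simp
        show "restrict (\<lambda>\<tau>. g \<tau> + g' \<tau>) gal \<in> class_functions"
          by (rule restrict_class_function)
            (simp only: class_functionD[OF g(1)] class_functionD[OF g'(1)] gal_add)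
      qed
    next
      fix s and q :: rat assume "s \<in> ?R"
      then obtain g :: "('a \<Rightarrow> 'a) \<Rightarrow> 'a" where g: "g \<in> class_functions" "s = prime_seq (eval_frobenius g)"
        by blast
      show "scale_A q s \<in> ?R"
      proof (rule R)
        show "frobenius_value (restrict (\<lambda>\<tau>. of_rat q * g \<tau>) gal) (scale_A q s)"
          unfolding g(2)
          by (rule frobenius_value_cong[OF frobenius_value_scale[OF val[OF g(1)]]]) simp
        show "restrict (\<lambda>\<tau>. of_rat q * g \<tau>) gal \<in> class_functions"
          by (rule restrict_class_function)
            (simp only: class_functionD[OF g(1)] gal_mult gal_of_rat)
      qed
    qed
  qed
  show "?R \<subseteq> A.span ?M"
  proof
    fix s assume "s \<in> ?R"
    then obtain g :: "('a \<Rightarrow> 'a) \<Rightarrow> 'a" where g: "g \<in> class_functions" "s = prime_seq (eval_frobenius g)"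
      by blast
    obtain q where q: "frobenius_value g (\<Sum>b\<in>B. \<Sum>c\<in>B. scale_A (q b c) (matrix_A B frobenius_A b c))"
      using class_function_frobenius_value[OF g(1)] .
    show "s \<in> A.span ?M" unfolding g(2) eval_frobenius_eqI[OF q]
      by (intro A.span_sum A.span_scale A.span_base) blast
  qed
qed

end

end

theorem theorem4p2:
  fixes B :: "'a :: number_field set"
  assumes "galois TYPE('a)"
    and "Q_basis B"
  shows "A.span {matrix_A B frobenius_A x y | x y. x \<in> B \<and> y \<in> B} =
         {prime_seq (eval_frobenius g) | g :: ('a \<Rightarrow> 'a) \<Rightarrow> 'a. g \<in> class_functions}"
proof -
  obtain d where d: "dual_basis B d" by (rule exists_dual_basis[OF assms(2)])
  obtain D where D: "D > 0" "\<And>x. x \<in> B \<union> d ` B \<Longrightarrow> algebraic_int (of_nat D * x)"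
    using common_denom[of "B \<union> d ` B"] Q_basis_finite[OF assms(2)] by auto
  interpret integral_dual_basis B d D "\<lambda>b. to_algint (of_nat D * b)" "\<lambda>b. to_algint (of_nat D * d b)"
    using assms(1) d D by unfold_locales (auto simp: of_to_algint)
  show ?thesis by (rule span_matrix_A[OF assms(2)])
qed

end
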